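(* Let $B$ be a simple (unital) AH algebra with diagonal maps. Then $B$ is singly generated, i.e., there is an element $b\in B$ such that the smallest C*-subalgebra of $B$ containing $b$ is $B$ itself.
   Context: $\mathbb N=\{1,2,3,\dots\}$. Given an inductive sequence $(B_i,\phi_i)_{i\in\mathbb N}$ of C*-algebras, $\phi_i\colon B_i\to B_{i+1}$, put $\phi_{i,i+1}=\phi_i$ and $\phi_{i,i'}=\phi_{i'-1}\circ\cdots\circ\phi_i$ for $i'>i+1$. AH algebra with diagonal maps. Let $B$ be the limit of an inductive sequence $(B_i,\phi_i)_{i\in\mathbb N}$ of unital C*-algebras with each $\phi_i$ unital. $B$ is called a (unital) AH algebra with diagonal maps if $B_i=\bigoplus_{1\le j\le K_i}\mathrm{M}_{n_{i,j}}(\mathrm{C}(X_{i,j}))$, where $X_{i,j}$ is a (nonempty) compact connected metric space and $n_{i,j},K_i\in\mathbb N$, and if for any $i'>i$ the restriction of $\phi_{i,i'}$ to any direct summands $\mathrm{M}_{n_{i,j}}(\mathrm{C}(X_{i,j}))$ and $\mathrm{M}_{n_{i',j'}}(\mathrm{C}(X_{i',j'}))$ has a seed of the form $f\mapsto 0$ or $f\mapsto\mathrm{diag}\{f\circ\lambda_1,\dots,f\circ\lambda_m\}$ for some continuous maps $\lambda_1,\dots,\lambda_m\colon X_{i',j'}\to X_{i,j}$. Here "a map $\mathrm{M}_n(\mathrm{C}(X))\to\mathrm{M}_{n'}(\mathrm{C}(Y))$ has seed $f\mapsto\mathrm{diag}\{f\circ\lambda_1,\dots,f\circ\lambda_m\}$"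 means that, up to a fixed permutation of the $n'$ coordinates, it is $F\mapsto\mathrm{diag}\{F\circ\lambda_1,\dots,F\circ\lambda_m,0,\dots,0\}$ (it is the amplification of the seed to $n\times n$ matrices, placed in a diagonal corner); seed $f\mapsto0$ means the map is zero. *)

theory Defs
  imports
    "HOL-Analysis.Abstract_Metric_Spaces"
    "HOL-Analysis.L2_Norm"
    "HOL-Combinatorics.Permutations"
    "Jordan_Normal_Form.Matrix"
begin

section \<open>Unital C*-algebras\<close>

text \<open>
  The superclass \<^class>\<open>real_normed_algebra_1\<close> excludes the zero algebra. This loses nothing here:
  a limit of nonzero unital C*-algebras along unital *-homomorphisms satisfies \<open>\<parallel>1\<parallel> = 1\<close>.
\<close>

class unital_cstar_algebra = real_normed_algebra_1 + banach +
  fixes scaleC :: "complex \<Rightarrow> 'a \<Rightarrow> 'a"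
    and adj :: "'a \<Rightarrow> 'a"
  assumes scaleR_eq_scaleC: "scaleR r x = scaleC (complex_of_real r) x"
    and scaleC_add_right: "scaleC c (x + y) = scaleC c x + scaleC c y"
    and scaleC_add_left: "scaleC (c + d) x = scaleC c x + scaleC d x"
    and scaleC_scaleC: "scaleC c (scaleC d x) = scaleC (c * d) x"
    and scaleC_one: "scaleC 1 x = x"
    and mult_scaleC_left: "scaleC c x * y = scaleC c (x * y)"
    and mult_scaleC_right: "x * scaleC c y = scaleC c (x * y)"
    and norm_scaleC: "norm (scaleC c x) = cmod c * norm x"
    and adj_add: "adj (x + y) = adj x + adj y"
    and adj_scaleC: "adj (scaleC c x) = scaleC (cnj c) (adj x)"
    and adj_mult: "adj (x * y) = adj y * adj x"
    and adj_adj: "adj (adj x) = x"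
    and norm_adj_mult: "norm (adj x * x) = (norm x)\<^sup>2"

text \<open>C*-subalgebras need not contain the unit.\<close>

definition cstar_subalgebra :: "'a::unital_cstar_algebra set \<Rightarrow> bool" where
  "cstar_subalgebra S \<longleftrightarrow>
     0 \<in> S \<and> (\<forall>x\<in>S. \<forall>y\<in>S. x + y \<in> S \<and> x * y \<in> S) \<and>
     (\<forall>c. \<forall>x\<in>S. scaleC c x \<in> S) \<and> (\<forall>x\<in>S. adj x \<in> S) \<and> closed S"

definition cstar_generated :: "'a::unital_cstar_algebra \<Rightarrow> 'a set" where
  "cstar_generated b = \<Inter>{S. cstar_subalgebra S \<and> b \<in> S}"

definition singly_generated :: "'a::unital_cstar_algebra itself \<Rightarrow> bool" where
  "singly_generated _ \<longleftrightarrow> (\<exists>b::'a. cstar_generated b = UNIV)"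

definition closed_two_sided_ideal :: "'a::unital_cstar_algebra set \<Rightarrow> bool" where
  "closed_two_sided_ideal I \<longleftrightarrow>
     0 \<in> I \<and> (\<forall>x\<in>I. \<forall>y\<in>I. x + y \<in> I) \<and> (\<forall>c. \<forall>x\<in>I. scaleC c x \<in> I) \<and>
     (\<forall>a. \<forall>x\<in>I. a * x \<in> I \<and> x * a \<in> I) \<and> closed I"

definition simple_cstar :: "'a::unital_cstar_algebra itself \<Rightarrow> bool" where
  "simple_cstar _ \<longleftrightarrow> (\<forall>I::'a set. closed_two_sided_ideal I \<longrightarrow> I = {0} \<or> I = UNIV)"


section \<open>Normed *-algebras with explicit carrier\<close>

text \<open>
  The members of an inductive sequence vary with the index, so they are represented as records
  over one common type of elements.
\<close>

record 'a nstar_alg = "(complex, 'a) module" +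
  star :: "'a \<Rightarrow> 'a"
  nrm :: "'a \<Rightarrow> real"

definition type_alg :: "'a::unital_cstar_algebra nstar_alg" where
  "type_alg = \<lparr>carrier = UNIV, monoid.mult = (*), one = 1, zero = 0, add = (+), smult = scaleC,
     star = adj, nrm = norm\<rparr>"

definition unital_star_hom :: "'a nstar_alg \<Rightarrow> 'b nstar_alg \<Rightarrow> ('a \<Rightarrow> 'b) \<Rightarrow> bool" where
  "unital_star_hom A B h \<longleftrightarrow>
     h \<in> ring_hom A B \<and>
     (\<forall>c. \<forall>a\<in>carrier A. h (smult A c a) = smult B c (h a)) \<and>
     (\<forall>a\<in>carrier A. h (star A a) = star B (h a))"

definition direct_sum :: "nat \<Rightarrow> (nat \<Rightarrow> 'a nstar_alg) \<Rightarrow> (nat \<Rightarrow> 'a) nstar_alg" where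
  "direct_sum K A =
     \<lparr>carrier = (\<Pi>\<^sub>E j\<in>{..<K}. carrier (A j)),
      monoid.mult = (\<lambda>f g. \<lambda>j\<in>{..<K}. monoid.mult (A j) (f j) (g j)),
      one = (\<lambda>j\<in>{..<K}. one (A j)),
      zero = (\<lambda>j\<in>{..<K}. zero (A j)),
      add = (\<lambda>f g. \<lambda>j\<in>{..<K}. add (A j) (f j) (g j)),
      smult = (\<lambda>c f. \<lambda>j\<in>{..<K}. smult (A j) c (f j)),
      star = (\<lambda>f. \<lambda>j\<in>{..<K}. star (A j) (f j)),
      nrm = (\<lambda>f. MAX j\<in>{..<K}. nrm (A j) (f j))\<rparr>"


section \<open>Inductive sequences and their limits\<close>

text \<open>\<open>conn \<phi> i k\<close> is the connecting map \<open>\<phi>\<^bsub>i,i+k\<^esub>\<close>.\<close>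

primrec conn :: "(nat \<Rightarrow> 'a \<Rightarrow> 'a) \<Rightarrow> nat \<Rightarrow> nat \<Rightarrow> 'a \<Rightarrow> 'a" where
  "conn \<phi> i 0 = id"
| "conn \<phi> i (Suc k) = \<phi> (i + k) \<circ> conn \<phi> i k"

definition unital_inductive_sequence ::
    "(nat \<Rightarrow> 'a nstar_alg) \<Rightarrow> (nat \<Rightarrow> 'a \<Rightarrow> 'a) \<Rightarrow> bool" where
  "unital_inductive_sequence A \<phi> \<longleftrightarrow> (\<forall>i. unital_star_hom (A i) (A (Suc i)) (\<phi> i))"

text \<open>
  The C*-algebra on the type \<open>'b\<close>, with canonical maps \<open>\<mu> i\<close>, is the completion of the algebraic
  direct limit with respect to the C*-seminorm \<open>lim\<^sub>k \<parallel>\<phi>\<^bsub>i,i+k\<^esub> a\<parallel>\<close>: the maps \<open>\<mu> i\<close> induce an isometric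
  *-homomorphism with dense range from the algebraic limit modulo null vectors.
\<close>

definition inductive_limit ::
    "(nat \<Rightarrow> 'a nstar_alg) \<Rightarrow> (nat \<Rightarrow> 'a \<Rightarrow> 'a) \<Rightarrow> (nat \<Rightarrow> 'a \<Rightarrow> 'b::unital_cstar_algebra) \<Rightarrow> bool"
  where
  "inductive_limit A \<phi> \<mu> \<longleftrightarrow>
     (\<forall>i. unital_star_hom (A i) type_alg (\<mu> i)) \<and>
     (\<forall>i. \<forall>a\<in>carrier (A i). \<mu> (Suc i) (\<phi> i a) = \<mu> i a) \<and>
     (\<forall>i. \<forall>a\<in>carrier (A i). (\<lambda>k. nrm (A (i + k)) (conn \<phi> i k a)) \<longlonglongrightarrow> norm (\<mu> i a)) \<and>
     closure (\<Union>i. \<mu> i ` carrier (A i)) = UNIV"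


section \<open>AH algebras with diagonal maps\<close>

definition vec_l2 :: "complex Matrix.vec \<Rightarrow> real" where
  "vec_l2 v = L2_set (\<lambda>i. cmod (vec_index v i)) {..<dim_vec v}"

definition mat_opnorm :: "complex mat \<Rightarrow> real" where
  "mat_opnorm M = (SUP v\<in>{v \<in> carrier_vec (dim_col M). vec_l2 v \<le> 1}. vec_l2 (M *\<^sub>v v))"

text \<open>\<open>mat_C n X\<close> is \<open>M\<^sub>n(C(X))\<close>, with elements regarded as continuous matrix-valued functions.\<close>

definition mat_C :: "nat \<Rightarrow> 'x metric \<Rightarrow> ('x \<Rightarrow> complex mat) nstar_alg" where
  "mat_C n X =
     \<lparr>carrier = {F \<in> mspace X \<rightarrow>\<^sub>E carrier_mat n n.
        \<forall>a<n. \<forall>b<n. continuous_map (mtopology_of X) euclidean (\<lambda>x. F x $$ (a, b))},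
      monoid.mult = (\<lambda>F G. \<lambda>x\<in>mspace X. F x * G x),
      one = (\<lambda>x\<in>mspace X. 1\<^sub>m n),
      zero = (\<lambda>x\<in>mspace X. 0\<^sub>m n n),
      add = (\<lambda>F G. \<lambda>x\<in>mspace X. F x + G x),
      smult = (\<lambda>c F. \<lambda>x\<in>mspace X. c \<cdot>\<^sub>m F x),
      star = (\<lambda>F. \<lambda>x\<in>mspace X. map_mat cnj (transpose_mat (F x))),
      nrm = (\<lambda>F. SUP x\<in>mspace X. mat_opnorm (F x))\<rparr>"

text \<open>
  A map \<open>\<psi> : M\<^sub>n(C(X)) \<rightarrow> M\<^bsub>n'\<^esub>(C(Y))\<close> has a diagonal seed if it is zero or, up to one fixed
  permutation \<open>p\<close> of the \<open>n'\<close> coordinates, of the form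
  \<open>F \<mapsto> diag(F \<circ> \<lambda>\<^sub>1, \<dots>, F \<circ> \<lambda>\<^sub>m, 0, \<dots>, 0)\<close>.
\<close>

definition has_diagonal_seed ::
    "nat \<Rightarrow> 'x metric \<Rightarrow> nat \<Rightarrow> 'x metric \<Rightarrow> (('x \<Rightarrow> complex mat) \<Rightarrow> ('x \<Rightarrow> complex mat)) \<Rightarrow> bool"
  where
  "has_diagonal_seed n X n' Y \<psi> \<longleftrightarrow>
     (\<forall>F\<in>carrier (mat_C n X). \<psi> F = zero (mat_C n' Y)) \<or>
     (\<exists>m l p. 1 \<le> m \<and> m * n \<le> n' \<and> p permutes {..<n'} \<and>
        (\<forall>k<m. continuous_map (mtopology_of Y) (mtopology_of X) (l k)) \<and>
        (\<forall>F\<in>carrier (mat_C n X). \<forall>y\<in>mspace Y.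
           \<psi> F y = Matrix.mat n' n' (\<lambda>(a, b).
             diag_block_mat (map (\<lambda>k. F (l k y)) [0..<m] @ [0\<^sub>m (n' - m * n) (n' - m * n)])
               $$ (p a, p b))))"

text \<open>The sequence index \<open>i\<close> and the summand index \<open>j\<close> are counted from \<open>0\<close>.\<close>

definition AH_building_block ::
    "nat \<Rightarrow> (nat \<Rightarrow> nat) \<Rightarrow> (nat \<Rightarrow> 'x metric) \<Rightarrow> (nat \<Rightarrow> 'x \<Rightarrow> complex mat) nstar_alg" where
  "AH_building_block K n X = direct_sum K (\<lambda>j. mat_C (n j) (X j))"

definition AH_diagonal_limit ::
    "(nat \<Rightarrow> nat) \<Rightarrow> (nat \<Rightarrow> nat \<Rightarrow> nat) \<Rightarrow> (nat \<Rightarrow> nat \<Rightarrow> 'x metric) \<Rightarrow>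
     (nat \<Rightarrow> (nat \<Rightarrow> 'x \<Rightarrow> complex mat) \<Rightarrow> (nat \<Rightarrow> 'x \<Rightarrow> complex mat)) \<Rightarrow>
     (nat \<Rightarrow> (nat \<Rightarrow> 'x \<Rightarrow> complex mat) \<Rightarrow> 'b::unital_cstar_algebra) \<Rightarrow> bool" where
  "AH_diagonal_limit K n X \<phi> \<mu> \<longleftrightarrow>
     (\<forall>i. 1 \<le> K i) \<and>
     (\<forall>i. \<forall>j<K i. 1 \<le> n i j \<and> mspace (X i j) \<noteq> {} \<and>
        compact_space (mtopology_of (X i j)) \<and> connected_space (mtopology_of (X i j))) \<and>
     unital_inductive_sequence (\<lambda>i. AH_building_block (K i) (n i) (X i)) \<phi> \<and>
     inductive_limit (\<lambda>i. AH_building_block (K i) (n i) (X i)) \<phi> \<mu> \<and>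
     (\<forall>i i'. i < i' \<longrightarrow> (\<forall>j<K i. \<forall>j'<K i'.
        has_diagonal_seed (n i j) (X i j) (n i' j') (X i' j')
          (\<lambda>F. conn \<phi> i (i' - i) ((zero (AH_building_block (K i) (n i) (X i)))(j := F)) j')))"

end

theory Submission
  imports Defs
begin

text \<open>
  Represent elements of the limit by matrix-valued functions at some level. Suppose first that the
  matrix sizes tend to infinity. Passing from level \<open>i\<close> to a much later level, the images of all level
  \<open>i\<close> functions are supported in a fixed pattern with boundedly many entries per row, so almost all
  matrix slots are free. If the real part of \<open>b\<close> is a constant diagonal, a small perturbation makes its
  diagonal values distinct and nonzero, so that the generated algebra contains the diagonal matrix
  units, and a small perturbation of the imaginary part stores in the free slots both constants, which
  yield all matrix units, and every entry of the image of a given element. Iterating over a countable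
  generating set with perturbations that decrease fast enough, the limit generates everything,
  because approximate membership in the generated algebra is an open condition.

  Otherwise point evaluations of bounded size at arbitrarily late levels accumulate to a finite
  dimensional representation of the algebraic limit. By simplicity it is faithful, so the images
  of the levels stabilize; scalar-valued functions at a stable level are then central, hence, again
  by simplicity, constants, and the matrix units of this level together generate the limit.
\<close>

section \<open>Singly generated C*-algebras\<close>

text \<open>Over a space of dimension at least 3, a hermitian matrix function cannot in general be
  perturbed so that its eigenvalues become distinct. Hence the real parts are kept diagonal and
  constant. Diagonal connecting maps carry constant diagonals to constant diagonals, so this form
  survives at all later levels, and making the values distinct only takes a change of finitely many
  real numbers. The room for storing information comes from counting: the pattern of an image
  occupies a number of slots linear in the matrix size, while the number of all slots is quadratic.
  Outside the pattern the old generator vanishes, so what is stored there can be read off exactly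
  and only the size of the perturbation has to be controlled. With bounded sizes there is no such
  room, and \<open>M_n(C(X))\<close> alone need not be singly generated (take \<open>n = 1\<close>
  and a cube of dimension 3). There simplicity has to force the limit to be finite dimensional.
  Connecting maps may have kernels, so the argument computes with representatives and transfers only
  their images in the limit.\<close>

lemma scaleC_zero_left [simp]: "scaleC 0 x = (0::'a::unital_cstar_algebra)"
  using scaleC_add_left[of 0 0 x] by simp

lemma scaleC_zero_right [simp]: "scaleC c 0 = (0::'a::unital_cstar_algebra)"
  using scaleC_add_right[of c "0::'a" 0] by simp

lemma scaleC_minus_one: "scaleC (- 1) x = - x"
  using scaleC_add_left[of "- 1" 1 x] by (simp add: scaleC_one eq_neg_iff_add_eq_0)

lemma norm_adj: "norm (adj x) = norm (x :: 'a::unital_cstar_algebra)"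
proof -
  have le: "norm y \<le> norm (adj y)" for y :: 'a
  proof (cases "y = 0")
    case False
    have "norm y * norm y \<le> norm (adj y) * norm y"
      using norm_adj_mult[of y] norm_mult_ineq[of "adj y" y] by (simp add: power2_eq_square)
    with False show ?thesis by simp
  qed simp
  show ?thesis using le[of x] le[of "adj x"] by (simp add: adj_adj)
qed

lemma bounded_linear_scaleC: "bounded_linear (scaleC c :: 'a::unital_cstar_algebra \<Rightarrow> 'a)"
  by (rule bounded_linear_intro[where K = "cmod c"])
    (auto simp: scaleC_add_right scaleR_eq_scaleC scaleC_scaleC norm_scaleC mult.commute)

lemma bounded_linear_adj: "bounded_linear (adj :: 'a::unital_cstar_algebra \<Rightarrow> 'a)"
  by (rule bounded_linear_intro[where K = 1])
    (auto simp: adj_add scaleR_eq_scaleC adj_scaleC norm_adj)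

lemmas continuous_on_scaleC [continuous_intros] = bounded_linear.continuous_on[OF bounded_linear_scaleC]
lemmas continuous_on_adj [continuous_intros] = bounded_linear.continuous_on[OF bounded_linear_adj]
lemmas tendsto_scaleC [tendsto_intros] = bounded_linear.tendsto[OF bounded_linear_scaleC]
lemmas tendsto_adj [tendsto_intros] = bounded_linear.tendsto[OF bounded_linear_adj]

section \<open>Generated subalgebras and noncommutative polynomials\<close>

lemma cstar_subalgebraD:
  assumes "cstar_subalgebra A"
  shows "0 \<in> A" "x \<in> A \<Longrightarrow> y \<in> A \<Longrightarrow> x + y \<in> A" "x \<in> A \<Longrightarrow> y \<in> A \<Longrightarrow> x * y \<in> A"
    "x \<in> A \<Longrightarrow> scaleC c x \<in> A" "x \<in> A \<Longrightarrow> adj x \<in> A" "closed A"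
  using assms by (auto simp: cstar_subalgebra_def)

lemma cstar_subalgebra_sum:
  assumes "cstar_subalgebra A" "\<And>i. i \<in> I \<Longrightarrow> f i \<in> A"
  shows "sum f I \<in> A"
  using assms(2)
  by (induction I rule: infinite_finite_induct) (auto intro: cstar_subalgebraD[OF assms(1)])

lemma cstar_subalgebra_generated: "cstar_subalgebra (cstar_generated b)"
  unfolding cstar_generated_def cstar_subalgebra_def by (auto intro!: closed_Inter)

lemma cstar_generated_self: "b \<in> cstar_generated b"
  by (auto simp: cstar_generated_def)

text \<open>
  The noncommutative *-polynomials without constant term, as functions: they are continuous, so
  approximate membership in the generated algebra is stable under perturbing the generator.
\<close>

inductive_set star_polys :: "('a::unital_cstar_algebra \<Rightarrow> 'a) set" where
  star_polys_id: "(\<lambda>b. b) \<in> star_polys"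
| star_polys_zero: "(\<lambda>b. 0) \<in> star_polys"
| star_polys_add: "p \<in> star_polys \<Longrightarrow> q \<in> star_polys \<Longrightarrow> (\<lambda>b. p b + q b) \<in> star_polys"
| star_polys_mult: "p \<in> star_polys \<Longrightarrow> q \<in> star_polys \<Longrightarrow> (\<lambda>b. p b * q b) \<in> star_polys"
| star_polys_scaleC: "p \<in> star_polys \<Longrightarrow> (\<lambda>b. scaleC c (p b)) \<in> star_polys"
| star_polys_adj: "p \<in> star_polys \<Longrightarrow> (\<lambda>b. adj (p b)) \<in> star_polys"

lemma continuous_on_star_polys: "p \<in> star_polys \<Longrightarrow> continuous_on UNIV p"
  by (induction rule: star_polys.induct) (auto intro!: continuous_intros)

lemma star_polys_in_generated: "p \<in> star_polys \<Longrightarrow> p b \<in> cstar_generated b"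
  by (induction rule: star_polys.induct)
    (auto intro: cstar_subalgebraD[OF cstar_subalgebra_generated] cstar_generated_self)

lemma closure_sequentialI: "(\<And>k. f k \<in> S) \<Longrightarrow> f \<longlonglongrightarrow> x \<Longrightarrow> x \<in> closure S"
  for x :: "'a::metric_space"
  unfolding closure_sequential by blast

lemma cstar_subalgebra_closure:
  assumes 0: "0 \<in> S" and add: "\<And>x y. x \<in> S \<Longrightarrow> y \<in> S \<Longrightarrow> x + y \<in> S"
    and mult: "\<And>x y. x \<in> S \<Longrightarrow> y \<in> S \<Longrightarrow> x * y \<in> S"
    and scale: "\<And>c x. x \<in> S \<Longrightarrow> scaleC c x \<in> S" and adj: "\<And>x. x \<in> S \<Longrightarrow> adj x \<in> S"
  shows "cstar_subalgebra (closure S)"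
  unfolding cstar_subalgebra_def
proof (intro conjI ballI allI)
  show "0 \<in> closure S" using 0 closure_subset by blast
next
  fix x y assume "x \<in> closure S" "y \<in> closure S"
  then obtain f g where "\<And>k. f k \<in> S" "f \<longlonglongrightarrow> x" "\<And>k. g k \<in> S" "g \<longlonglongrightarrow> y"
    unfolding closure_sequential by blast
  then have lim: "(\<lambda>k. f k + g k) \<longlonglongrightarrow> x + y" "(\<lambda>k. f k * g k) \<longlonglongrightarrow> x * y"
    and mem: "\<And>k. f k + g k \<in> S" "\<And>k. f k * g k \<in> S"
    by (auto intro!: tendsto_intros add mult)
  show "x + y \<in> closure S" "x * y \<in> closure S"
    by (rule closure_sequentialI[OF mem(1) lim(1)], rule closure_sequentialI[OF mem(2) lim(2)])
next
  fix c x assume "x \<in> closure S"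
  then obtain f where "\<And>k. f k \<in> S" "f \<longlonglongrightarrow> x"
    unfolding closure_sequential by blast
  then have lim: "(\<lambda>k. scaleC c (f k)) \<longlonglongrightarrow> scaleC c x" and mem: "\<And>k. scaleC c (f k) \<in> S"
    by (auto intro!: tendsto_intros scale)
  show "scaleC c x \<in> closure S"
    by (rule closure_sequentialI[OF mem lim])
next
  fix x assume "x \<in> closure S"
  then obtain f where "\<And>k. f k \<in> S" "f \<longlonglongrightarrow> x"
    unfolding closure_sequential by blast
  then have lim: "(\<lambda>k. adj (f k)) \<longlonglongrightarrow> adj x" and mem: "\<And>k. adj (f k) \<in> S"
    by (auto intro!: tendsto_intros adj)
  show "adj x \<in> closure S"
    by (rule closure_sequentialI[OF mem lim])
qed simp

text \<open>The values of the polynomials at \<open>b\<close> form a *-subalgebra containing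
  \<open>b\<close>. Its closure is a C*-subalgebra, so nothing outside this closure is generated by
  \<open>b\<close>.\<close>

lemma cstar_generated_approx:
  assumes "w \<in> cstar_generated b" "\<epsilon> > 0"
  obtains p where "p \<in> star_polys" "norm (p b - w) < \<epsilon>"
proof -
  let ?S = "(\<lambda>p. p b) ` star_polys"
  have "cstar_subalgebra (closure ?S)"
    by (rule cstar_subalgebra_closure) (auto intro: star_polys.intros image_eqI[rotated])
  moreover have "b \<in> closure ?S"
    using closure_subset star_polys_id by (metis (no_types, lifting) image_eqI subsetD)
  ultimately have "w \<in> closure ?S"
    using assms(1) by (auto simp: cstar_generated_def)
  then show ?thesis
    using assms(2) that unfolding closure_approachable by (auto simp: dist_norm)
qed

text \<open>Exact membership may be lost under arbitrarily small perturbations of the generator.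
  Approximate membership is witnessed by a single polynomial, and continuity of that polynomial at
  \<open>b\<close> yields \<open>\<delta>\<close>.\<close>

lemma cstar_generated_stable:
  assumes "w \<in> cstar_generated b" "\<epsilon> > 0"
  obtains \<delta> where "\<delta> > 0"
    "\<And>x. norm (x - b) < \<delta> \<Longrightarrow> \<exists>v\<in>cstar_generated x. norm (v - w) < \<epsilon>"
proof -
  obtain p where p: "p \<in> star_polys" "norm (p b - w) < \<epsilon>"
    using cstar_generated_approx[OF assms] .
  have "isCont p b"
    using continuous_on_star_polys[OF p(1)] by (simp add: continuous_on_eq_continuous_at)
  then obtain \<delta> where "\<delta> > 0" "\<And>x. norm (x - b) < \<delta> \<Longrightarrow> norm (p x - p b) < \<epsilon> - norm (p b - w)"
    using p(2) unfolding continuous_at_eps_delta by (metis diff_gt_0_iff_gt dist_norm)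
  moreover have "norm (p x - w) \<le> norm (p x - p b) + norm (p b - w)" for x
    by norm
  ultimately have "\<exists>v\<in>cstar_generated x. norm (v - w) < \<epsilon>" if "norm (x - b) < \<delta>" for x
    using that star_polys_in_generated[OF p(1), of x] by (smt (verit))
  with \<open>\<delta> > 0\<close> show ?thesis using that by blast
qed

text \<open>A Baire category argument. Exact membership of \<open>w k\<close> at one point of
  \<open>S\<close> makes \<open>w k\<close> approximately generated on a ball around this point.
  Nested balls satisfy these demands for every \<open>k\<close> and every precision, and their
  common point, which need not lie in \<open>S\<close>, generates all \<open>w k\<close>.\<close>

lemma exists_generator_of_sequence:
  fixes w :: "nat \<Rightarrow> 'a::unital_cstar_algebra"
  assumes nonempty: "S \<noteq> {}"
    and step: "\<And>b k \<epsilon>. b \<in> S \<Longrightarrow> \<epsilon> > 0 \<Longrightarrow> \<exists>b'\<in>S. norm (b' - b) < \<epsilon> \<and> w k \<in> cstar_generated b'"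
  obtains b where "range w \<subseteq> cstar_generated b"
proof -
  \<comment> \<open>Stage \<open>t\<close> encodes an index \<open>k\<close> and a precision
    \<open>m\<close>, so that each \<open>w k\<close> is treated for every tolerance
    \<open>1 / (m + 1)\<close>.\<close>
  define near where "near t x \<longleftrightarrow>
    (\<exists>v\<in>cstar_generated x. norm (v - w (fst (prod_decode t))) < 1 / (snd (prod_decode t) + 1))"
    for t :: nat and x
  define P where "P t = (\<lambda>(b, \<rho>). b \<in> S \<and> \<rho> > 0 \<and> \<rho> \<le> (1/2::real) ^ t)" for t :: nat
  define Q where "Q t = (\<lambda>(b, \<rho>) (b', \<rho>'). cball b' \<rho>' \<subseteq> cball b \<rho> \<and> (\<forall>x\<in>cball b' \<rho>'. near t x))"
    for t :: nat
  obtain b0 where "b0 \<in> S" using nonempty by blast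
  have "\<exists>f. \<forall>t. P t (f t) \<and> Q t (f t) (f (Suc t))"
  proof (rule dependent_nat_choice)
    show "\<exists>x. P 0 x" using \<open>b0 \<in> S\<close> by (intro exI[of _ "(b0, 1)"]) (simp add: P_def)
  next
    fix z t assume "P t z"
    then obtain b \<rho> where z: "z = (b, \<rho>)" "b \<in> S" "\<rho> > 0" by (cases z) (auto simp: P_def)
    obtain b' where b': "b' \<in> S" "norm (b' - b) < \<rho> / 2" "w (fst (prod_decode t)) \<in> cstar_generated b'"
      using step[OF z(2), of "\<rho> / 2"] z(3) by fastforce
    have "1 / real (snd (prod_decode t) + 1) > 0" by simp
    from cstar_generated_stable[OF b'(3) this]
    obtain \<delta> where \<delta>: "\<delta> > 0" "\<And>x. norm (x - b') < \<delta> \<Longrightarrow> near t x"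
      unfolding near_def by blast
    \<comment> \<open>\<open>\<delta> / 2\<close> keeps the closed ball inside the open region of
      stability, \<open>\<rho> / 2\<close> nests it in the previous ball because \<open>b'\<close>
      is within \<open>\<rho> / 2\<close> of \<open>b\<close>, and the power of \<open>1/2\<close>
      makes the diameters tend to 0.\<close>
    define \<rho>' where "\<rho>' = min (\<delta> / 2) (min (\<rho> / 2) ((1/2) ^ Suc t))"
    have "\<rho>' > 0" "\<rho>' \<le> (1/2) ^ Suc t" "\<rho>' \<le> \<rho> / 2" "\<rho>' \<le> \<delta> / 2"
      using \<delta>(1) z(3) by (auto simp: \<rho>'_def)
    moreover have "cball b' \<rho>' \<subseteq> cball b \<rho>"
    proof
      fix x assume "x \<in> cball b' \<rho>'"
      then show "x \<in> cball b \<rho>"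
        using b'(2) \<open>\<rho>' \<le> \<rho> / 2\<close> dist_triangle[of b x b'] by (simp add: dist_norm norm_minus_commute)
    qed
    moreover have "\<forall>x\<in>cball b' \<rho>'. near t x"
      using \<delta> \<open>\<rho>' \<le> \<delta> / 2\<close> by (auto simp: dist_norm norm_minus_commute)
    ultimately show "\<exists>y. P (Suc t) y \<and> Q t z y"
      using b'(1) by (intro exI[of _ "(b', \<rho>')"]) (auto simp: P_def Q_def z(1))
  qed
  then obtain f where f: "\<And>t. P t (f t)" "\<And>t. Q t (f t) (f (Suc t))" by blast
  define c where "c t = cball (fst (f t)) (snd (f t))" for t
  have c_Suc: "c (Suc t) \<subseteq> c t" for t
    using f(2)[of t] by (auto simp: Q_def c_def split: prod.splits)
  have "\<exists>b. (\<forall>t. b \<in> c t)"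
  proof -
    have "\<exists>a. \<forall>n. a \<in> c n"
    proof (rule decreasing_closed_nest)
      show "closed (c n)" for n by (simp add: c_def)
      show "c n \<noteq> {}" for n using f(1)[of n] by (auto simp: c_def P_def split: prod.splits)
      show "c n \<subseteq> c m" if "m \<le> n" for m n
        using lift_Suc_antimono_le[of c, OF c_Suc that] .
    next
      fix e :: real assume "e > 0"
      then obtain t where "(1/2::real) ^ t < e / 2"
        using real_arch_pow_inv[of "e / 2" "1/2"] by auto
      moreover have "snd (f t) \<le> (1/2) ^ t" using f(1)[of t] by (auto simp: P_def split: prod.splits)
      ultimately have "snd (f t) < e / 2" by linarith
      then have "dist x y < e" if "x \<in> c t" "y \<in> c t" for x y
        using that dist_triangle2[of x y "fst (f t)"] by (simp add: c_def dist_commute)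
      then show "\<exists>n. \<forall>x\<in>c n. \<forall>y\<in>c n. dist x y < e" by blast
    qed blast
    then show ?thesis by blast
  qed
  then obtain b where b: "\<And>t. b \<in> c t" by blast
  have near: "near t b" for t
    using f(2)[of t] b[of "Suc t"] by (auto simp: Q_def c_def split: prod.splits)
  have "w k \<in> cstar_generated b" for k
  proof -
    have "w k \<in> closure (cstar_generated b)"
      unfolding closure_approachable
    proof (intro allI impI)
      fix e :: real assume "e > 0"
      then obtain m where "1 / (real m + 1) < e"
        using reals_Archimedean[of e] by (auto simp: inverse_eq_divide add.commute)
      then show "\<exists>y\<in>cstar_generated b. dist y (w k) < e"
        using near[of "prod_encode (k, m)"] unfolding near_def dist_norm
        by (simp add: add.commute) (meson less_trans)
    qed
    then show ?thesis
      using cstar_subalgebraD(6)[OF cstar_subalgebra_generated] by (metis closure_eq)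
  qed
  then show ?thesis using that by blast
qed

text \<open>The closure of an ideal at distance 1 from the unit is proper.\<close>

lemma simple_cstar_dense_ideal:
  fixes V I :: "'a::unital_cstar_algebra set"
  assumes simple: "simple_cstar TYPE('a)" and dense: "closure V = UNIV"
    and 0: "0 \<in> I" and add: "\<And>x y. x \<in> I \<Longrightarrow> y \<in> I \<Longrightarrow> x + y \<in> I"
    and scale: "\<And>c x. x \<in> I \<Longrightarrow> scaleC c x \<in> I"
    and mult: "\<And>a x. a \<in> V \<Longrightarrow> x \<in> I \<Longrightarrow> a * x \<in> I \<and> x * a \<in> I"
    and far: "\<And>x. x \<in> I \<Longrightarrow> norm (1 - x) \<ge> 1"
  shows "I = {0}"
proof -
  have "closed_two_sided_ideal (closure I)"
    unfolding closed_two_sided_ideal_def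
  proof (intro conjI ballI allI)
    show "0 \<in> closure I" using 0 closure_subset by blast
  next
    fix x y assume "x \<in> closure I" "y \<in> closure I"
    then obtain f g where "\<And>k. f k \<in> I" "f \<longlonglongrightarrow> x" "\<And>k. g k \<in> I" "g \<longlonglongrightarrow> y"
      unfolding closure_sequential by blast
    then have lim: "(\<lambda>k. f k + g k) \<longlonglongrightarrow> x + y" and mem: "\<And>k. f k + g k \<in> I"
      by (auto intro!: tendsto_intros add)
    show "x + y \<in> closure I"
      by (rule closure_sequentialI[OF mem lim])
  next
    fix c x assume "x \<in> closure I"
    then obtain f where "\<And>k. f k \<in> I" "f \<longlonglongrightarrow> x"
      unfolding closure_sequential by blast
    then have lim: "(\<lambda>k. scaleC c (f k)) \<longlonglongrightarrow> scaleC c x" and mem: "\<And>k. scaleC c (f k) \<in> I"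
      by (auto intro!: tendsto_intros scale)
    show "scaleC c x \<in> closure I"
      by (rule closure_sequentialI[OF mem lim])
  next
    \<comment> \<open>\<open>I\<close> absorbs factors from \<open>V\<close> only; density of
      \<open>V\<close> and continuity of the product extend this to all factors.\<close>
    fix a x assume "x \<in> closure I"
    moreover have "a \<in> closure V" using dense by simp
    ultimately obtain f g where "\<And>k. f k \<in> I" "f \<longlonglongrightarrow> x" "\<And>k. g k \<in> V" "g \<longlonglongrightarrow> a"
      unfolding closure_sequential by blast
    then have lim: "(\<lambda>k. g k * f k) \<longlonglongrightarrow> a * x" "(\<lambda>k. f k * g k) \<longlonglongrightarrow> x * a"
      and mem: "\<And>k. g k * f k \<in> I" "\<And>k. f k * g k \<in> I"
      using mult by (auto intro!: tendsto_intros)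
    show "a * x \<in> closure I" "x * a \<in> closure I"
      by (rule closure_sequentialI[OF mem(1) lim(1)], rule closure_sequentialI[OF mem(2) lim(2)])
  qed simp
  moreover have "1 \<notin> closure I"
  proof
    assume "1 \<in> closure I"
    then have "\<forall>\<epsilon>>0. \<exists>x\<in>I. dist x 1 < \<epsilon>"
      by (simp only: closure_approachable)
    from this[rule_format, of 1] obtain x where "x \<in> I" "dist x 1 < 1" by auto
    with far[of x] show False by (simp add: dist_norm norm_minus_commute)
  qed
  ultimately have "closure I = {0}"
    using simple unfolding simple_cstar_def by blast
  then show ?thesis using closure_subset[of I] 0 by blast
qed

text \<open>Since \<open>q\<close> linear functionals separate points, each \<open>V i\<close> has
  dimension at most \<open>q\<close>, and an increasing chain can grow only finitely often. The
  induction peels off one functional: its kernels form a chain separated by the others, and a single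
  vector outside the kernel accounts for the rest.\<close>

lemma subspace_chain_stabilizes:
  fixes V :: "nat \<Rightarrow> 'a::unital_cstar_algebra set" and F :: "nat \<Rightarrow> 'a \<Rightarrow> complex"
  assumes mono: "mono V"
    and sub: "\<And>i x y c. x \<in> V i \<Longrightarrow> y \<in> V i \<Longrightarrow> x - scaleC c y \<in> V i"
    and lin: "\<And>i k x y c. x \<in> V i \<Longrightarrow> y \<in> V i \<Longrightarrow> F k (x - scaleC c y) = F k x - c * F k y"
    and sep: "\<And>i x. x \<in> V i \<Longrightarrow> (\<And>k. k < q \<Longrightarrow> F k x = 0) \<Longrightarrow> x = 0"
    and 0: "\<And>i. 0 \<in> V i"
  shows "\<exists>i. \<forall>i'. V i' \<subseteq> V i"
  using assms
proof (induction q arbitrary: V)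
  case 0
  then show ?case by (metis not_less_zero subsetI)
next
  case (Suc q)
  define W where "W i = {x \<in> V i. F q x = 0}" for i
  have F0: "F q 0 = 0"
    using Suc.prems(3)[OF Suc.prems(5) Suc.prems(5), where c = 1 and k = q] by simp
  have "\<exists>i. \<forall>i'. W i' \<subseteq> W i"
  proof (rule Suc.IH)
    show "mono W" using Suc.prems(1) by (auto simp: W_def mono_def)
    show "x - scaleC c y \<in> W i" if "x \<in> W i" "y \<in> W i" for i x y c
      using that Suc.prems(2,3) by (auto simp: W_def)
    show "F k (x - scaleC c y) = F k x - c * F k y" if "x \<in> W i" "y \<in> W i" for i k x y c
      using that Suc.prems(3) by (auto simp: W_def)
    show "x = 0" if "x \<in> W i" "\<And>k. k < q \<Longrightarrow> F k x = 0" for i x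
      using that Suc.prems(4)[of x i] by (auto simp: W_def less_Suc_eq)
    show "0 \<in> W i" for i using Suc.prems(5) F0 by (simp add: W_def)
  qed
  then obtain i1 where i1: "\<And>i'. W i' \<subseteq> W i1" by blast
  show ?case
  proof (cases "\<exists>i x. x \<in> V i \<and> F q x \<noteq> 0")
    case False
    then have "W = V" by (auto simp: W_def)
    with i1 show ?thesis by blast
  next
    case True
    then obtain i2 y where y: "y \<in> V i2" "F q y \<noteq> 0" by blast
    have V_mono: "V i \<subseteq> V i'" if "i \<le> i'" for i i' using Suc.prems(1) that by (auto simp: mono_def)
    show ?thesis
    proof (intro exI[of _ "max i1 i2"] allI subsetI)
      fix i' x assume x: "x \<in> V i'"
      \<comment> \<open>This multiple of \<open>y\<close> moves \<open>x\<close> into the kernel of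
        functional \<open>q\<close>, where level \<open>i1\<close> already contains everything.
        Adding the multiple of \<open>y\<close> back requires level \<open>i2\<close> as
        well.\<close>
      let ?c = "F q x / F q y"
      have x': "x \<in> V (max i' i2)" "y \<in> V (max i' i2)"
        using x y(1) V_mono[of i' "max i' i2"] V_mono[of i2 "max i' i2"] by (simp_all add: subset_iff)
      have "x - scaleC ?c y \<in> W (max i' i2)"
        using Suc.prems(2,3)[OF x'] y(2) by (simp add: W_def)
      then have "x - scaleC ?c y \<in> V (max i1 i2)"
        using i1 V_mono[of i1 "max i1 i2"] by (auto simp: W_def)
      moreover have "y \<in> V (max i1 i2)" using y(1) V_mono[of i2 "max i1 i2"] by (simp add: subset_iff)
      ultimately have "(x - scaleC ?c y) - scaleC (- ?c) y \<in> V (max i1 i2)"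
        using Suc.prems(2) by blast
      then show "x \<in> V (max i1 i2)"
        using scaleC_add_left[of "?c" "- ?c" y] by (simp add: eq_neg_iff_add_eq_0[symmetric])
    qed
  qed
qed

section \<open>Matrix-valued functions in terms of their entries\<close>

text \<open>The arguments are summand, row, column and point. These are total functions with
  arbitrary values outside the index ranges and off the spaces, which is why equality is replaced by
  \<open>ent_eq\<close>.\<close>

type_synonym 'x entries = "nat \<Rightarrow> nat \<Rightarrow> nat \<Rightarrow> 'x \<Rightarrow> complex"

definition mk :: "nat \<Rightarrow> (nat \<Rightarrow> nat) \<Rightarrow> (nat \<Rightarrow> 'x metric) \<Rightarrow> 'x entries \<Rightarrow> (nat \<Rightarrow> 'x \<Rightarrow> complex mat)" where
  "mk K n X u = (\<lambda>j\<in>{..<K}. \<lambda>x\<in>mspace (X j). Matrix.mat (n j) (n j) (\<lambda>(c, d). u j c d x))"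

definition ent :: "(nat \<Rightarrow> 'x \<Rightarrow> complex mat) \<Rightarrow> 'x entries" where
  "ent f = (\<lambda>j c d x. f j x $$ (c, d))"

definition cont_ent :: "nat \<Rightarrow> (nat \<Rightarrow> nat) \<Rightarrow> (nat \<Rightarrow> 'x metric) \<Rightarrow> 'x entries \<Rightarrow> bool" where
  "cont_ent K n X u \<longleftrightarrow>
     (\<forall>j<K. \<forall>c<n j. \<forall>d<n j. continuous_map (mtopology_of (X j)) euclidean (u j c d))"

definition ent_eq :: "nat \<Rightarrow> (nat \<Rightarrow> nat) \<Rightarrow> (nat \<Rightarrow> 'x metric) \<Rightarrow> 'x entries \<Rightarrow> 'x entries \<Rightarrow> bool" where
  "ent_eq K n X u v \<longleftrightarrow> (\<forall>j<K. \<forall>c<n j. \<forall>d<n j. \<forall>x\<in>mspace (X j). u j c d x = v j c d x)"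

definition ent_mult :: "(nat \<Rightarrow> nat) \<Rightarrow> 'x entries \<Rightarrow> 'x entries \<Rightarrow> 'x entries" where
  "ent_mult n u v = (\<lambda>j c d x. \<Sum>e<n j. u j c e x * v j e d x)"

definition ent_diag :: "(nat \<Rightarrow> nat \<Rightarrow> 'x \<Rightarrow> complex) \<Rightarrow> 'x entries" where
  "ent_diag g = (\<lambda>j c d x. if c = d then g j c x else 0)"

definition ent_unit :: "nat \<Rightarrow> nat \<Rightarrow> nat \<Rightarrow> ('x \<Rightarrow> complex) \<Rightarrow> 'x entries" where
  "ent_unit j0 c0 d0 g = (\<lambda>j c d x. if j = j0 \<and> c = c0 \<and> d = d0 then g x else 0)"

lemma AH_building_block_carrier:
  "f \<in> carrier (AH_building_block K n X) \<longleftrightarrow>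
     f \<in> extensional {..<K} \<and>
     (\<forall>j<K. f j \<in> extensional (mspace (X j)) \<and>
       (\<forall>x\<in>mspace (X j). f j x \<in> carrier_mat (n j) (n j))) \<and> cont_ent K n X (ent f)"
  unfolding AH_building_block_def direct_sum_def mat_C_def cont_ent_def ent_def PiE_def Pi_def
  by auto

lemma ent_mk:
  "j < K \<Longrightarrow> c < n j \<Longrightarrow> d < n j \<Longrightarrow> x \<in> mspace (X j) \<Longrightarrow> ent (mk K n X u) j c d x = u j c d x"
  by (simp add: ent_def mk_def)

lemma mk_carrier:
  assumes "cont_ent K n X u"
  shows "mk K n X u \<in> carrier (AH_building_block K n X)"
proof -
  have "continuous_map (mtopology_of (X j)) euclidean (ent (mk K n X u) j c d)"
    if "j < K" "c < n j" "d < n j" for j c d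
  proof (rule continuous_map_eq)
    show "continuous_map (mtopology_of (X j)) euclidean (u j c d)"
      using assms that by (simp add: cont_ent_def)
  qed (use that in \<open>simp add: ent_mk\<close>)
  then show ?thesis
    unfolding AH_building_block_carrier by (simp add: cont_ent_def) (simp add: mk_def)
qed

lemma mk_ent:
  assumes "f \<in> carrier (AH_building_block K n X)"
  shows "mk K n X (ent f) = f"
proof (rule ext)
  fix j
  show "mk K n X (ent f) j = f j"
  proof (cases "j < K")
    case True
    show ?thesis
    proof (rule ext)
      fix x
      show "mk K n X (ent f) j x = f j x"
      proof (cases "x \<in> mspace (X j)")
        case x: True
        then have "f j x \<in> carrier_mat (n j) (n j)"
          using assms True unfolding AH_building_block_carrier by blast
        then show ?thesis using True x by (auto simp: mk_def ent_def intro!: eq_matI)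
      next
        case False
        then show ?thesis
          using assms True unfolding AH_building_block_carrier by (simp add: mk_def extensional_def)
      qed
    qed
  next
    case False
    then show ?thesis using assms unfolding AH_building_block_carrier by (auto simp: mk_def extensional_def)
  qed
qed

lemma cont_ent_ent: "f \<in> carrier (AH_building_block K n X) \<Longrightarrow> cont_ent K n X (ent f)"
  by (simp add: AH_building_block_carrier)

lemma mk_cong: "ent_eq K n X u v \<Longrightarrow> mk K n X u = mk K n X v"
  unfolding mk_def ent_eq_def by (intro restrict_ext eq_matI) auto

lemma mk_zero: "zero (AH_building_block K n X) = mk K n X (\<lambda>j c d x. 0)"
  by (auto simp: AH_building_block_def direct_sum_def mat_C_def mk_def intro!: restrict_ext eq_matI)

lemma mk_one: "one (AH_building_block K n X) = mk K n X (ent_diag (\<lambda>j c x. 1))"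
  by (auto simp: AH_building_block_def direct_sum_def mat_C_def mk_def ent_diag_def
      intro!: restrict_ext eq_matI)

lemma mk_add:
  "add (AH_building_block K n X) (mk K n X u) (mk K n X v) = mk K n X (\<lambda>j c d x. u j c d x + v j c d x)"
  by (auto simp: AH_building_block_def direct_sum_def mat_C_def mk_def intro!: restrict_ext eq_matI)

lemma mk_mult:
  "monoid.mult (AH_building_block K n X) (mk K n X u) (mk K n X v) = mk K n X (ent_mult n u v)"
  by (auto simp: AH_building_block_def direct_sum_def mat_C_def mk_def ent_mult_def scalar_prod_def
      atLeast0LessThan intro!: restrict_ext eq_matI)

lemma mk_smult:
  "smult (AH_building_block K n X) a (mk K n X u) = mk K n X (\<lambda>j c d x. a * u j c d x)"
  by (auto simp: AH_building_block_def direct_sum_def mat_C_def mk_def intro!: restrict_ext eq_matI)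

lemma mk_star:
  "star (AH_building_block K n X) (mk K n X u) = mk K n X (\<lambda>j c d x. cnj (u j d c x))"
  by (auto simp: AH_building_block_def direct_sum_def mat_C_def mk_def intro!: restrict_ext eq_matI)

lemma cont_ent_const: "cont_ent K n X (\<lambda>j c d x. a j c d)"
  by (simp add: cont_ent_def)

lemma cont_ent_add:
  "cont_ent K n X u \<Longrightarrow> cont_ent K n X v \<Longrightarrow> cont_ent K n X (\<lambda>j c d x. u j c d x + v j c d x)"
  unfolding cont_ent_def by (auto intro!: continuous_map_add)

lemma cont_ent_diff:
  "cont_ent K n X u \<Longrightarrow> cont_ent K n X v \<Longrightarrow> cont_ent K n X (\<lambda>j c d x. u j c d x - v j c d x)"
  unfolding cont_ent_def by (auto intro!: continuous_map_diff)

lemma continuous_map_continuous_on_compose: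
  fixes g :: "'b::topological_space \<Rightarrow> 'c::topological_space"
  assumes "continuous_map T euclidean f" "continuous_on UNIV g"
  shows "continuous_map T euclidean (\<lambda>x. g (f x))"
  using continuous_map_compose[OF assms(1), of euclidean g] assms(2) by (simp add: o_def)

lemma cont_ent_smult:
  assumes "cont_ent K n X u"
  shows "cont_ent K n X (\<lambda>j c d x. a * u j c d x)"
  using assms unfolding cont_ent_def
  by (intro allI impI continuous_map_continuous_on_compose[where g = "\<lambda>z. a * z"]) (auto intro: continuous_intros)

lemma continuous_map_mult_algebra:
  fixes f g :: "'a \<Rightarrow> 'b::real_normed_algebra"
  shows "continuous_map T euclidean f \<Longrightarrow> continuous_map T euclidean g \<Longrightarrow>
    continuous_map T euclidean (\<lambda>x. f x * g x)"
  by (simp add: continuous_map_atin tendsto_mult)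

lemma cont_ent_mult: "cont_ent K n X u \<Longrightarrow> cont_ent K n X v \<Longrightarrow> cont_ent K n X (ent_mult n u v)"
  unfolding cont_ent_def ent_mult_def
  by (auto intro!: continuous_map_sum continuous_map_mult_algebra)

lemma cont_ent_star:
  assumes "cont_ent K n X u"
  shows "cont_ent K n X (\<lambda>j c d x. cnj (u j d c x))"
  using assms unfolding cont_ent_def
  by (intro allI impI continuous_map_continuous_on_compose[where g = "cnj"]) (auto intro: continuous_intros)

lemma cont_ent_diag:
  "(\<And>j c. j < K \<Longrightarrow> c < n j \<Longrightarrow> continuous_map (mtopology_of (X j)) euclidean (g j c)) \<Longrightarrow>
    cont_ent K n X (ent_diag g)"
  by (auto simp: cont_ent_def ent_diag_def)

lemma cont_ent_unit:
  "(j < K \<Longrightarrow> continuous_map (mtopology_of (X j)) euclidean g) \<Longrightarrow> cont_ent K n X (ent_unit j c d g)"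
  by (auto simp: cont_ent_def ent_unit_def)

subsection \<open>Norms\<close>

text \<open>A crude bound, whose purpose is to show that the supremum defining
  \<open>mat_opnorm\<close> is taken over a bounded set.\<close>

lemma vec_l2_mult_le:
  assumes "M \<in> carrier_mat n n" "v \<in> carrier_vec n" "vec_l2 v \<le> 1"
  shows "vec_l2 (M *\<^sub>v v) \<le> (\<Sum>i<n. \<Sum>k<n. cmod (M $$ (i, k)))"
proof -
  have v: "cmod (vec_index v k) \<le> 1" if "k < n" for k
    using member_le_L2_set[of "{..<n}" k "\<lambda>i. cmod (vec_index v i)"] that assms(2,3)
    by (simp add: vec_l2_def)
  have "vec_l2 (M *\<^sub>v v) \<le> (\<Sum>i<n. cmod (vec_index (M *\<^sub>v v) i))"
    using assms(1) by (simp add: vec_l2_def L2_set_le_sum del: index_mult_mat_vec)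
  also have "\<dots> \<le> (\<Sum>i<n. \<Sum>k<n. cmod (M $$ (i, k)))"
  proof (rule sum_mono)
    fix i assume "i \<in> {..<n}"
    then have "vec_index (M *\<^sub>v v) i = (\<Sum>k<n. M $$ (i, k) * vec_index v k)"
      using assms by (auto simp: scalar_prod_def atLeast0LessThan)
    also have "cmod \<dots> \<le> (\<Sum>k<n. cmod (M $$ (i, k)))"
      using v by (intro sum_norm_le) (auto simp: norm_mult mult_left_le)
    finally show "cmod (vec_index (M *\<^sub>v v) i) \<le> (\<Sum>k<n. cmod (M $$ (i, k)))" .
  qed
  finally show ?thesis .
qed

lemma
  assumes "M \<in> carrier_mat n n"
  shows mat_opnorm_le_sum: "mat_opnorm M \<le> (\<Sum>i<n. \<Sum>k<n. cmod (M $$ (i, k)))" (is ?upper)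
    and entry_le_mat_opnorm: "c < n \<Longrightarrow> d < n \<Longrightarrow> cmod (M $$ (c, d)) \<le> mat_opnorm M" (is "_ \<Longrightarrow> _ \<Longrightarrow> ?lower")
proof -
  let ?B = "{v \<in> carrier_vec (dim_col M). vec_l2 v \<le> 1}"
  have bound: "vec_l2 (M *\<^sub>v v) \<le> (\<Sum>i<n. \<Sum>k<n. cmod (M $$ (i, k)))" if "v \<in> ?B" for v
    using vec_l2_mult_le[OF assms, of v] that assms by auto
  have "0\<^sub>v (dim_col M) \<in> ?B" by (simp add: vec_l2_def L2_set_def)
  then have "?B \<noteq> {}" by blast
  then show ?upper unfolding mat_opnorm_def using bound by (rule cSUP_least)
  assume cd: "c < n" "d < n"
  have bdd: "bdd_above ((\<lambda>v. vec_l2 (M *\<^sub>v v)) ` ?B)" using bound by (rule bdd_aboveI2)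
  have "(\<Sum>i<n. (cmod (vec_index (unit_vec n d) i))\<^sup>2) = (\<Sum>i<n. if i = d then 1 else 0)"
    using cd by (intro sum.cong) auto
  then have "vec_l2 (unit_vec n d) = 1"
    unfolding vec_l2_def L2_set_def using cd by simp
  then have "unit_vec n d \<in> ?B" using assms cd by simp
  then have "vec_l2 (M *\<^sub>v unit_vec n d) \<le> mat_opnorm M"
    unfolding mat_opnorm_def by (rule cSUP_upper[OF _ bdd])
  moreover have "cmod (vec_index (M *\<^sub>v unit_vec n d) c) \<le> vec_l2 (M *\<^sub>v unit_vec n d)"
    unfolding vec_l2_def using assms cd by (intro member_le_L2_set) auto
  moreover have "vec_index (M *\<^sub>v unit_vec n d) c = M $$ (c, d)"
    using assms cd by (simp add: scalar_prod_right_unit)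
  ultimately show ?lower by simp
qed

text \<open>The bound by the sum of all entries grows with the matrix size. Along the sequence a
  bound independent of the size is required, and diagonal matrices admit one.\<close>

lemma mat_opnorm_diag_le:
  assumes M: "M \<in> carrier_mat n n" and "\<delta> \<ge> 0"
    and diag: "\<And>a b. a < n \<Longrightarrow> b < n \<Longrightarrow> a \<noteq> b \<Longrightarrow> M $$ (a, b) = 0"
    and le: "\<And>a. a < n \<Longrightarrow> cmod (M $$ (a, a)) \<le> \<delta>"
  shows "mat_opnorm M \<le> \<delta>"
  unfolding mat_opnorm_def
proof (rule cSUP_least)
  have "0\<^sub>v (dim_col M) \<in> {v \<in> carrier_vec (dim_col M). vec_l2 v \<le> 1}"
    by (simp add: vec_l2_def L2_set_def)
  then show "{v \<in> carrier_vec (dim_col M). vec_l2 v \<le> 1} \<noteq> {}" by blast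
next
  fix v assume v: "v \<in> {v \<in> carrier_vec (dim_col M). vec_l2 v \<le> 1}"
  have idx: "vec_index (M *\<^sub>v v) i = M $$ (i, i) * vec_index v i" if "i < n" for i
  proof -
    have "vec_index (M *\<^sub>v v) i = (\<Sum>k<n. M $$ (i, k) * vec_index v k)"
      using v M that by (auto simp: scalar_prod_def atLeast0LessThan)
    also have "\<dots> = (\<Sum>k<n. if k = i then M $$ (i, i) * vec_index v i else 0)"
      using diag that by (intro sum.cong) auto
    finally show ?thesis using that by simp
  qed
  have "vec_l2 (M *\<^sub>v v) = L2_set (\<lambda>i. cmod (M $$ (i, i) * vec_index v i)) {..<n}"
    unfolding vec_l2_def using M idx by (intro L2_set_cong) auto
  also have "\<dots> \<le> L2_set (\<lambda>i. \<delta> * cmod (vec_index v i)) {..<n}"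
    using le by (intro L2_set_mono) (auto simp: norm_mult intro!: mult_right_mono)
  also have "\<dots> = \<delta> * vec_l2 v"
    unfolding vec_l2_def using v M \<open>\<delta> \<ge> 0\<close> by (subst L2_set_right_distrib) auto
  also have "\<dots> \<le> \<delta>" using v \<open>\<delta> \<ge> 0\<close> by (simp add: mult_left_le)
  finally show "vec_l2 (M *\<^sub>v v) \<le> \<delta>" .
qed

lemma continuous_map_compact_bounded:
  fixes g :: "'x \<Rightarrow> 'b::metric_space"
  assumes "continuous_map T euclidean g" "compact_space T"
  shows "bounded (g ` topspace T)"
  using image_compactin[OF _ assms(1), of "topspace T"] assms(2)
  by (simp add: compact_space_def compact_imp_bounded)

text \<open>Compactness bounds the entries and with them the operator norms, so the supremum over
  the points really is an upper bound.\<close>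

lemma entry_le_nrm:
  assumes f: "f \<in> carrier (AH_building_block K n X)"
    and compact: "compact_space (mtopology_of (X j))"
    and jcd: "j < K" "c < n j" "d < n j" and x: "x \<in> mspace (X j)"
  shows "cmod (f j x $$ (c, d)) \<le> nrm (AH_building_block K n X) f"
proof -
  have fx: "f j y \<in> carrier_mat (n j) (n j)" if "y \<in> mspace (X j)" for y
    using f jcd that by (auto simp: AH_building_block_carrier)
  have "\<exists>B. \<forall>y\<in>mspace (X j). cmod (f j y $$ (a, b)) \<le> B" if "a < n j" "b < n j" for a b
  proof -
    have "continuous_map (mtopology_of (X j)) euclidean (\<lambda>y. f j y $$ (a, b))"
      using f jcd that by (auto simp: AH_building_block_carrier cont_ent_def ent_def)
    from continuous_map_compact_bounded[OF this compact] show ?thesis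
      by (auto simp: bounded_iff)
  qed
  then obtain B where B: "\<And>a b y. a < n j \<Longrightarrow> b < n j \<Longrightarrow> y \<in> mspace (X j) \<Longrightarrow> cmod (f j y $$ (a, b)) \<le> B a b"
    by metis
  have "bdd_above ((\<lambda>y. mat_opnorm (f j y)) ` mspace (X j))"
  proof (rule bdd_aboveI2)
    fix y assume y: "y \<in> mspace (X j)"
    show "mat_opnorm (f j y) \<le> (\<Sum>i<n j. \<Sum>k<n j. B i k)"
      using B y by (intro order_trans[OF mat_opnorm_le_sum[OF fx[OF y]]] sum_mono) auto
  qed
  then have "mat_opnorm (f j x) \<le> nrm (mat_C (n j) (X j)) (f j)"
    unfolding mat_C_def using x by (auto intro: cSUP_upper)
  also have "\<dots> \<le> nrm (AH_building_block K n X) f"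
    unfolding AH_building_block_def direct_sum_def using jcd by (auto intro!: Max_ge)
  finally show ?thesis using entry_le_mat_opnorm[OF fx[OF x] jcd(2,3)] by simp
qed

lemma nrm_diag_le:
  assumes f: "f \<in> carrier (AH_building_block K n X)"
    and "K \<ge> 1" "\<And>j. j < K \<Longrightarrow> mspace (X j) \<noteq> {}" "\<delta> \<ge> 0"
    and diag: "\<And>j a b x. j < K \<Longrightarrow> a < n j \<Longrightarrow> b < n j \<Longrightarrow> x \<in> mspace (X j) \<Longrightarrow> a \<noteq> b \<Longrightarrow> f j x $$ (a, b) = 0"
    and le: "\<And>j a x. j < K \<Longrightarrow> a < n j \<Longrightarrow> x \<in> mspace (X j) \<Longrightarrow> cmod (f j x $$ (a, a)) \<le> \<delta>"
  shows "nrm (AH_building_block K n X) f \<le> \<delta>"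
proof -
  have "nrm (mat_C (n j) (X j)) (f j) \<le> \<delta>" if "j < K" for j
    unfolding mat_C_def
  proof (simp, rule cSUP_least)
    fix x assume "x \<in> mspace (X j)"
    then show "mat_opnorm (f j x) \<le> \<delta>"
      using f that diag le \<open>\<delta> \<ge> 0\<close> by (intro mat_opnorm_diag_le[of _ "n j"]) (auto simp: AH_building_block_carrier)
  qed (use assms that in auto)
  then show ?thesis
    unfolding AH_building_block_def direct_sum_def using \<open>K \<ge> 1\<close>
    by (simp, subst Max_le_iff) (auto simp: lessThan_empty_iff)
qed

section \<open>Diagonal connecting maps\<close>

text \<open>With blocks of equal size, coordinate \<open>a\<close> sits in block
  \<open>a div n\<close> at position \<open>a mod n\<close>; the quotients from
  \<open>length As\<close> on belong to the trailing zero block.\<close>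

lemma diag_block_mat_uniform:
  fixes As :: "'a::zero mat list" and k :: nat
  assumes "\<And>A. A \<in> set As \<Longrightarrow> A \<in> carrier_mat n n" "n \<ge> 1"
  defines "D \<equiv> diag_block_mat (As @ [0\<^sub>m k k])"
  shows "D \<in> carrier_mat (length As * n + k) (length As * n + k) \<and>
    (\<forall>a<length As * n + k. \<forall>b<length As * n + k. D $$ (a, b) =
      (if a div n = b div n \<and> a div n < length As then (As ! (a div n)) $$ (a mod n, b mod n) else 0))"
  using assms(1) unfolding D_def
proof (induction As)
  case Nil
  then show ?case by simp
next
  case (Cons A As)
  let ?D = "diag_block_mat (As @ [0\<^sub>m k k])" and ?N = "length As * n + k"
  have A: "A \<in> carrier_mat n n" using Cons.prems by simp
  have "B \<in> carrier_mat n n" if "B \<in> set As" for B using Cons.prems that by simp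
  note IH' = Cons.IH[OF this]
  have IH: "?D \<in> carrier_mat ?N ?N" using IH' by blast
  have ent: "?D $$ (a, b) =
      (if a div n = b div n \<and> a div n < length As then (As ! (a div n)) $$ (a mod n, b mod n) else 0)"
    if "a < ?N" "b < ?N" for a b
    using IH' that by blast
  have D: "diag_block_mat ((A # As) @ [0\<^sub>m k k]) = four_block_mat A (0\<^sub>m n ?N) (0\<^sub>m ?N n) ?D"
    unfolding append_Cons diag_block_mat.simps Let_def carrier_matD[OF A] carrier_matD[OF IH] ..
  have div: "a div n = Suc ((a - n) div n)" "a mod n = (a - n) mod n" if "\<not> a < n" for a
    using that assms(2) by (simp only: le_div_geq not_less, simp only: le_mod_geq not_less)
  show ?case
  proof (intro conjI allI impI)
    show "diag_block_mat ((A # As) @ [0\<^sub>m k k])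
        \<in> carrier_mat (length (A # As) * n + k) (length (A # As) * n + k)"
      unfolding D using A IH by (simp add: add.assoc)
  next
    fix a b assume ab: "a < length (A # As) * n + k" "b < length (A # As) * n + k"
    have "diag_block_mat ((A # As) @ [0\<^sub>m k k]) $$ (a, b) =
      (if a < n then if b < n then A $$ (a, b) else 0
       else if b < n then 0 else ?D $$ (a - n, b - n))"
      unfolding D using ab A IH by (auto simp: add.assoc)
    also have "\<dots> = (if a div n = b div n \<and> a div n < length (A # As)
        then ((A # As) ! (a div n)) $$ (a mod n, b mod n) else 0)"
    proof (cases "a < n \<or> b < n")
      case True
      then show ?thesis using div(1)[of a] div(1)[of b] by (cases "a < n"; cases "b < n") simp_all
    next
      case False
      then have "?D $$ (a - n, b - n) = (if (a - n) div n = (b - n) div n \<and> (a - n) div n < length As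
          then (As ! ((a - n) div n)) $$ ((a - n) mod n, (b - n) mod n) else 0)"
        using ab by (intro ent) auto
      moreover from False have a: "\<not> a < n" and b: "\<not> b < n" by auto
      ultimately show ?thesis unfolding div(1)[OF a] div(2)[OF a] div(1)[OF b] div(2)[OF b] by simp
    qed
    finally show "diag_block_mat ((A # As) @ [0\<^sub>m k k]) $$ (a, b) =
        (if a div n = b div n \<and> a div n < length (A # As)
        then ((A # As) ! (a div n)) $$ (a mod n, b mod n) else 0)" .
  qed
qed

text \<open>
  A diagonal seed sends coordinate \<open>a \<in> Act\<close> to position \<open>\<rho> a\<close> of block \<open>\<kappa> a\<close>; the zero map is
  the case \<open>Act = {}\<close>.
\<close>

definition seed_data :: "nat \<Rightarrow> 'x metric \<Rightarrow> nat \<Rightarrow> 'x metric \<Rightarrow>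
    nat set \<Rightarrow> (nat \<Rightarrow> nat) \<Rightarrow> (nat \<Rightarrow> nat) \<Rightarrow> (nat \<Rightarrow> 'x \<Rightarrow> 'x) \<Rightarrow> bool" where
  "seed_data n X n' Y Act \<kappa> \<rho> l \<longleftrightarrow>
     Act \<subseteq> {..<n'} \<and> inj_on (\<lambda>a. (\<kappa> a, \<rho> a)) Act \<and> (\<forall>a\<in>Act. \<rho> a < n) \<and>
     (\<forall>a\<in>Act. \<forall>y\<in>mspace Y. l (\<kappa> a) y \<in> mspace X)"

definition seed_entry ::
    "nat set \<Rightarrow> (nat \<Rightarrow> nat) \<Rightarrow> (nat \<Rightarrow> nat) \<Rightarrow> (nat \<Rightarrow> 'x \<Rightarrow> 'x) \<Rightarrow> ('x \<Rightarrow> complex mat) \<Rightarrow>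
      nat \<Rightarrow> nat \<Rightarrow> 'x \<Rightarrow> complex" where
  "seed_entry Act \<kappa> \<rho> l F a b y =
     (if a \<in> Act \<and> b \<in> Act \<and> \<kappa> a = \<kappa> b then F (l (\<kappa> a) y) $$ (\<rho> a, \<rho> b) else 0)"

text \<open>The permutation is absorbed into the coordinates: \<open>a\<close> belongs to block
  \<open>p a div n\<close> at position \<open>p a mod n\<close>, and it is active if that block
  precedes the zero tail. Injectivity of \<open>p\<close> and division with remainder make the pair
  determine \<open>a\<close>.\<close>

lemma has_diagonal_seed_data:
  assumes seed: "has_diagonal_seed n X n' Y \<psi>" and n: "n \<ge> 1"
  obtains Act \<kappa> \<rho> l where "seed_data n X n' Y Act \<kappa> \<rho> l"
    "\<And>F a b y. F \<in> carrier (mat_C n X) \<Longrightarrow> a < n' \<Longrightarrow> b < n' \<Longrightarrow> y \<in> mspace Y \<Longrightarrow>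
       \<psi> F y $$ (a, b) = seed_entry Act \<kappa> \<rho> l F a b y"
proof -
  consider "\<forall>F\<in>carrier (mat_C n X). \<psi> F = zero (mat_C n' Y)"
    | m l p where "m * n \<le> n'" "p permutes {..<n'}"
        "\<forall>k<m. continuous_map (mtopology_of Y) (mtopology_of X) (l k)"
        "\<forall>F\<in>carrier (mat_C n X). \<forall>y\<in>mspace Y.
           \<psi> F y = Matrix.mat n' n' (\<lambda>(a, b).
             diag_block_mat (map (\<lambda>k. F (l k y)) [0..<m] @ [0\<^sub>m (n' - m * n) (n' - m * n)])
               $$ (p a, p b))"
    using seed unfolding has_diagonal_seed_def by blast
  then show ?thesis
  proof cases
    case 1
    show ?thesis
    proof (rule that)
      show "seed_data n X n' Y {} id id (\<lambda>k y. y)" by (simp add: seed_data_def)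
      show "\<psi> F y $$ (a, b) = seed_entry {} id id (\<lambda>k y. y) F a b y"
        if "F \<in> carrier (mat_C n X)" "a < n'" "b < n'" "y \<in> mspace Y" for F a b y
        using 1 that by (simp add: seed_entry_def mat_C_def)
    qed
  next
    case (2 m l p)
    define Act where "Act = {a. a < n' \<and> p a div n < m}"
    have l: "l k y \<in> mspace X" if "k < m" "y \<in> mspace Y" for k y
      using 2(3) that continuous_map_funspace[of "mtopology_of Y" "mtopology_of X" "l k"] by auto
    have pn: "p a < n'" if "a < n'" for a using permutes_in_image[OF 2(2), of a] that by simp
    show ?thesis
    proof (rule that)
      show "seed_data n X n' Y Act (\<lambda>a. p a div n) (\<lambda>a. p a mod n) l"
        unfolding seed_data_def
      proof (intro conjI ballI)
        show "inj_on (\<lambda>a. (p a div n, p a mod n)) Act"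
        proof (rule inj_onI)
          fix a b assume "(p a div n, p a mod n) = (p b div n, p b mod n)"
          then have "p a = p b" by (metis div_mult_mod_eq prod.inject)
          then show "a = b" using permutes_inj[OF 2(2)] by (simp add: inj_eq)
        qed
      next
        show "p a mod n < n" for a using n by simp
        show "l (p a div n) y \<in> mspace X" if "a \<in> Act" "y \<in> mspace Y" for a y
          using l that by (simp add: Act_def)
      qed (simp add: Act_def subset_iff)
    next
      fix F a b y assume F: "F \<in> carrier (mat_C n X)" and ab: "a < n'" "b < n'" and y: "y \<in> mspace Y"
      let ?As = "map (\<lambda>k. F (l k y)) [0..<m]"
      have As: "A \<in> carrier_mat n n" if "A \<in> set ?As" for A
        using that F l[OF _ y] by (auto simp: mat_C_def)
      from diag_block_mat_uniform[of ?As n "n' - m * n", OF As n]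
      have "diag_block_mat (?As @ [0\<^sub>m (n' - m * n) (n' - m * n)]) $$ (p a, p b) =
          (if p a div n = p b div n \<and> p a div n < m then (?As ! (p a div n)) $$ (p a mod n, p b mod n) else 0)"
        using pn[OF ab(1)] pn[OF ab(2)] 2(1) by simp
      moreover have "\<psi> F y $$ (a, b) =
          diag_block_mat (?As @ [0\<^sub>m (n' - m * n) (n' - m * n)]) $$ (p a, p b)"
        using 2(4)[rule_format, OF F y] ab by simp
      ultimately show "\<psi> F y $$ (a, b) = seed_entry Act (\<lambda>a. p a div n) (\<lambda>a. p a mod n) l F a b y"
        unfolding seed_entry_def Act_def using ab by auto
    qed
  qed
qed

text \<open>Within one block, the position \<open>\<rho>\<close> determines the coordinate, and
  there are \<open>n\<close> positions.\<close>

lemma seed_block_card: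
  assumes "seed_data n X n' Y Act \<kappa> \<rho> l"
  shows "card {b \<in> Act. \<kappa> b = k} \<le> n"
proof -
  have "inj_on \<rho> {b \<in> Act. \<kappa> b = k}" "\<rho> ` {b \<in> Act. \<kappa> b = k} \<subseteq> {..<n}"
    using assms by (auto simp: seed_data_def inj_on_def)
  then show ?thesis using card_inj_on_le[of \<rho> _ "{..<n}"] by auto
qed

lemma conn_Suc_add: "conn \<phi> i (k + k') = conn \<phi> (i + k) k' \<circ> conn \<phi> i k"
proof (induction k')
  case (Suc k')
  then show ?case by (simp add: comp_assoc add.assoc)
qed simp

lemma unital_star_homD:
  assumes "unital_star_hom A B h"
  shows "a \<in> carrier A \<Longrightarrow> h a \<in> carrier B"
    "a \<in> carrier A \<Longrightarrow> b \<in> carrier A \<Longrightarrow> h (add A a b) = add B (h a) (h b)"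
    "a \<in> carrier A \<Longrightarrow> b \<in> carrier A \<Longrightarrow> h (monoid.mult A a b) = monoid.mult B (h a) (h b)"
    "h (one A) = one B"
    "a \<in> carrier A \<Longrightarrow> h (smult A c a) = smult B c (h a)"
    "a \<in> carrier A \<Longrightarrow> h (star A a) = star B (h a)"
  using assms unfolding unital_star_hom_def ring_hom_def by auto

lemma unital_star_hom_comp:
  assumes "unital_star_hom A B g" "unital_star_hom B C h"
  shows "unital_star_hom A C (h \<circ> g)"
proof -
  note g = unital_star_homD[OF assms(1)] and h = unital_star_homD[OF assms(2)]
  show ?thesis
    unfolding unital_star_hom_def ring_hom_def by (simp add: g h)
qed

section \<open>The inductive limit in terms of entries\<close>

locale ah_limit =
  fixes K :: "nat \<Rightarrow> nat" and n :: "nat \<Rightarrow> nat \<Rightarrow> nat" and X :: "nat \<Rightarrow> nat \<Rightarrow> 'x metric"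
    and \<phi> :: "nat \<Rightarrow> (nat \<Rightarrow> 'x \<Rightarrow> complex mat) \<Rightarrow> (nat \<Rightarrow> 'x \<Rightarrow> complex mat)"
    and \<mu> :: "nat \<Rightarrow> (nat \<Rightarrow> 'x \<Rightarrow> complex mat) \<Rightarrow> 'b::unital_cstar_algebra"
  assumes AH: "AH_diagonal_limit K n X \<phi> \<mu>"
begin

abbreviation block :: "nat \<Rightarrow> (nat \<Rightarrow> 'x \<Rightarrow> complex mat) nstar_alg" where
  "block i \<equiv> AH_building_block (K i) (n i) (X i)"

abbreviation cont :: "nat \<Rightarrow> 'x entries \<Rightarrow> bool" where
  "cont i \<equiv> cont_ent (K i) (n i) (X i)"

abbreviation eqv :: "nat \<Rightarrow> 'x entries \<Rightarrow> 'x entries \<Rightarrow> bool" where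
  "eqv i \<equiv> ent_eq (K i) (n i) (X i)"

abbreviation elt :: "nat \<Rightarrow> 'x entries \<Rightarrow> (nat \<Rightarrow> 'x \<Rightarrow> complex mat)" where
  "elt i \<equiv> mk (K i) (n i) (X i)"

text \<open>The connecting maps may have kernels, so \<open>M i\<close> is not injective even up to
  \<open>eqv\<close>: equivalent entries have equal images, but not conversely.\<close>

definition M :: "nat \<Rightarrow> 'x entries \<Rightarrow> 'b" where
  "M i u = \<mu> i (elt i u)"

text \<open>Passing through \<open>elt i\<close> discards arbitrary values. Equivalent entries
  therefore have literally equal \<open>push\<close>, whereas the algebraic laws below hold up to
  \<open>eqv\<close> only.\<close>

definition push :: "nat \<Rightarrow> nat \<Rightarrow> 'x entries \<Rightarrow> 'x entries" where
  "push i k u = ent (conn \<phi> i k (elt i u))"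

lemma K_pos: "1 \<le> K i"
  and n_pos: "j < K i \<Longrightarrow> 1 \<le> n i j"
  and X_nonempty: "j < K i \<Longrightarrow> mspace (X i j) \<noteq> {}"
  and X_compact: "j < K i \<Longrightarrow> compact_space (mtopology_of (X i j))"
  using AH unfolding AH_diagonal_limit_def by blast+

lemma star_hom_\<phi>: "unital_star_hom (block i) (block (Suc i)) (\<phi> i)"
  using AH unfolding AH_diagonal_limit_def unital_inductive_sequence_def by blast

lemma inductive_limit_blocks: "inductive_limit block \<phi> \<mu>"
  using AH unfolding AH_diagonal_limit_def by blast

lemma star_hom_\<mu>: "unital_star_hom (block i) type_alg (\<mu> i)"
  and \<mu>_\<phi>: "f \<in> carrier (block i) \<Longrightarrow> \<mu> (Suc i) (\<phi> i f) = \<mu> i f"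
  and nrm_limit: "f \<in> carrier (block i) \<Longrightarrow>
    (\<lambda>k. nrm (block (i + k)) (conn \<phi> i k f)) \<longlonglongrightarrow> norm (\<mu> i f)"
  and dense_union: "closure (\<Union>i. \<mu> i ` carrier (block i)) = UNIV"
  using inductive_limit_blocks unfolding inductive_limit_def by blast+

lemma star_hom_conn: "unital_star_hom (block i) (block (i + k)) (conn \<phi> i k)"
proof (induction k)
  case 0
  then show ?case by (simp add: unital_star_hom_def ring_hom_def)
next
  case (Suc k)
  from unital_star_hom_comp[OF this star_hom_\<phi>[of "i + k"]] show ?case by (simp add: comp_def)
qed

lemma \<mu>_conn: "f \<in> carrier (block i) \<Longrightarrow> \<mu> (i + k) (conn \<phi> i k f) = \<mu> i f"
proof (induction k)
  case (Suc k)
  then show ?case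
    using \<mu>_\<phi>[of "conn \<phi> i k f" "i + k"] unital_star_homD(1)[OF star_hom_conn] by simp
qed simp

lemma M_cong: "eqv i u v \<Longrightarrow> M i u = M i v"
  using mk_cong unfolding M_def by metis

lemma
  assumes "cont i u"
  shows M_add: "cont i v \<Longrightarrow> M i (\<lambda>j c d x. u j c d x + v j c d x) = M i u + M i v"
    and M_mult: "cont i v \<Longrightarrow> M i (ent_mult (n i) u v) = M i u * M i v"
    and M_scale: "M i (\<lambda>j c d x. a * u j c d x) = scaleC a (M i u)"
    and M_star: "M i (\<lambda>j c d x. cnj (u j d c x)) = adj (M i u)"
proof -
  note hom = unital_star_homD[OF star_hom_\<mu>[of i]] and u = mk_carrier[OF assms]
  show "M i (\<lambda>j c d x. a * u j c d x) = scaleC a (M i u)"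
    using hom(5)[OF u, of a] by (simp add: M_def mk_smult type_alg_def)
  show "M i (\<lambda>j c d x. cnj (u j d c x)) = adj (M i u)"
    using hom(6)[OF u] by (simp add: M_def mk_star type_alg_def)
  assume "cont i v"
  note v = mk_carrier[OF this]
  show "M i (\<lambda>j c d x. u j c d x + v j c d x) = M i u + M i v"
    using hom(2)[OF u v] by (simp add: M_def mk_add type_alg_def)
  show "M i (ent_mult (n i) u v) = M i u * M i v"
    using hom(3)[OF u v] by (simp add: M_def mk_mult type_alg_def)
qed

lemma M_zero: "M i (\<lambda>j c d x. 0) = 0"
  using M_scale[of i "\<lambda>j c d x. 0" 0] by (simp add: cont_ent_const)

lemma M_one: "M i (ent_diag (\<lambda>j c x. 1)) = 1"
  using unital_star_homD(4)[OF star_hom_\<mu>[of i]] by (simp add: M_def mk_one type_alg_def)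

lemma M_diff: "cont i u \<Longrightarrow> cont i v \<Longrightarrow> M i (\<lambda>j c d x. u j c d x - v j c d x) = M i u - M i v"
  using M_add[of i u "\<lambda>j c d x. - 1 * v j c d x"] M_scale[of i v "- 1"] cont_ent_smult[of "K i" "n i" "X i" v "- 1"]
  by (simp add: scaleC_minus_one)

lemma M_sum:
  assumes "\<And>s. s \<in> I \<Longrightarrow> cont i (u s)"
  shows "M i (\<lambda>j c d x. \<Sum>s\<in>I. u s j c d x) = (\<Sum>s\<in>I. M i (u s))"
    and "cont i (\<lambda>j c d x. \<Sum>s\<in>I. u s j c d x)"
proof -
  have "cont i (\<lambda>j c d x. \<Sum>s\<in>I. u s j c d x) \<and>
    M i (\<lambda>j c d x. \<Sum>s\<in>I. u s j c d x) = (\<Sum>s\<in>I. M i (u s))"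
    using assms
  proof (induction I rule: infinite_finite_induct)
    case (insert s I)
    then have IH: "cont i (\<lambda>j c d x. \<Sum>s\<in>I. u s j c d x)" "cont i (u s)"
      "M i (\<lambda>j c d x. \<Sum>s\<in>I. u s j c d x) = (\<Sum>s\<in>I. M i (u s))" by auto
    show ?case
      using insert.hyps cont_ent_add[OF IH(2,1)] M_add[OF IH(2,1)] IH(3) by simp
  qed (auto simp: M_zero cont_ent_const)
  then show "M i (\<lambda>j c d x. \<Sum>s\<in>I. u s j c d x) = (\<Sum>s\<in>I. M i (u s))"
    and "cont i (\<lambda>j c d x. \<Sum>s\<in>I. u s j c d x)" by auto
qed

text \<open>The image of the algebraic direct limit, dense but in general not closed.\<close>

definition V :: "'b set" where
  "V = {M i u |i u. cont i u}"

lemma \<mu>_carrier_eq: "\<mu> i ` carrier (block i) = {M i u |u. cont i u}"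
proof
  show "\<mu> i ` carrier (block i) \<subseteq> {M i u |u. cont i u}"
  proof
    fix y assume "y \<in> \<mu> i ` carrier (block i)"
    then obtain f where "f \<in> carrier (block i)" "y = \<mu> i f" by blast
    then have "y = M i (ent f)" "cont i (ent f)" by (simp_all add: M_def mk_ent cont_ent_ent)
    then show "y \<in> {M i u |u. cont i u}" by blast
  qed
  show "{M i u |u. cont i u} \<subseteq> \<mu> i ` carrier (block i)"
    by (auto simp: M_def mk_carrier)
qed

lemma closure_V: "closure V = UNIV"
proof -
  have "V = (\<Union>i. \<mu> i ` carrier (block i))"
    unfolding \<mu>_carrier_eq V_def by blast
  then show ?thesis using dense_union by simp
qed

lemma conn_elt:
  assumes "cont i u"
  shows "conn \<phi> i k (elt i u) = elt (i + k) (push i k u)" and "cont (i + k) (push i k u)"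
  using unital_star_homD(1)[OF star_hom_conn mk_carrier[OF assms]]
  by (simp_all add: push_def mk_ent cont_ent_ent)

lemma M_push: "cont i u \<Longrightarrow> M (i + k) (push i k u) = M i u"
  unfolding M_def by (simp add: conn_elt(1)[symmetric] \<mu>_conn mk_carrier)

lemma push_eqv:
  assumes "conn \<phi> i k (elt i u) = elt (i + k) v"
  shows "eqv (i + k) (push i k u) v"
  unfolding ent_eq_def push_def assms by (auto simp: ent_mk)

lemma
  assumes u: "cont i u"
  shows push_add: "cont i v \<Longrightarrow> eqv (i + k) (push i k (\<lambda>j c d x. u j c d x + v j c d x))
      (\<lambda>j c d x. push i k u j c d x + push i k v j c d x)"
    and push_mult: "cont i v \<Longrightarrow> eqv (i + k) (push i k (ent_mult (n i) u v))
      (ent_mult (n (i + k)) (push i k u) (push i k v))"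
    and push_scale: "eqv (i + k) (push i k (\<lambda>j c d x. a * u j c d x)) (\<lambda>j c d x. a * push i k u j c d x)"
    and push_star: "eqv (i + k) (push i k (\<lambda>j c d x. cnj (u j d c x))) (\<lambda>j c d x. cnj (push i k u j d c x))"
proof -
  note hom = unital_star_homD[OF star_hom_conn[of i k]] and u' = mk_carrier[OF u]
  note elt = conn_elt(1)[OF u, of k]
  show "eqv (i + k) (push i k (\<lambda>j c d x. a * u j c d x)) (\<lambda>j c d x. a * push i k u j c d x)"
    using hom(5)[OF u', of a] by (intro push_eqv) (simp add: mk_smult elt)
  show "eqv (i + k) (push i k (\<lambda>j c d x. cnj (u j d c x))) (\<lambda>j c d x. cnj (push i k u j d c x))"
    using hom(6)[OF u'] by (intro push_eqv) (simp add: mk_star elt)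
  assume v: "cont i v"
  note v' = mk_carrier[OF v] and elt' = conn_elt(1)[OF v, of k]
  show "eqv (i + k) (push i k (\<lambda>j c d x. u j c d x + v j c d x))
      (\<lambda>j c d x. push i k u j c d x + push i k v j c d x)"
    using hom(2)[OF u' v'] by (intro push_eqv) (simp add: mk_add elt elt')
  show "eqv (i + k) (push i k (ent_mult (n i) u v)) (ent_mult (n (i + k)) (push i k u) (push i k v))"
    using hom(3)[OF u' v'] by (intro push_eqv) (simp add: mk_mult elt elt')
qed

lemma push_one: "eqv (i + k) (push i k (ent_diag (\<lambda>j c x. 1))) (ent_diag (\<lambda>j c x. 1))"
  using unital_star_homD(4)[OF star_hom_conn[of i k]] by (auto intro!: push_eqv simp: mk_one)

lemma push_push: "cont i u \<Longrightarrow> push (i + k) k' (push i k u) = push i (k + k') u"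
  unfolding push_def conn_Suc_add
  by (simp add: mk_ent unital_star_homD(1)[OF star_hom_conn] mk_carrier)

lemma cmod_push_le:
  assumes "cont i u" "j < K (i + k)" "c < n (i + k) j" "d < n (i + k) j" "x \<in> mspace (X (i + k) j)"
  shows "cmod (push i k u j c d x) \<le> nrm (block (i + k)) (conn \<phi> i k (elt i u))"
  using entry_le_nrm[OF unital_star_homD(1)[OF star_hom_conn mk_carrier[OF assms(1)]] X_compact] assms
  by (simp add: push_def ent_def)

section \<open>Entries of the connecting maps\<close>

lemma push_cong: "eqv i u v \<Longrightarrow> push i k u = push i k v"
  unfolding push_def using mk_cong by metis

lemma push_zero:
  "j < K (i + k) \<Longrightarrow> a < n (i + k) j \<Longrightarrow> b < n (i + k) j \<Longrightarrow> y \<in> mspace (X (i + k) j) \<Longrightarrow>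
    push i k (\<lambda>j c d x. 0) j a b y = 0"
  using push_scale[of i "\<lambda>j c d x. 0" k 0] by (simp add: cont_ent_const ent_eq_def)

text \<open>The seed condition describes connecting maps on one summand at a time; additivity
  assembles these descriptions. The induction runs over the truncations of \<open>u\<close> to the
  first \<open>m\<close> summands.\<close>

lemma push_summands:
  assumes u: "cont i u" and j': "j' < K (i + k)" "a < n (i + k) j'" "b < n (i + k) j'" "y \<in> mspace (X (i + k) j')"
  shows "push i k u j' a b y = (\<Sum>j<K i. push i k (\<lambda>j0 c d x. if j0 = j then u j0 c d x else 0) j' a b y)"
proof -
  let ?v = "\<lambda>m j0 c d x. if j0 = m then u j0 c d x else 0"
  let ?w = "\<lambda>m j0 c d x. if j0 < m then u j0 c d x else 0"
  have cont_v: "cont i (?v m)" and cont_w: "cont i (?w m)" for m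
    using u by (auto simp: cont_ent_def)
  have "push i k (?w m) j' a b y = (\<Sum>j<m. push i k (?v j) j' a b y)" for m
  proof (induction m)
    case 0
    then show ?case using push_zero[OF j'] by simp
  next
    case (Suc m)
    have "?w (Suc m) = (\<lambda>j c d x. ?w m j c d x + ?v m j c d x)"
      by (auto simp: fun_eq_iff)
    then show ?case
      using push_add[OF cont_w cont_v, of k m m] j' Suc.IH by (simp add: ent_eq_def)
  qed
  moreover have "push i k u = push i k (?w (K i))"
    by (rule push_cong) (simp add: ent_eq_def)
  ultimately show ?thesis by simp
qed

text \<open>In \<open>Act j' j\<close> and its companions the first index is the target summand at
  level \<open>i + k\<close>, the second the source summand at level \<open>i\<close>.\<close>

definition push_data ::
    "nat \<Rightarrow> nat \<Rightarrow> (nat \<Rightarrow> nat \<Rightarrow> nat set) \<Rightarrow> (nat \<Rightarrow> nat \<Rightarrow> nat \<Rightarrow> nat) \<Rightarrow> (nat \<Rightarrow> nat \<Rightarrow> nat \<Rightarrow> nat) \<Rightarrow>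
      (nat \<Rightarrow> nat \<Rightarrow> nat \<Rightarrow> 'x \<Rightarrow> 'x) \<Rightarrow> bool" where
  "push_data i k Act \<kappa> \<rho> l \<longleftrightarrow>
     (\<forall>j'<K (i + k). \<forall>j<K i.
       seed_data (n i j) (X i j) (n (i + k) j') (X (i + k) j') (Act j' j) (\<kappa> j' j) (\<rho> j' j) (l j' j)) \<and>
     (\<forall>u. cont i u \<longrightarrow> (\<forall>j'<K (i + k). \<forall>a<n (i + k) j'. \<forall>b<n (i + k) j'. \<forall>y\<in>mspace (X (i + k) j').
       push i k u j' a b y = (\<Sum>j<K i. if a \<in> Act j' j \<and> b \<in> Act j' j \<and> \<kappa> j' j a = \<kappa> j' j b
         then u j (\<rho> j' j a) (\<rho> j' j b) (l j' j (\<kappa> j' j a) y) else 0)))"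

lemma push_dataD:
  assumes "push_data i k Act \<kappa> \<rho> l"
  shows "\<And>j' j. j' < K (i + k) \<Longrightarrow> j < K i \<Longrightarrow>
      seed_data (n i j) (X i j) (n (i + k) j') (X (i + k) j') (Act j' j) (\<kappa> j' j) (\<rho> j' j) (l j' j)"
    "\<And>u j' a b y. cont i u \<Longrightarrow> j' < K (i + k) \<Longrightarrow> a < n (i + k) j' \<Longrightarrow> b < n (i + k) j' \<Longrightarrow>
      y \<in> mspace (X (i + k) j') \<Longrightarrow>
      push i k u j' a b y = (\<Sum>j<K i. if a \<in> Act j' j \<and> b \<in> Act j' j \<and> \<kappa> j' j a = \<kappa> j' j b
        then u j (\<rho> j' j a) (\<rho> j' j b) (l j' j (\<kappa> j' j a) y) else 0)"
  using assms unfolding push_data_def by blast+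

text \<open>The seed condition concerns \<open>i < i'\<close>, hence \<open>k \<ge> 1\<close>. A
  choice for every pair of summands turns the individual seeds into functions of \<open>j'\<close>
  and \<open>j\<close>.\<close>

lemma push_entries:
  assumes "k \<ge> 1"
  shows "\<exists>Act \<kappa> \<rho> l. push_data i k Act \<kappa> \<rho> l"
proof -
  let ?\<psi> = "\<lambda>j' j F. conn \<phi> i k ((zero (block i))(j := F)) j'"
  have seed: "has_diagonal_seed (n i j) (X i j) (n (i + k) j') (X (i + k) j') (?\<psi> j' j)"
    if "j < K i" "j' < K (i + k)" for j j'
  proof -
    have *: "\<forall>i i'. i < i' \<longrightarrow> (\<forall>j<K i. \<forall>j'<K i'.
        has_diagonal_seed (n i j) (X i j) (n i' j') (X i' j')
          (\<lambda>F. conn \<phi> i (i' - i) ((zero (block i))(j := F)) j'))"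
      using AH unfolding AH_diagonal_limit_def by blast
    have "i < i + k" using assms by simp
    from *[rule_format, OF this that] show ?thesis by simp
  qed
  define P where "P j' j A \<kappa> \<rho> l \<longleftrightarrow>
      seed_data (n i j) (X i j) (n (i + k) j') (X (i + k) j') A \<kappa> \<rho> l \<and>
      (\<forall>F a b y. F \<in> carrier (mat_C (n i j) (X i j)) \<longrightarrow> a < n (i + k) j' \<longrightarrow> b < n (i + k) j' \<longrightarrow>
        y \<in> mspace (X (i + k) j') \<longrightarrow> ?\<psi> j' j F y $$ (a, b) = seed_entry A \<kappa> \<rho> l F a b y)" for j' j A \<kappa> \<rho> l
  have "\<exists>A \<kappa> \<rho> l. P j' j A \<kappa> \<rho> l" if "j' < K (i + k)" "j < K i" for j j'
    unfolding P_def
    by (rule has_diagonal_seed_data[OF seed[OF that(2,1)] n_pos[OF that(2)]]) blast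
  then obtain Act \<kappa> \<rho> l where
    P: "\<And>j' j. j' < K (i + k) \<Longrightarrow> j < K i \<Longrightarrow> P j' j (Act j' j) (\<kappa> j' j) (\<rho> j' j) (l j' j)"
    by metis
  note data = P[unfolded P_def, THEN conjunct1]
    and entry = P[unfolded P_def, THEN conjunct2, rule_format]
  have push: "push i k u j' a b y = (\<Sum>j<K i. if a \<in> Act j' j \<and> b \<in> Act j' j \<and> \<kappa> j' j a = \<kappa> j' j b
        then u j (\<rho> j' j a) (\<rho> j' j b) (l j' j (\<kappa> j' j a) y) else 0)"
    if u: "cont i u" and j': "j' < K (i + k)" "a < n (i + k) j'" "b < n (i + k) j'" "y \<in> mspace (X (i + k) j')"
    for u j' a b y
  proof -
    have "push i k (\<lambda>j0 c d x. if j0 = j then u j0 c d x else 0) j' a b y =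
      (if a \<in> Act j' j \<and> b \<in> Act j' j \<and> \<kappa> j' j a = \<kappa> j' j b
        then u j (\<rho> j' j a) (\<rho> j' j b) (l j' j (\<kappa> j' j a) y) else 0)" if j: "j < K i" for j
    proof -
      have "elt i (\<lambda>j0 c d x. if j0 = j then u j0 c d x else 0) = (zero (block i))(j := elt i u j)"
        using j by (auto simp: mk_zero mk_def fun_eq_iff restrict_def)
      moreover have "elt i u j \<in> carrier (mat_C (n i j) (X i j))"
        using mk_carrier[OF u] j by (auto simp: AH_building_block_def direct_sum_def)
      ultimately have "push i k (\<lambda>j0 c d x. if j0 = j then u j0 c d x else 0) j' a b y =
          seed_entry (Act j' j) (\<kappa> j' j) (\<rho> j' j) (l j' j) (elt i u j) a b y"
        using entry[OF j'(1) j _ j'(2,3,4)] by (simp add: push_def ent_def)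
      then show ?thesis
        using data[OF j'(1) j] j j'(4) by (simp add: seed_entry_def seed_data_def mk_def)
    qed
    then show ?thesis
      unfolding push_summands[OF u j'] by (intro sum.cong) auto
  qed
  have "push_data i k Act \<kappa> \<rho> l"
    unfolding push_data_def by (intro conjI allI impI ballI data push)
  then show ?thesis by blast
qed

text \<open>Different coordinates of one block have different positions in it, so such a pair reads
  an off-diagonal entry of the source.\<close>

lemma push_diag_offdiag:
  assumes "k \<ge> 1" "cont i (ent_diag g)" "j < K (i + k)" "a < n (i + k) j" "b < n (i + k) j"
    "y \<in> mspace (X (i + k) j)" "a \<noteq> b"
  shows "push i k (ent_diag g) j a b y = 0"
proof -
  obtain Act \<kappa> \<rho> l where
    push_data: "push_data i k Act \<kappa> \<rho> l"
    using push_entries[OF assms(1)] by blast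
  note data = push_dataD(1)[OF push_data] and push = push_dataD(2)[OF push_data]
  show ?thesis
    unfolding push[OF assms(2-6)]
  proof (rule sum.neutral, rule ballI)
    fix j0 assume "j0 \<in> {..<K i}"
    with data[OF assms(3), of j0] \<open>a \<noteq> b\<close>
    show "(if a \<in> Act j j0 \<and> b \<in> Act j j0 \<and> \<kappa> j j0 a = \<kappa> j j0 b
        then ent_diag g j0 (\<rho> j j0 a) (\<rho> j j0 b) (l j j0 (\<kappa> j j0 a) y) else 0) = 0"
      by (auto simp: seed_data_def ent_diag_def inj_on_def)
  qed
qed

text \<open>Composition with the point maps \<open>l\<close> does not affect constants. This lets
  the generators keep a constant diagonal real part at every later level.\<close>

lemma push_diag_const:
  assumes "k \<ge> 1"
  shows "\<exists>t' :: nat \<Rightarrow> nat \<Rightarrow> real.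
    eqv (i + k) (push i k (ent_diag (\<lambda>j c x. of_real (t j c)))) (ent_diag (\<lambda>j c x. of_real (t' j c)))"
proof -
  obtain Act \<kappa> \<rho> l where
    push_data: "push_data i k Act \<kappa> \<rho> l"
    using push_entries[OF assms(1)] by blast
  note data = push_dataD(1)[OF push_data] and push = push_dataD(2)[OF push_data]
  define t' where "t' j' a = (\<Sum>j<K i. if a \<in> Act j' j then t j (\<rho> j' j a) else 0)" for j' a
  have cont: "cont i (ent_diag (\<lambda>j c x. of_real (t j c)))"
    by (rule cont_ent_diag) simp
  have "eqv (i + k) (push i k (ent_diag (\<lambda>j c x. of_real (t j c)))) (ent_diag (\<lambda>j c x. of_real (t' j c)))"
    unfolding ent_eq_def
  proof (intro allI impI ballI)
    fix j a b y
    assume jab: "j < K (i + k)" "a < n (i + k) j" "b < n (i + k) j" "y \<in> mspace (X (i + k) j)"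
    show "push i k (ent_diag (\<lambda>j c x. of_real (t j c))) j a b y = ent_diag (\<lambda>j c x. of_real (t' j c)) j a b y"
    proof (cases "a = b")
      case True
      then show ?thesis
        unfolding push[OF cont jab] by (auto simp: ent_diag_def t'_def intro!: sum.cong)
    next
      case False
      then show ?thesis using push_diag_offdiag[OF assms(1) cont jab] by (simp add: ent_diag_def)
    qed
  qed
  then show ?thesis by blast
qed

text \<open>A function on the single summand \<open>j0\<close> contributes one value of
  \<open>g\<close>, or 0, to each diagonal coordinate, so summation over the source summands does
  not spoil the bound.\<close>

lemma push_scalar_bound:
  assumes "k \<ge> 1" "continuous_map (mtopology_of (X i j0)) euclidean g"
    "\<And>x. x \<in> mspace (X i j0) \<Longrightarrow> cmod (g x) \<le> \<delta>" "\<delta> \<ge> 0"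
    "j < K (i + k)" "a < n (i + k) j" "y \<in> mspace (X (i + k) j)"
  shows "cmod (push i k (ent_diag (\<lambda>j c x. if j = j0 then g x else 0)) j a a y) \<le> \<delta>"
proof -
  obtain Act \<kappa> \<rho> l where
    push_data: "push_data i k Act \<kappa> \<rho> l"
    using push_entries[OF assms(1)] by blast
  note data = push_dataD(1)[OF push_data] and push = push_dataD(2)[OF push_data]
  have cont: "cont i (ent_diag (\<lambda>j c x. if j = j0 then g x else 0))"
    using assms(2) by (intro cont_ent_diag) auto
  have "push i k (ent_diag (\<lambda>j c x. if j = j0 then g x else 0)) j a a y =
      (\<Sum>j1<K i. if j1 = j0 then (if a \<in> Act j j0 then g (l j j0 (\<kappa> j j0 a) y) else 0) else 0)"
    unfolding push[OF cont assms(5,6,6,7)] by (intro sum.cong) (auto simp: ent_diag_def)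
  also have "\<dots> = (if j0 < K i \<and> a \<in> Act j j0 then g (l j j0 (\<kappa> j j0 a) y) else 0)"
    by (subst sum.delta) auto
  finally show ?thesis
    using data[OF assms(5), of j0] assms(3,4,7) by (auto simp: seed_data_def)
qed

text \<open>The bound on the rows of the support pattern does not depend on \<open>k\<close>.\<close>

lemma push_sparse:
  assumes "k \<ge> 1"
  obtains R :: "nat \<Rightarrow> (nat \<times> nat) set" where
    "\<And>j. sym (R j)" "\<And>j a. finite {b. (a, b) \<in> R j}"
    "\<And>j a. j < K (i + k) \<Longrightarrow> card {b. (a, b) \<in> R j} \<le> (\<Sum>j<K i. n i j)"
    "\<And>u j a b y. cont i u \<Longrightarrow> j < K (i + k) \<Longrightarrow> a < n (i + k) j \<Longrightarrow> b < n (i + k) j \<Longrightarrow>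
      y \<in> mspace (X (i + k) j) \<Longrightarrow> (a, b) \<notin> R j \<Longrightarrow> push i k u j a b y = 0"
proof -
  obtain Act \<kappa> \<rho> l where
    push_data: "push_data i k Act \<kappa> \<rho> l"
    using push_entries[OF assms(1)] by blast
  note data = push_dataD(1)[OF push_data] and push = push_dataD(2)[OF push_data]
  define R where "R j' = {(a, b). a < n (i + k) j' \<and> b < n (i + k) j' \<and>
    (\<exists>j<K i. a \<in> Act j' j \<and> b \<in> Act j' j \<and> \<kappa> j' j a = \<kappa> j' j b)}" for j'
  show ?thesis
  proof (rule that)
    show "sym (R j)" for j unfolding R_def sym_def by auto
    show fin: "finite {b. (a, b) \<in> R j}" for j a
      by (rule finite_subset[of _ "{..<n (i + k) j}"]) (auto simp: R_def)
    \<comment> \<open>A row of the pattern consists, for each source summand \<open>j\<close>, of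
      the coordinates sharing a block with \<open>a\<close>, and a block has at most
      \<open>n i j\<close> of them.\<close>
    show "card {b. (a, b) \<in> R j'} \<le> (\<Sum>j<K i. n i j)" if "j' < K (i + k)" for j' a
    proof -
      have fin': "finite {b \<in> Act j' j. \<kappa> j' j b = \<kappa> j' j a}" if "j < K i" for j
      proof -
        have "Act j' j \<subseteq> {..<n (i + k) j'}"
          using data[OF \<open>j' < K (i + k)\<close> that] by (simp add: seed_data_def)
        then show ?thesis by (auto intro: rev_finite_subset[of "{..<n (i + k) j'}"])
      qed
      have "{b. (a, b) \<in> R j'} \<subseteq> (\<Union>j<K i. {b \<in> Act j' j. \<kappa> j' j b = \<kappa> j' j a})"
        by (auto simp: R_def)
      then have "card {b. (a, b) \<in> R j'} \<le> card (\<Union>j<K i. {b \<in> Act j' j. \<kappa> j' j b = \<kappa> j' j a})"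
        using fin' by (intro card_mono) auto
      also have "\<dots> \<le> (\<Sum>j<K i. card {b \<in> Act j' j. \<kappa> j' j b = \<kappa> j' j a})"
        by (rule card_UN_le) simp
      also have "\<dots> \<le> (\<Sum>j<K i. n i j)"
        using seed_block_card[OF data[OF that]] by (intro sum_mono) auto
      finally show ?thesis .
    qed
    show "push i k u j a b y = 0" if "cont i u" "j < K (i + k)" "a < n (i + k) j" "b < n (i + k) j"
      "y \<in> mspace (X (i + k) j)" "(a, b) \<notin> R j" for u j a b y
      unfolding push[OF that(1-5)] using that(3,4,6) by (intro sum.neutral) (auto simp: R_def)
  qed
qed

text \<open>The norm in the limit is the limit of the norms of the images. For
  \<open>k \<ge> 1\<close> these images are diagonal with entries bounded by
  \<open>\<delta>\<close>.\<close>

lemma norm_M_scalar_le: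
  assumes g: "continuous_map (mtopology_of (X i j0)) euclidean g"
    and le: "\<And>x. x \<in> mspace (X i j0) \<Longrightarrow> cmod (g x) \<le> \<delta>" and \<delta>: "\<delta> \<ge> 0"
  shows "norm (M i (ent_diag (\<lambda>j c x. if j = j0 then g x else 0))) \<le> \<delta>"
proof -
  let ?u = "ent_diag (\<lambda>j c x. if j = j0 then g x else 0)"
  have cont: "cont i ?u" using g by (intro cont_ent_diag) auto
  have "nrm (block (i + k)) (conn \<phi> i k (elt i ?u)) \<le> \<delta>" if "k \<ge> 1" for k
  proof (rule nrm_diag_le)
    show "conn \<phi> i k (elt i ?u) \<in> carrier (block (i + k))"
      using unital_star_homD(1)[OF star_hom_conn mk_carrier[OF cont]] .
    show "conn \<phi> i k (elt i ?u) j x $$ (a, b) = 0"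
      if "j < K (i + k)" "a < n (i + k) j" "b < n (i + k) j" "x \<in> mspace (X (i + k) j)" "a \<noteq> b" for j a b x
      using push_diag_offdiag[OF \<open>k \<ge> 1\<close> cont that] by (simp add: push_def ent_def)
    show "cmod (conn \<phi> i k (elt i ?u) j x $$ (a, a)) \<le> \<delta>"
      if "j < K (i + k)" "a < n (i + k) j" "x \<in> mspace (X (i + k) j)" for j a x
      using push_scalar_bound[OF \<open>k \<ge> 1\<close> g le \<delta> that] by (simp add: push_def ent_def)
  qed (use K_pos X_nonempty \<delta> in auto)
  then show ?thesis
    unfolding M_def by (intro LIMSEQ_le_const2[OF nrm_limit[OF mk_carrier[OF cont]]]) blast
qed

end

section \<open>Generating matrix units\<close>

lemma ent_mult_unit:
  assumes "b < n j"
  shows "ent_mult n (ent_unit j a b f) (ent_unit j b d g) = ent_unit j a d (\<lambda>x. f x * g x)"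
proof -
  have "(\<Sum>e<n j0. ent_unit j a b f j0 c e x * ent_unit j b d g j0 e d0 x) =
      (\<Sum>e<n j0. if e = b then ent_unit j a d (\<lambda>x. f x * g x) j0 c d0 x else 0)" for j0 c d0 x
    by (intro sum.cong) (auto simp: ent_unit_def)
  then show ?thesis
    using assms by (auto simp: ent_mult_def ent_unit_def fun_eq_iff)
qed

lemma ent_mult_diag:
  "ent_eq K n X (ent_mult n (ent_diag f) (ent_diag g)) (ent_diag (\<lambda>j c x. f j c x * g j c x))"
proof -
  have "(\<Sum>e<n j. ent_diag f j c e x * ent_diag g j e d x) =
      (\<Sum>e<n j. if e = c then ent_diag (\<lambda>j c x. f j c x * g j c x) j c d x else 0)" for j c d x
    by (intro sum.cong) (auto simp: ent_diag_def)
  then show ?thesis unfolding ent_eq_def ent_mult_def by simp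
qed

lemma ent_mult_compress:
  "ent_eq K n X (ent_mult n (ent_mult n (ent_unit j c c (\<lambda>x. 1)) u) (ent_unit j d d (\<lambda>x. 1)))
    (ent_unit j c d (u j c d))"
proof -
  have 1: "(\<Sum>e<n j0. ent_unit j c c (\<lambda>x. 1) j0 a e x * u j0 e b x) = (if j0 = j \<and> a = c then u j c b x else 0)"
    if "a < n j0" for j0 a b x
  proof -
    have "(\<Sum>e<n j0. ent_unit j c c (\<lambda>x. 1) j0 a e x * u j0 e b x) =
        (\<Sum>e<n j0. if e = a then if j0 = j \<and> a = c then u j c b x else 0 else 0)"
      by (intro sum.cong) (auto simp: ent_unit_def)
    then show ?thesis using that by simp
  qed
  have "(\<Sum>e<n j0. (if j0 = j \<and> a = c then u j c e x else 0) * ent_unit j d d (\<lambda>x. 1) j0 e b x) =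
      ent_unit j c d (u j c d) j0 a b x" if "b < n j0" for j0 a b x
  proof -
    have "(\<Sum>e<n j0. (if j0 = j \<and> a = c then u j c e x else 0) * ent_unit j d d (\<lambda>x. 1) j0 e b x) =
        (\<Sum>e<n j0. if e = b then ent_unit j c d (u j c d) j0 a b x else 0)"
      by (intro sum.cong) (auto simp: ent_unit_def)
    then show ?thesis using that by simp
  qed
  with 1 show ?thesis unfolding ent_eq_def ent_mult_def by simp
qed

text \<open>Lagrange interpolation without constant term.\<close>

lemma indicator_in_function_algebra:
  fixes \<theta> :: "'i \<Rightarrow> complex"
  assumes \<theta>: "\<theta> \<in> \<Phi>" and I: "finite I" "inj_on \<theta> I" "\<And>s. s \<in> I \<Longrightarrow> \<theta> s \<noteq> 0"
    and add: "\<And>f g. f \<in> \<Phi> \<Longrightarrow> g \<in> \<Phi> \<Longrightarrow> (\<lambda>s. f s + g s) \<in> \<Phi>"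
    and mult: "\<And>f g. f \<in> \<Phi> \<Longrightarrow> g \<in> \<Phi> \<Longrightarrow> (\<lambda>s. f s * g s) \<in> \<Phi>"
    and scale: "\<And>c f. f \<in> \<Phi> \<Longrightarrow> (\<lambda>s. c * f s) \<in> \<Phi>"
    and s: "s \<in> I"
  obtains f where "f \<in> \<Phi>" "\<And>t. t \<in> I \<Longrightarrow> f t = (if t = s then 1 else 0)"
proof -
  have "\<exists>f\<in>\<Phi>. f s = 1 \<and> (\<forall>t\<in>J. f t = 0)" if "J \<subseteq> I - {s}" for J
    using finite_subset[OF that] I(1) that
  proof (induction J rule: infinite_finite_induct)
    \<comment> \<open>The constant 1 is not at hand, so \<open>\<theta> / \<theta> s\<close> takes
      the place of the empty product. This is where the values have to be nonzero.\<close>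
    case empty
    show ?case
      using scale[OF \<theta>, of "1 / \<theta> s"] I(3)[OF s] by (intro bexI[of _ "\<lambda>t. 1 / \<theta> s * \<theta> t"]) auto
  next
    case (insert t J)
    then obtain f where f: "f \<in> \<Phi>" "f s = 1" "\<forall>r\<in>J. f r = 0" by auto
    have ne: "\<theta> s - \<theta> t \<noteq> 0" using insert.prems I(2) s by (auto simp: inj_on_def)
    \<comment> \<open>Multiplication of \<open>f\<close> by the Lagrange factor
      \<open>(\<theta> - \<theta> t) / (\<theta> s - \<theta> t)\<close>, expanded so that no
      constant function occurs.\<close>
    let ?g = "\<lambda>r. 1 / (\<theta> s - \<theta> t) * (f r * \<theta> r + (- \<theta> t) * f r)"
    have "?g \<in> \<Phi>" by (intro scale add mult \<theta> f(1))
    moreover have "?g s = 1" using ne f(2) by simp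
    moreover have "\<forall>r\<in>insert t J. ?g r = 0" using f(3) by simp
    ultimately show ?case by (intro bexI[of _ ?g]) blast
  qed (use I(1) finite_subset in blast)
  from this[OF order_refl] obtain f where "f \<in> \<Phi>" "f s = 1" "\<forall>t\<in>I - {s}. f t = 0" by blast
  then show ?thesis using that[of f] by auto
qed

context ah_limit
begin

lemma M_unit_mult:
  assumes "b < n i j" "j < K i \<Longrightarrow> continuous_map (mtopology_of (X i j)) euclidean f"
    "j < K i \<Longrightarrow> continuous_map (mtopology_of (X i j)) euclidean g"
  shows "M i (ent_unit j a b f) * M i (ent_unit j b d g) = M i (ent_unit j a d (\<lambda>x. f x * g x))"
  using M_mult[OF cont_ent_unit cont_ent_unit, OF assms(2,3)] ent_mult_unit[of b "n i" j] assms(1) by metis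

lemma M_units_sum:
  assumes "cont i u"
  shows "M i u = (\<Sum>(j, c, d)\<in>(SIGMA j:{..<K i}. {..<n i j} \<times> {..<n i j}). M i (ent_unit j c d (u j c d)))"
proof -
  let ?I = "SIGMA j:{..<K i}. {..<n i j} \<times> {..<n i j}"
  let ?v = "\<lambda>(j, c, d). ent_unit j c d (u j c d)"
  have cont: "cont i (?v s)" if "s \<in> ?I" for s
    using that assms by (auto simp: cont_ent_def[of _ _ _ u] intro!: cont_ent_unit)
  have "(\<Sum>s\<in>?I. ?v s j c d x) = u j c d x" if "j < K i" "c < n i j" "d < n i j" for j c d x
  proof -
    have "(\<Sum>s\<in>?I. ?v s j c d x) = (\<Sum>s\<in>?I. if s = (j, c, d) then u j c d x else 0)"
      by (intro sum.cong) (auto simp: ent_unit_def split: if_splits)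
    also have "\<dots> = u j c d x" using that by (subst sum.delta) auto
    finally show ?thesis .
  qed
  then have "M i u = M i (\<lambda>j c d x. \<Sum>s\<in>?I. ?v s j c d x)"
    by (intro M_cong) (simp add: ent_eq_def)
  also have "\<dots> = (\<Sum>s\<in>?I. M i (?v s))" by (rule M_sum(1)[OF cont])
  finally show ?thesis by (simp add: case_prod_unfold)
qed

lemma M_in_subalgebra:
  assumes A: "cstar_subalgebra A" and "cont i u"
    and "\<And>j c d. j < K i \<Longrightarrow> c < n i j \<Longrightarrow> d < n i j \<Longrightarrow> M i (ent_unit j c d (u j c d)) \<in> A"
  shows "M i u \<in> A"
  unfolding M_units_sum[OF assms(2)] using assms(3) by (intro cstar_subalgebra_sum[OF A]) auto

text \<open>The diagonal values are distinct across all summands at once, so polynomials in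
  \<open>u\<close> plus its adjoint separate summands as well as coordinates; they have no constant
  term, hence the value 0 is excluded. Compressing \<open>u\<close> between two of the resulting
  diagonal units isolates one entry.\<close>

lemma entries_generated:
  fixes \<theta> :: "nat \<Rightarrow> nat \<Rightarrow> real"
  assumes A: "cstar_subalgebra A" and u: "cont i u" "M i u \<in> A"
    and \<theta>: "eqv i (\<lambda>j c d x. u j c d x + cnj (u j d c x)) (ent_diag (\<lambda>j c x. of_real (\<theta> j c)))"
    and inj: "inj_on (\<lambda>(j, c). \<theta> j c) (SIGMA j:{..<K i}. {..<n i j})"
    and nonzero: "\<And>j c. j < K i \<Longrightarrow> c < n i j \<Longrightarrow> \<theta> j c \<noteq> 0"
    and j: "j < K i" "c < n i j" "d < n i j"
  shows "M i (ent_unit j c d (u j c d)) \<in> A" and "M i (ent_unit j c c (\<lambda>x. 1)) \<in> A"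
proof -
  note A' = cstar_subalgebraD[OF A]
  let ?D = "\<lambda>f. ent_diag (\<lambda>j c x. f (j, c)) :: 'x entries"
  \<comment> \<open>The constant diagonals lying in \<open>A\<close> form a function algebra on the
    finite set of coordinates, to which interpolation applies.\<close>
  define \<Phi> where "\<Phi> = {f :: nat \<times> nat \<Rightarrow> complex. M i (?D f) \<in> A}"
  let ?I = "SIGMA j:{..<K i}. {..<n i j}"
  have cont: "cont i (?D f)" for f by (rule cont_ent_diag) simp
  have "M i (\<lambda>j c d x. u j c d x + cnj (u j d c x)) = M i u + adj (M i u)"
    using M_add[OF u(1) cont_ent_star[OF u(1)]] M_star[OF u(1)] by simp
  then have "M i (ent_diag (\<lambda>j c x. of_real (\<theta> j c))) \<in> A"
    using M_cong[OF \<theta>] A' u(2) by metis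
  then have \<Phi>_\<theta>: "(\<lambda>(j, c). complex_of_real (\<theta> j c)) \<in> \<Phi>"
    by (simp add: \<Phi>_def)
  have unit: "M i (ent_unit j c c (\<lambda>x. 1)) \<in> A" if jc: "j < K i" "c < n i j" for j c
  proof -
    obtain f where f: "f \<in> \<Phi>" "\<And>t. t \<in> ?I \<Longrightarrow> f t = (if t = (j, c) then 1 else 0)"
    proof (rule indicator_in_function_algebra[OF \<Phi>_\<theta>, of ?I "(j, c)"])
      show "inj_on (\<lambda>(j, c). complex_of_real (\<theta> j c)) ?I"
        using inj by (auto simp: inj_on_def)
      show "(\<lambda>s. f s + g s) \<in> \<Phi>" if "f \<in> \<Phi>" "g \<in> \<Phi>" for f g
      proof -
        have "M i (?D (\<lambda>s. f s + g s)) = M i (?D f) + M i (?D g)"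
          unfolding M_add[OF cont cont, symmetric] by (rule M_cong) (simp add: ent_eq_def ent_diag_def)
        then show ?thesis using that A' by (simp add: \<Phi>_def)
      qed
      show "(\<lambda>s. f s * g s) \<in> \<Phi>" if "f \<in> \<Phi>" "g \<in> \<Phi>" for f g
      proof -
        have "M i (?D (\<lambda>s. f s * g s)) = M i (?D f) * M i (?D g)"
          unfolding M_mult[OF cont cont, symmetric] by (rule M_cong[symmetric]) (rule ent_mult_diag)
        then show ?thesis using that A' by (simp add: \<Phi>_def)
      qed
      show "(\<lambda>s. a * f s) \<in> \<Phi>" if "f \<in> \<Phi>" for a f
      proof -
        have "M i (?D (\<lambda>s. a * f s)) = scaleC a (M i (?D f))"
          unfolding M_scale[OF cont, symmetric] by (rule M_cong) (simp add: ent_eq_def ent_diag_def)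
        then show ?thesis using that A' by (simp add: \<Phi>_def)
      qed
    qed (use jc nonzero in auto)
    have "M i (ent_unit j c c (\<lambda>x. 1)) = M i (?D f)"
      using f(2) by (intro M_cong) (auto simp: ent_eq_def ent_unit_def ent_diag_def)
    then show ?thesis using f(1) by (simp add: \<Phi>_def)
  qed
  then show "M i (ent_unit j c c (\<lambda>x. 1)) \<in> A" using j by simp
  have cont1: "cont i (ent_unit j c c (\<lambda>x. 1))" for c by (rule cont_ent_unit) simp
  have "M i (ent_unit j c d (u j c d)) = M i (ent_unit j c c (\<lambda>x. 1)) * M i u * M i (ent_unit j d d (\<lambda>x. 1))"
    unfolding M_mult[OF cont1 u(1), symmetric] M_mult[OF cont_ent_mult[OF cont1 u(1)] cont1, symmetric]
    by (rule M_cong[symmetric]) (rule ent_mult_compress)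
  then show "M i (ent_unit j c d (u j c d)) \<in> A"
    using A' unit j u(2) by simp
qed

end

section \<open>Separability\<close>

lemma compact_metric_net:
  assumes "compact_space (mtopology_of m)" "\<epsilon> > 0"
  obtains S where "finite S" "S \<subseteq> mspace m" "\<And>y. y \<in> mspace m \<Longrightarrow> \<exists>s\<in>S. mdist m s y < \<epsilon>"
proof -
  interpret Metric_space "mspace m" "mdist m" by (rule Metric_space_mspace_mdist)
  have "mtotally_bounded (mspace m)"
    using assms(1) by (intro compactin_imp_mtotally_bounded) (simp add: compact_space_def mtopology_of_def)
  then obtain S where "finite S" "S \<subseteq> mspace m" "mspace m \<subseteq> (\<Union>x\<in>S. mball x \<epsilon>)"
    using assms(2) unfolding mtotally_bounded_def by meson
  moreover from this(3) have "\<exists>s\<in>S. mdist m s y < \<epsilon>" if "y \<in> mspace m" for y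
    using that by fastforce
  ultimately show ?thesis using that by blast
qed

text \<open>Tent functions of radius \<open>\<epsilon>\<close> around a finite net, divided by their
  sum, which is positive because every point is within \<open>\<epsilon>\<close> of the net.\<close>

lemma compact_metric_partition_of_unity:
  assumes compact: "compact_space (mtopology_of m)" and \<epsilon>: "\<epsilon> > 0"
  obtains S and \<psi> :: "'x \<Rightarrow> 'x \<Rightarrow> real" where "finite S" "S \<subseteq> mspace m"
    "\<And>s. s \<in> S \<Longrightarrow> continuous_map (mtopology_of m) euclidean (\<psi> s)"
    "\<And>s y. \<psi> s y \<ge> 0" "\<And>y. y \<in> mspace m \<Longrightarrow> (\<Sum>s\<in>S. \<psi> s y) = 1"
    "\<And>s y. s \<in> S \<Longrightarrow> y \<in> mspace m \<Longrightarrow> \<psi> s y \<noteq> 0 \<Longrightarrow> mdist m s y < \<epsilon>"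
proof -
  obtain S where S: "finite S" "S \<subseteq> mspace m" "\<And>y. y \<in> mspace m \<Longrightarrow> \<exists>s\<in>S. mdist m s y < \<epsilon>"
    by (rule compact_metric_net[OF assms]) blast
  define \<theta> where "\<theta> s y = max 0 (\<epsilon> - mdist m s y)" for s y
  define \<psi> where "\<psi> s y = \<theta> s y / (\<Sum>t\<in>S. \<theta> t y)" for s y
  have \<theta>_nonneg: "\<theta> s y \<ge> 0" for s y by (simp add: \<theta>_def)
  have pos: "(\<Sum>t\<in>S. \<theta> t y) > 0" if y: "y \<in> mspace m" for y
  proof -
    obtain s where "s \<in> S" "mdist m s y < \<epsilon>" using S(3)[OF y] by blast
    then show ?thesis using S(1) \<theta>_nonneg by (intro sum_pos2[of _ s]) (auto simp: \<theta>_def)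
  qed
  have cont: "continuous_map (mtopology_of m) euclidean (\<theta> s)" if "s \<in> S" for s
    unfolding \<theta>_def using that S(2)
    by (intro continuous_map_real_max continuous_map_diff continuous_map_mdist) auto
  show ?thesis
  proof (rule that[OF S(1,2)])
    show "continuous_map (mtopology_of m) euclidean (\<psi> s)" if "s \<in> S" for s
      unfolding \<psi>_def using pos cont that S(1)
      by (intro continuous_map_real_divide continuous_map_sum) (auto simp: less_le)
    show "\<psi> s y \<ge> 0" for s y unfolding \<psi>_def using \<theta>_nonneg by (simp add: sum_nonneg)
    show "(\<Sum>s\<in>S. \<psi> s y) = 1" if "y \<in> mspace m" for y
      unfolding \<psi>_def sum_divide_distrib[symmetric] using pos[OF that] by simp
    show "mdist m s y < \<epsilon>" if "\<psi> s y \<noteq> 0" for s y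
      using that by (auto simp: \<psi>_def \<theta>_def max_def split: if_splits)
  qed
qed

text \<open>The functions of all partitions of unity of radius \<open>1 / (r + 1)\<close> have a
  dense span: by uniform continuity \<open>f\<close> is close to the combination with coefficients
  \<open>f s\<close> at the centres. The coefficients range over all complex numbers; only the
  functions need to be countable in number.\<close>

lemma compact_metric_separable_functions:
  assumes compact: "compact_space (mtopology_of m)"
  obtains S and \<psi> :: "nat \<Rightarrow> 'x \<Rightarrow> 'x \<Rightarrow> complex" where "\<And>r. finite (S r)"
    "\<And>r s. s \<in> S r \<Longrightarrow> continuous_map (mtopology_of m) euclidean (\<psi> r s)"
    "\<And>(f :: 'x \<Rightarrow> complex) \<epsilon>. continuous_map (mtopology_of m) euclidean f \<Longrightarrow> \<epsilon> > 0 \<Longrightarrow>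
      \<exists>r c. \<forall>y\<in>mspace m. cmod (f y - (\<Sum>s\<in>S r. c s * \<psi> r s y)) \<le> \<epsilon>"
proof -
  define P where "P r S \<psi> \<longleftrightarrow> finite S \<and> S \<subseteq> mspace m \<and>
      (\<forall>s\<in>S. continuous_map (mtopology_of m) euclidean (\<psi> s)) \<and>
      (\<forall>s y. \<psi> s y \<ge> 0) \<and> (\<forall>y\<in>mspace m. (\<Sum>s\<in>S. \<psi> s y) = 1) \<and>
      (\<forall>s\<in>S. \<forall>y\<in>mspace m. \<psi> s y \<noteq> 0 \<longrightarrow> mdist m s y < 1 / real (Suc r))"
    for r S and \<psi> :: "'x \<Rightarrow> 'x \<Rightarrow> real"
  have "\<exists>S \<psi>. P r S \<psi>" for r
  proof (rule compact_metric_partition_of_unity[OF compact, of "1 / real (Suc r)"])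
    fix S and \<psi> :: "'x \<Rightarrow> 'x \<Rightarrow> real"
    assume *: "finite S" "S \<subseteq> mspace m"
      "\<And>s. s \<in> S \<Longrightarrow> continuous_map (mtopology_of m) euclidean (\<psi> s)"
      "\<And>s y. \<psi> s y \<ge> 0" "\<And>y. y \<in> mspace m \<Longrightarrow> (\<Sum>s\<in>S. \<psi> s y) = 1"
      "\<And>s y. s \<in> S \<Longrightarrow> y \<in> mspace m \<Longrightarrow> \<psi> s y \<noteq> 0 \<Longrightarrow> mdist m s y < 1 / real (Suc r)"
    show ?thesis
      unfolding P_def by (intro exI[of _ S] exI[of _ \<psi>] conjI ballI allI impI *)
  qed simp
  then obtain S \<psi> where P: "\<And>r. P r (S r) (\<psi> r)" by metis
  show ?thesis
  proof (rule that[of S "\<lambda>r s y. complex_of_real (\<psi> r s y)"])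
    show "finite (S r)" for r using P[of r] by (simp add: P_def)
    show "continuous_map (mtopology_of m) euclidean (\<lambda>y. complex_of_real (\<psi> r s y))" if "s \<in> S r" for r s
    proof (rule continuous_map_continuous_on_compose[where f = "\<psi> r s" and g = complex_of_real])
      show "continuous_map (mtopology_of m) euclidean (\<psi> r s)" using P[of r] that by (simp add: P_def)
    qed (rule continuous_on_of_real[OF continuous_on_id])
  next
    fix f :: "'x \<Rightarrow> complex" and \<epsilon> :: real
    assume "continuous_map (mtopology_of m) euclidean f" and \<epsilon>: "\<epsilon> > 0"
    then have "uniformly_continuous_map m euclidean_metric f"
      using compact by (intro continuous_imp_uniformly_continuous_map) simp
    then obtain \<delta> where \<delta>: "\<delta> > 0"
      "\<And>x y. x \<in> mspace m \<Longrightarrow> y \<in> mspace m \<Longrightarrow> mdist m y x < \<delta> \<Longrightarrow> dist (f y) (f x) < \<epsilon>"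
      using \<epsilon> unfolding uniformly_continuous_map_def by (metis mdist_euclidean_metric)
    obtain r where r: "1 / real (Suc r) < \<delta>"
      using reals_Archimedean[OF \<delta>(1)] by (auto simp: inverse_eq_divide)
    have "cmod (f y - (\<Sum>s\<in>S r. f s * complex_of_real (\<psi> r s y))) \<le> \<epsilon>" if y: "y \<in> mspace m" for y
    proof -
      have sum1: "(\<Sum>s\<in>S r. complex_of_real (\<psi> r s y)) = 1"
        using P[of r] y unfolding P_def by (metis of_real_1 of_real_sum)
      have "f y - (\<Sum>s\<in>S r. f s * complex_of_real (\<psi> r s y)) =
          f y * (\<Sum>s\<in>S r. complex_of_real (\<psi> r s y)) - (\<Sum>s\<in>S r. f s * complex_of_real (\<psi> r s y))"
        by (simp add: sum1)
      also have "\<dots> = (\<Sum>s\<in>S r. (f y - f s) * complex_of_real (\<psi> r s y))"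
        by (simp add: sum_distrib_left sum_subtractf left_diff_distrib)
      also have "cmod \<dots> \<le> (\<Sum>s\<in>S r. \<epsilon> * \<psi> r s y)"
      proof (rule sum_norm_le)
        fix s assume s: "s \<in> S r"
        have "\<psi> r s y \<ge> 0" "s \<in> mspace m" using P[of r] s by (auto simp: P_def)
        moreover have "cmod (f y - f s) \<le> \<epsilon>" if "\<psi> r s y \<noteq> 0"
        proof -
          have "mdist m s y < \<delta>"
            using P[of r] s y that r unfolding P_def by (meson less_trans)
          from \<delta>(2)[OF y \<open>s \<in> mspace m\<close> this] show ?thesis
            by (simp add: dist_norm norm_minus_commute)
        qed
        ultimately show "cmod ((f y - f s) * complex_of_real (\<psi> r s y)) \<le> \<epsilon> * \<psi> r s y"
          by (cases "\<psi> r s y = 0") (auto simp: norm_mult intro!: mult_right_mono)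
      qed
      also have "\<dots> = \<epsilon>"
        using P[of r] y by (simp add: sum_distrib_left[symmetric] P_def)
      finally show ?thesis .
    qed
    then show "\<exists>r c. \<forall>y\<in>mspace m. cmod (f y - (\<Sum>s\<in>S r. c s * complex_of_real (\<psi> r s y))) \<le> \<epsilon>"
      by blast
  qed
qed

section \<open>A countable generating set of the limit\<close>

context ah_limit
begin

lemma cont_unit_1: "cont i (ent_unit j c d (\<lambda>x. 1))"
  by (rule cont_ent_unit) simp

lemma cont_unit:
  "continuous_map (mtopology_of (X i j)) euclidean g \<Longrightarrow> cont i (ent_unit j c d g)"
  by (rule cont_ent_unit)

text \<open>Splits the function from the matrix unit, because the norm estimate
  \<open>norm_M_scalar_le\<close> is for scalar functions.\<close>

lemma M_unit_scalar:
  assumes j: "j < K i" "c < n i j" "d < n i j" and g: "continuous_map (mtopology_of (X i j)) euclidean g"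
  shows "M i (ent_unit j c d g) = M i (ent_diag (\<lambda>j' c x. if j' = j then g x else 0)) * M i (ent_unit j c d (\<lambda>x. 1))"
proof -
  let ?D = "ent_diag (\<lambda>j' c x. if j' = j then g x else 0)"
  have cont: "cont i ?D" using g by (intro cont_ent_diag) auto
  have "(\<Sum>e<n i j'. ?D j' a e x * ent_unit j c d (\<lambda>x. 1) j' e b x) = ent_unit j c d g j' a b x"
    if "a < n i j'" for j' a b x
  proof -
    have "(\<Sum>e<n i j'. ?D j' a e x * ent_unit j c d (\<lambda>x. 1) j' e b x) =
        (\<Sum>e<n i j'. if e = a then ent_unit j c d g j' a b x else 0)"
      by (intro sum.cong) (auto simp: ent_diag_def ent_unit_def)
    then show ?thesis using that by simp
  qed
  then have "eqv i (ent_mult (n i) ?D (ent_unit j c d (\<lambda>x. 1))) (ent_unit j c d g)"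
    by (simp add: ent_eq_def ent_mult_def)
  from M_cong[OF this] show ?thesis
    unfolding M_mult[OF cont cont_unit_1] by simp
qed

text \<open>A subalgebra is closed under sums and complex multiples, so it suffices to take each
  matrix unit times each of the countably many partition functions, over all levels.\<close>

lemma countable_generators:
  obtains W where "countable W" "W \<noteq> {}" "W \<subseteq> V"
    "\<And>A. cstar_subalgebra A \<Longrightarrow> W \<subseteq> A \<Longrightarrow> A = UNIV"
proof -
  define P where "P i j S \<psi> \<longleftrightarrow> (\<forall>r. finite (S r)) \<and>
    (\<forall>r. \<forall>s\<in>S r. continuous_map (mtopology_of (X i j)) euclidean (\<psi> r s)) \<and>
    (\<forall>f \<epsilon>. continuous_map (mtopology_of (X i j)) euclidean f \<longrightarrow> \<epsilon> > 0 \<longrightarrow>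
      (\<exists>r c. \<forall>y\<in>mspace (X i j). cmod (f y - (\<Sum>s\<in>S r. c s * \<psi> r s y)) \<le> \<epsilon>))"
    for i j S and \<psi> :: "nat \<Rightarrow> 'x \<Rightarrow> 'x \<Rightarrow> complex"
  have "\<exists>q. P i j (fst q) (snd q)" if "j < K i" for i j
  proof -
    have "\<exists>S \<psi>. P i j S \<psi>"
      unfolding P_def by (rule compact_metric_separable_functions[OF X_compact[OF that]]) blast
    then show ?thesis by auto
  qed
  note ex = this
  define q where "q i j = (SOME q. P i j (fst q) (snd q))" for i j
  have q: "P i j (fst (q i j)) (snd (q i j))" if "j < K i" for i j
    unfolding q_def by (rule someI_ex[OF ex[OF that]])
  define S \<psi> where "S i j = fst (q i j)" and "\<psi> i j = snd (q i j)" for i j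
  have P: "P i j (S i j) (\<psi> i j)" if "j < K i" for i j
    using q[OF that] by (simp add: S_def \<psi>_def)
  define W0 where "W0 = (\<Union>i. \<Union>j\<in>{..<K i}. \<Union>c\<in>{..<n i j}. \<Union>d\<in>{..<n i j}. \<Union>r. \<Union>s\<in>S i j r.
    {M i (ent_unit j c d (\<psi> i j r s))})"
  have fin: "finite (S i j r)" if "j < K i" for i j r
    using P[OF that] by (simp add: P_def)
  have cont: "continuous_map (mtopology_of (X i j)) euclidean (\<psi> i j r s)" if "j < K i" "s \<in> S i j r" for i j r s
    using P[OF that(1)] that(2) by (simp add: P_def)
  have W0I: "M i (ent_unit j c d (\<psi> i j r s)) \<in> W0" if "j < K i" "c < n i j" "d < n i j" "s \<in> S i j r" for i j c d r s
    unfolding W0_def UN_iff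
    by (rule bexI[of _ i], rule bexI[of _ j], rule bexI[of _ c], rule bexI[of _ d], rule bexI[of _ r],
        rule bexI[of _ s]) (simp_all add: that)
  show ?thesis
  \<comment> \<open>Inserting 0 makes the set visibly nonempty, so that it can be enumerated with
    \<open>from_nat_into\<close>.\<close>
  proof (rule that[of "insert 0 W0"])
    show "countable (insert 0 W0)"
      unfolding W0_def by (intro countable_insert countable_UN countableI_type) (auto intro: countable_finite fin)
    show "insert 0 W0 \<subseteq> V"
    proof -
      have "0 \<in> V" unfolding V_def using M_zero[of 0, symmetric] cont_ent_const[of "K 0" "n 0" "X 0" "\<lambda>j c d. 0"] by blast
      moreover have "M i (ent_unit j c d (\<psi> i j r s)) \<in> V" if "j < K i" "s \<in> S i j r" for i j c d r s
        unfolding V_def using cont_unit[OF cont[OF that]] by blast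
      ultimately show ?thesis by (auto simp: W0_def)
    qed
    fix A :: "'b set"
    assume A: "cstar_subalgebra A" and W: "insert 0 W0 \<subseteq> A"
    note A' = cstar_subalgebraD[OF A]
    have unit: "M i (ent_unit j c d f) \<in> A"
      if j: "j < K i" "c < n i j" "d < n i j" and f: "continuous_map (mtopology_of (X i j)) euclidean f"
      for i j c d f
    proof -
      let ?B = "norm (M i (ent_unit j c d (\<lambda>x. 1)))"
      have "M i (ent_unit j c d f) \<in> closure A"
        unfolding closure_approachable
      proof (intro allI impI)
        fix \<epsilon> :: real assume "\<epsilon> > 0"
        \<comment> \<open>The error gets multiplied by \<open>?B\<close>; dividing by
          \<open>?B + 1\<close> keeps the product below \<open>\<epsilon>\<close> and allows
          \<open>?B = 0\<close>.\<close>
        then have \<delta>: "\<epsilon> / (?B + 1) > 0" by (simp add: add_nonneg_pos)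
        then obtain r a where approx:
          "\<And>y. y \<in> mspace (X i j) \<Longrightarrow> cmod (f y - (\<Sum>s\<in>S i j r. a s * \<psi> i j r s y)) \<le> \<epsilon> / (?B + 1)"
          using P[OF j(1)] f unfolding P_def by meson
        let ?g = "\<lambda>y. \<Sum>s\<in>S i j r. a s * \<psi> i j r s y"
        have cont_s: "continuous_map (mtopology_of (X i j)) euclidean (\<lambda>y. a s * \<psi> i j r s y)" if "s \<in> S i j r" for s
          using continuous_map_continuous_on_compose[OF cont[OF j(1) that], of "\<lambda>z. a s * z"]
          by (simp add: continuous_on_mult_left)
        have g: "continuous_map (mtopology_of (X i j)) euclidean ?g"
          by (intro continuous_map_sum fin j cont_s)
        have "M i (ent_unit j c d ?g) = M i (\<lambda>j' c' d' x. \<Sum>s\<in>S i j r. ent_unit j c d (\<lambda>y. a s * \<psi> i j r s y) j' c' d' x)"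
          by (intro M_cong) (auto simp: ent_eq_def ent_unit_def intro!: sum.neutral)
        also have "\<dots> = (\<Sum>s\<in>S i j r. M i (ent_unit j c d (\<lambda>y. a s * \<psi> i j r s y)))"
          by (intro M_sum(1) cont_unit cont_s)
        also have "\<dots> = (\<Sum>s\<in>S i j r. scaleC (a s) (M i (ent_unit j c d (\<psi> i j r s))))"
        proof (rule sum.cong[OF refl])
          fix s assume "s \<in> S i j r"
          show "M i (ent_unit j c d (\<lambda>y. a s * \<psi> i j r s y)) = scaleC (a s) (M i (ent_unit j c d (\<psi> i j r s)))"
            unfolding M_scale[OF cont_unit[OF cont[OF j(1) \<open>s \<in> S i j r\<close>]], symmetric]
            by (rule M_cong) (simp add: ent_eq_def ent_unit_def)
        qed
        also have "\<dots> \<in> A"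
          using W j W0I by (intro cstar_subalgebra_sum[OF A] A') blast
        finally have gA: "M i (ent_unit j c d ?g) \<in> A" .
        have "M i (ent_unit j c d f) - M i (ent_unit j c d ?g) = M i (ent_unit j c d (\<lambda>y. f y - ?g y))"
          unfolding M_diff[OF cont_unit[OF f] cont_unit[OF g], symmetric]
          by (rule M_cong) (auto simp: ent_eq_def ent_unit_def)
        also have "\<dots> = M i (ent_diag (\<lambda>j' c x. if j' = j then f x - ?g x else 0)) * M i (ent_unit j c d (\<lambda>x. 1))"
          using f g by (intro M_unit_scalar j continuous_map_diff)
        finally have "norm (M i (ent_unit j c d f) - M i (ent_unit j c d ?g))
            \<le> norm (M i (ent_diag (\<lambda>j' c x. if j' = j then f x - ?g x else 0))) * ?B"
          by (simp add: norm_mult_ineq)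
        also have "\<dots> \<le> \<epsilon> / (?B + 1) * ?B"
          using f g approx \<delta> by (intro mult_right_mono norm_M_scalar_le continuous_map_diff) auto
        also have "\<dots> < \<epsilon>"
        proof -
          have "\<epsilon> / (?B + 1) * ?B < \<epsilon> / (?B + 1) * (?B + 1)"
            using \<delta> by (intro mult_strict_left_mono) auto
          also have "\<dots> = \<epsilon>"
            using norm_ge_zero[of "M i (ent_unit j c d (\<lambda>x. 1))"] by (simp add: add_nonneg_eq_0_iff)
          finally show ?thesis .
        qed
        finally show "\<exists>y\<in>A. dist y (M i (ent_unit j c d f)) < \<epsilon>"
          using gA by (intro bexI[of _ "M i (ent_unit j c d ?g)"]) (simp_all add: dist_norm norm_minus_commute)
      qed
      then show ?thesis using A'(6) by (metis closure_eq)
    qed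
    have "V \<subseteq> A"
    proof
      fix x assume "x \<in> V"
      then obtain i u where x: "x = M i u" "cont i u" by (auto simp: V_def)
      show "x \<in> A" unfolding x(1)
        by (rule M_in_subalgebra[OF A x(2)], rule unit) (use x(2) in \<open>auto simp: cont_ent_def\<close>)
    qed
    then show "A = UNIV"
      using closure_V closure_minimal[OF _ A'(6)] by blast
  qed simp
qed

end

section \<open>The case of growing matrix sizes\<close>

text \<open>
  Every image of level \<open>i\<close> vanishes off the pattern \<open>R\<close>. The remaining slots with an index below
  \<open>2 N + 1\<close> carry the constant 1 and connect any two coordinates; \<open>\<sigma>\<close> reserves one further slot
  for each entry in the pattern.
\<close>

lemma free_slots:
  fixes R :: "(nat \<times> nat) set" and N m :: nat
  assumes fin: "\<And>a. finite {b. (a, b) \<in> R}" and card: "\<And>a. card {b. (a, b) \<in> R} \<le> N"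
    and m: "m \<ge> 12 * N + 2"
  defines "T \<equiv> {(a, b) \<in> R. a < m \<and> b < m}"
  obtains \<sigma> where "inj_on \<sigma> T"
    "\<And>s. s \<in> T \<Longrightarrow> \<sigma> s \<notin> R \<and> 2 * N + 1 \<le> fst (\<sigma> s) \<and> fst (\<sigma> s) < snd (\<sigma> s) \<and> snd (\<sigma> s) < m"
proof -
  have T_fin: "finite T"
    by (rule finite_subset[of _ "{..<m} \<times> {..<m}"]) (auto simp: T_def)
  have "card T \<le> card (SIGMA a:{..<m}. {b. (a, b) \<in> R})"
    by (rule card_mono) (auto simp: T_def fin)
  also have "\<dots> = (\<Sum>a<m. card {b. (a, b) \<in> R})"
    by (rule card_SigmaI) (auto simp: fin)
  also have "\<dots> \<le> (\<Sum>a<m. N)" using card by (intro sum_mono) auto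
  finally have T_card: "card T \<le> N * m" by (simp add: mult.commute)
  \<comment> \<open>A rectangle above the diagonal whose rows start at \<open>2 * N + 1\<close>, so
    it avoids the connecting slots. It has \<open>4 * N\<close> rows;
    \<open>m \<ge> 12 * N + 2\<close> makes its width at least \<open>m / 2\<close>. It thus has at
    least twice as many slots as the bound \<open>N * m\<close> on the pattern, and removing the
    pattern leaves enough.\<close>
  let ?P = "{2 * N + 1..<6 * N + 1} \<times> {6 * N + 1..<m}"
  have le: "6 * N + 1 \<le> m" using m by simp
  have "card ?P = 4 * N * (m - (6 * N + 1))" by (simp add: card_cartesian_product)
  moreover have "2 * (N * m) \<le> 4 * N * (m - (6 * N + 1))"
  proof -
    have "m \<le> 2 * (m - (6 * N + 1))" using m by simp
    then have "2 * N * m \<le> 2 * N * (2 * (m - (6 * N + 1)))" by (rule mult_le_mono2)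
    then show ?thesis by (simp add: mult.assoc)
  qed
  moreover have "card ?P - card T \<le> card (?P - T)"
    using T_fin by (rule diff_card_le_card_Diff)
  ultimately have "card T \<le> card (?P - T)" using T_card by linarith
  then obtain \<sigma> where \<sigma>: "\<sigma> ` T \<subseteq> ?P - T" "inj_on \<sigma> T"
    using card_le_inj[OF T_fin, of "?P - T"] by auto
  show ?thesis
  proof (rule that[OF \<sigma>(2)])
    fix s assume "s \<in> T"
    then have "\<sigma> s \<in> ?P - T" using \<sigma>(1) by blast
    then show "\<sigma> s \<notin> R \<and> 2 * N + 1 \<le> fst (\<sigma> s) \<and> fst (\<sigma> s) < snd (\<sigma> s) \<and> snd (\<sigma> s) < m"
      using le by (cases "\<sigma> s") (auto simp: T_def)
  qed
qed

text \<open>Two rows block at most \<open>2 * N\<close> indices. This pigeonhole count is the origin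
  of \<open>2 * N + 1\<close>.\<close>

lemma common_free_index:
  assumes fin: "\<And>a. finite {b. (a, b) \<in> R}" and card: "\<And>a. card {b. (a, b) \<in> R} \<le> N"
  shows "\<exists>z<2 * N + 1. (a, z) \<notin> R \<and> (b, z) \<notin> R"
proof (rule ccontr)
  assume "\<not> ?thesis"
  then have "{..<2 * N + 1} \<subseteq> {z. (a, z) \<in> R} \<union> {z. (b, z) \<in> R}" by auto
  then have "card {..<2 * N + 1} \<le> card ({z. (a, z) \<in> R} \<union> {z. (b, z) \<in> R})"
    using fin by (intro card_mono) auto
  also have "\<dots> \<le> card {z. (a, z) \<in> R} + card {z. (b, z) \<in> R}" by (rule card_Un_le)
  finally show False using card[of a] card[of b] by simp
qed

text \<open>Each coincidence of two values and each zero excludes at most one positive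
  \<open>\<eta>\<close>, so finitely many are excluded in all.\<close>

lemma generic_perturbation:
  fixes t \<tau> :: "'i \<Rightarrow> real"
  assumes I: "finite I" and \<tau>: "inj_on \<tau> I" "\<And>s. s \<in> I \<Longrightarrow> \<tau> s \<noteq> 0" and "\<epsilon> > 0"
  obtains \<eta> where "0 < \<eta>" "\<eta> < \<epsilon>" "inj_on (\<lambda>s. t s + \<eta> * \<tau> s) I" "\<And>s. s \<in> I \<Longrightarrow> t s + \<eta> * \<tau> s \<noteq> 0"
proof -
  \<comment> \<open>For \<open>r = s\<close> the quotient by 0 equals 0, which does no harm as
    \<open>\<eta>\<close> is positive.\<close>
  let ?bad = "(\<lambda>s. - t s / \<tau> s) ` I \<union> (\<lambda>(r, s). (t s - t r) / (\<tau> r - \<tau> s)) ` (I \<times> I)"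
  have "finite ?bad" using I by simp
  moreover have "infinite {0<..<\<epsilon>}" using \<open>\<epsilon> > 0\<close> by (simp add: infinite_Ioo)
  ultimately obtain \<eta> where \<eta>: "\<eta> \<in> {0<..<\<epsilon>}" "\<eta> \<notin> ?bad"
    by (meson finite_subset subsetI)
  show ?thesis
  proof (rule that[of \<eta>])
    show "t s + \<eta> * \<tau> s \<noteq> 0" if "s \<in> I" for s
    proof
      assume "t s + \<eta> * \<tau> s = 0"
      then have "\<eta> = - t s / \<tau> s" using \<tau>(2)[OF that] by (simp add: field_simps)
      with \<eta>(2) that show False by blast
    qed
    show "inj_on (\<lambda>s. t s + \<eta> * \<tau> s) I"
    proof (rule inj_onI, rule ccontr)
      fix r s assume rs: "r \<in> I" "s \<in> I" "t r + \<eta> * \<tau> r = t s + \<eta> * \<tau> s" "r \<noteq> s"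
      then have "\<tau> r - \<tau> s \<noteq> 0" using \<tau>(1) by (auto simp: inj_on_def)
      then have "\<eta> = (t s - t r) / (\<tau> r - \<tau> s)" using rs(3) by (simp add: field_simps)
      with rs(1,2) have "\<eta> \<in> ?bad" by (intro UnI2 image_eqI[of _ _ "(r, s)"]) auto
      with \<eta>(2) show False by blast
    qed
  qed (use \<eta>(1) in auto)
qed

section \<open>Perturbing a generator inside one level\<close>

context ah_limit
begin

text \<open>\<open>t\<close> is the diagonal of \<open>u\<close> plus its adjoint, that is, twice
  the real part; hence the factor in \<open>2 * \<tau>\<close> below.\<close>

definition diag_real_part :: "nat \<Rightarrow> 'x entries \<Rightarrow> (nat \<Rightarrow> nat \<Rightarrow> real) \<Rightarrow> bool" where
  "diag_real_part i u t \<longleftrightarrow> cont i u \<and>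
     eqv i (\<lambda>j c d x. u j c d x + cnj (u j d c x)) (ent_diag (\<lambda>j c x. of_real (t j c)))"

lemma push_diag_real_part:
  assumes "diag_real_part i u t" "k \<ge> 1"
  shows "\<exists>t'. diag_real_part (i + k) (push i k u) t'"
proof -
  have u: "cont i u" and t: "eqv i (\<lambda>j c d x. u j c d x + cnj (u j d c x)) (ent_diag (\<lambda>j c x. of_real (t j c)))"
    using assms(1) by (auto simp: diag_real_part_def)
  obtain t' where "eqv (i + k) (push i k (ent_diag (\<lambda>j c x. of_real (t j c)))) (ent_diag (\<lambda>j c x. of_real (t' j c)))"
    using push_diag_const[OF assms(2)] by blast
  moreover note push_cong[OF t, of k] push_add[OF u cont_ent_star[OF u], of k] push_star[OF u, of k]
  ultimately have "eqv (i + k) (\<lambda>j c d x. push i k u j c d x + cnj (push i k u j d c x))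
      (ent_diag (\<lambda>j c x. of_real (t' j c)))"
    by (simp add: ent_eq_def)
  then show ?thesis using conn_elt(2)[OF u] unfolding diag_real_part_def by blast
qed

text \<open>The generator is changed by a small multiple of \<open>\<tau> + \<i> * r\<close> with
  \<open>\<tau>\<close> a constant real diagonal and \<open>r\<close> hermitian, so its real part
  stays a constant diagonal. As \<open>u\<close> vanishes off \<open>R\<close>, the new entries
  there are multiples of those of \<open>r\<close> alone, however small the factor.\<close>

lemma generate_sparse:
  fixes R :: "nat \<Rightarrow> (nat \<times> nat) set"
  assumes u: "diag_real_part i u t" and v: "cont i v" and "\<epsilon> > 0"
    and sym: "\<And>j. sym (R j)" and refl: "\<And>j c. (c, c) \<in> R j"
    and fin: "\<And>j a. finite {b. (a, b) \<in> R j}" and card: "\<And>j a. card {b. (a, b) \<in> R j} \<le> N"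
    and u0: "\<And>j a b y. j < K i \<Longrightarrow> a < n i j \<Longrightarrow> b < n i j \<Longrightarrow> y \<in> mspace (X i j) \<Longrightarrow> (a, b) \<notin> R j \<Longrightarrow> u j a b y = 0"
    and v0: "\<And>j a b y. j < K i \<Longrightarrow> a < n i j \<Longrightarrow> b < n i j \<Longrightarrow> y \<in> mspace (X i j) \<Longrightarrow> (a, b) \<notin> R j \<Longrightarrow> v j a b y = 0"
    and large: "\<And>j. j < K i \<Longrightarrow> n i j \<ge> 12 * N + 2"
  shows "\<exists>u' t'. diag_real_part i u' t' \<and> norm (M i u' - M i u) < \<epsilon> \<and> M i v \<in> cstar_generated (M i u')"
proof -
  define T where "T j = {(a, b) \<in> R j. a < n i j \<and> b < n i j}" for j
  define good where "good j \<sigma> \<longleftrightarrow> inj_on \<sigma> (T j) \<and> (\<forall>s\<in>T j. \<sigma> s \<notin> R j \<and> 2 * N + 1 \<le> fst (\<sigma> s) \<and>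
      fst (\<sigma> s) < snd (\<sigma> s) \<and> snd (\<sigma> s) < n i j)" for j \<sigma>
  have "\<exists>\<sigma>. good j \<sigma>" if "j < K i" for j
    unfolding good_def T_def by (rule free_slots[OF fin card large[OF that]]) blast
  then obtain \<sigma> where \<sigma>: "\<And>j. j < K i \<Longrightarrow> good j (\<sigma> j)" by metis
  define src where "src j = inv_into (T j) (\<sigma> j)" for j
  have src: "src j (\<sigma> j s) = s" if "j < K i" "s \<in> T j" for j s
    unfolding src_def using \<sigma>[OF that(1)] that(2) by (simp add: good_def)
  \<comment> \<open>Connecting slots carry 1; slot \<open>\<sigma> j s\<close> carries the entry of
    \<open>v\<close> at \<open>s\<close>, which \<open>src\<close> recovers, and the transposed slot
    its conjugate. By choice of \<open>\<sigma>\<close> a storage slot has both indices at least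
    \<open>2 * N + 1\<close>, so it does not fall under the earlier cases.\<close>
  define r :: "'x entries" where "r j c d y = (if (c, d) \<in> R j then 0 else if min c d < 2 * N + 1 then 1
      else if (c, d) \<in> \<sigma> j ` T j then v j (fst (src j (c, d))) (snd (src j (c, d))) y
      else if (d, c) \<in> \<sigma> j ` T j then cnj (v j (fst (src j (d, c))) (snd (src j (d, c))) y) else 0)" for j c d y
  have cont_v: "continuous_map (mtopology_of (X i j)) euclidean (v j (fst (src j s)) (snd (src j s)))"
    if "j < K i" "s \<in> \<sigma> j ` T j" for j s
  proof -
    have "src j s \<in> T j" using that src by auto
    then show ?thesis using v that(1) by (cases "src j s") (auto simp: cont_ent_def T_def)
  qed
  have cont_cnj: "continuous_map (mtopology_of (X i j)) euclidean (\<lambda>y. cnj (v j (fst (src j s)) (snd (src j s)) y))"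
    if "j < K i" "s \<in> \<sigma> j ` T j" for j s
    by (rule continuous_map_continuous_on_compose[OF cont_v[OF that], of cnj]) (intro continuous_intros)
  have r_cont: "cont i r"
    unfolding cont_ent_def r_def using cont_v cont_cnj by simp
  have r_herm: "cnj (r j d c y) = r j c d y" if "j < K i" for j c d y
  proof -
    have "(c, d) \<in> R j \<longleftrightarrow> (d, c) \<in> R j" using sym[of j] by (meson symD)
    \<comment> \<open>Slots lie strictly above the diagonal, so a slot is never the transpose of
      another one and the two storage cases cannot conflict.\<close>
    moreover have "\<not> ((c, d) \<in> \<sigma> j ` T j \<and> (d, c) \<in> \<sigma> j ` T j)"
    proof
      assume "(c, d) \<in> \<sigma> j ` T j \<and> (d, c) \<in> \<sigma> j ` T j"
      then obtain s s' where "s \<in> T j" "s' \<in> T j" "\<sigma> j s = (c, d)" "\<sigma> j s' = (d, c)"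
        by (metis imageE)
      then have "c < d" "d < c"
        using \<sigma>[OF that] unfolding good_def by (metis fst_conv snd_conv)+
      then show False by simp
    qed
    ultimately show ?thesis by (auto simp: r_def min.commute)
  qed
  \<comment> \<open>The pairing function makes the values distinct across summands and coordinates,
    and \<open>+ 1\<close> makes them nonzero.\<close>
  define \<tau> where "\<tau> j c = real (prod_encode (j, c) + 1)" for j c
  define w :: "'x entries" where
    "w = (\<lambda>j c d y. ent_diag (\<lambda>j c x. of_real (\<tau> j c)) j c d y + \<i> * r j c d y)"
  have w_cont: "cont i w"
    unfolding w_def by (intro cont_ent_add cont_ent_smult r_cont cont_ent_diag) simp
  let ?I = "SIGMA j:{..<K i}. {..<n i j}"
  have pos: "\<epsilon> / (norm (M i w) + 1) > 0" using \<open>\<epsilon> > 0\<close> by (simp add: add_nonneg_pos)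
  obtain \<eta> where \<eta>: "0 < \<eta>" "\<eta> < \<epsilon> / (norm (M i w) + 1)"
    "inj_on (\<lambda>s. (case s of (j, c) \<Rightarrow> t j c) + \<eta> * (case s of (j, c) \<Rightarrow> 2 * \<tau> j c)) ?I"
    "\<And>s. s \<in> ?I \<Longrightarrow> (case s of (j, c) \<Rightarrow> t j c) + \<eta> * (case s of (j, c) \<Rightarrow> 2 * \<tau> j c) \<noteq> 0"
  proof (rule generic_perturbation[of ?I "\<lambda>(j, c). 2 * \<tau> j c" _ "\<lambda>(j, c). t j c", OF _ _ _ pos])
    show "inj_on (\<lambda>(j, c). 2 * \<tau> j c) ?I"
      by (rule inj_onI) (auto simp: \<tau>_def)
  qed (auto simp: \<tau>_def add_nonneg_eq_0_iff)
  define \<theta> where "\<theta> j c = t j c + \<eta> * (2 * \<tau> j c)" for j c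
  define u' :: "'x entries" where "u' = (\<lambda>j c d y. u j c d y + of_real \<eta> * w j c d y)"
  have u_cont: "cont i u" using u by (simp add: diag_real_part_def)
  have u'_cont: "cont i u'"
    unfolding u'_def by (intro cont_ent_add cont_ent_smult u_cont w_cont)
  have u'_real: "eqv i (\<lambda>j c d x. u' j c d x + cnj (u' j d c x)) (ent_diag (\<lambda>j c x. of_real (\<theta> j c)))"
    unfolding ent_eq_def
  proof (intro allI impI ballI)
    fix j c d x assume jcd: "j < K i" "c < n i j" "d < n i j" "x \<in> mspace (X i j)"
    have "u j c d x + cnj (u j d c x) = ent_diag (\<lambda>j c x. of_real (t j c)) j c d x"
      using u jcd by (simp add: diag_real_part_def ent_eq_def)
    moreover have "w j c d x + cnj (w j d c x) = ent_diag (\<lambda>j c x. of_real (2 * \<tau> j c)) j c d x"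
      using r_herm[OF jcd(1), of d c x] by (simp add: w_def ent_diag_def)
    ultimately have "u' j c d x + cnj (u' j d c x) = ent_diag (\<lambda>j c x. of_real (t j c)) j c d x +
        of_real \<eta> * ent_diag (\<lambda>j c x. of_real (2 * \<tau> j c)) j c d x"
      unfolding u'_def by (simp add: algebra_simps flip: distrib_left)
    then show "u' j c d x + cnj (u' j d c x) = ent_diag (\<lambda>j c x. of_real (\<theta> j c)) j c d x"
      by (simp add: ent_diag_def \<theta>_def)
  qed
  have "M i u' = M i u + scaleC (of_real \<eta>) (M i w)"
    unfolding u'_def using M_add[OF u_cont cont_ent_smult[OF w_cont]] M_scale[OF w_cont] by simp
  then have "norm (M i u' - M i u) = \<eta> * norm (M i w)"
    using \<eta>(1) by (simp add: norm_scaleC)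
  also have "\<dots> \<le> \<eta> * (norm (M i w) + 1)" using \<eta>(1) by simp
  also have "\<dots> < \<epsilon>"
    using \<eta>(2) norm_ge_zero[of "M i w"] by (subst (asm) pos_less_divide_eq) (auto simp: add_nonneg_pos)
  finally have close: "norm (M i u' - M i u) < \<epsilon>" .
  let ?A = "cstar_generated (M i u')"
  note sub = cstar_subalgebra_generated[of "M i u'"]
  note A = cstar_subalgebraD[OF sub]
  have slot: "M i (ent_unit j c d (r j c d)) \<in> ?A"
    if j: "j < K i" "c < n i j" "d < n i j" and free: "(c, d) \<notin> R j" for j c d
  proof -
    have "M i (ent_unit j c d (u' j c d)) \<in> ?A"
    proof (rule entries_generated(1)[OF sub u'_cont cstar_generated_self u'_real _ _ j])
      show "inj_on (\<lambda>(j, c). \<theta> j c) ?I" using \<eta>(3) by (auto simp: inj_on_def \<theta>_def)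
      show "\<theta> j c \<noteq> 0" if "j < K i" "c < n i j" for j c using \<eta>(4)[of "(j, c)"] that by (simp add: \<theta>_def)
    qed
    moreover have "M i (ent_unit j c d (r j c d)) = scaleC (1 / (of_real \<eta> * \<i>)) (M i (ent_unit j c d (u' j c d)))"
    proof -
      \<comment> \<open>A free slot is off the diagonal, so neither \<open>u\<close> nor
        \<open>\<tau>\<close> contributes and the entry of \<open>u'\<close> is
        \<open>\<eta> * \<i>\<close> times that of \<open>r\<close>.\<close>
      have "c \<noteq> d" using free refl by auto
      then have "r j c d x = 1 / (of_real \<eta> * \<i>) * u' j c d x" if "x \<in> mspace (X i j)" for x
        using u0[OF j that free] \<eta>(1) by (simp add: u'_def w_def ent_diag_def)
      then have "M i (ent_unit j c d (r j c d)) =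
          M i (\<lambda>j' c' d' x. 1 / (of_real \<eta> * \<i>) * ent_unit j c d (u' j c d) j' c' d' x)"
        by (intro M_cong) (auto simp: ent_eq_def ent_unit_def)
      then show ?thesis
        using M_scale[OF cont_unit, of i j "u' j c d" "1 / (of_real \<eta> * \<i>)" c d] u'_cont j
        by (simp add: cont_ent_def)
    qed
    ultimately show ?thesis using A(4) by simp
  qed
  \<comment> \<open>The two slots through a common free index \<open>z\<close> both carry 1, and the
    product of their units is the unit at \<open>(a, b)\<close>.\<close>
  have unit: "M i (ent_unit j a b (\<lambda>x. 1)) \<in> ?A" if j: "j < K i" "a < n i j" "b < n i j" for j a b
  proof -
    obtain z where z: "z < 2 * N + 1" "(a, z) \<notin> R j" "(b, z) \<notin> R j"
      using common_free_index[OF fin card] by blast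
    have zn: "z < n i j" using z(1) large[OF j(1)] by simp
    have zb: "(z, b) \<notin> R j" using z(3) sym[of j] by (meson symD)
    have "r j a z = (\<lambda>y. 1)" "r j z b = (\<lambda>y. 1)"
      using z zb by (auto simp: r_def fun_eq_iff)
    then have "M i (ent_unit j a z (\<lambda>x. 1)) \<in> ?A" "M i (ent_unit j z b (\<lambda>x. 1)) \<in> ?A"
      using slot[OF j(1,2) zn z(2)] slot[OF j(1) zn j(3) zb] by simp_all
    then show ?thesis
      using A(3) M_unit_mult[OF zn, of "\<lambda>x. 1" "\<lambda>x. 1" a b] by fastforce
  qed
  have "M i v \<in> ?A"
  proof (rule M_in_subalgebra[OF sub v])
    fix j a b assume j: "j < K i" "a < n i j" "b < n i j"
    have v_ab: "continuous_map (mtopology_of (X i j)) euclidean (v j a b)"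
      using v j by (simp add: cont_ent_def)
    show "M i (ent_unit j a b (v j a b)) \<in> ?A"
    proof (cases "(a, b) \<in> R j")
      case False
      then have "M i (ent_unit j a b (v j a b)) = M i (\<lambda>j c d x. 0)"
        using v0[OF j] by (intro M_cong) (auto simp: ent_eq_def ent_unit_def)
      then show ?thesis using A(1) M_zero by simp
    next
      case True
      then have T: "(a, b) \<in> T j" using j by (simp add: T_def)
      obtain c d where cd: "\<sigma> j (a, b) = (c, d)" by (cases "\<sigma> j (a, b)")
      then have free: "(c, d) \<notin> R j" "2 * N + 1 \<le> c" "c < d" "d < n i j"
        using \<sigma>[OF j(1)] T unfolding good_def by force+
      have "(c, d) \<in> \<sigma> j ` T j" using cd T by (metis imageI)
      moreover have "src j (c, d) = (a, b)" using src[OF j(1) T] cd by simp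
      ultimately have "r j c d = v j a b"
        using free by (auto simp: r_def fun_eq_iff)
      \<comment> \<open>The entry of \<open>v\<close> is available at its storage slot
        \<open>(c, d)\<close>; multiplying by the units \<open>(a, c)\<close> and
        \<open>(d, b)\<close> brings it back to \<open>(a, b)\<close>.\<close>
      then have "M i (ent_unit j c d (v j a b)) \<in> ?A"
        using slot[of j c d] j(1) free by simp
      moreover have "M i (ent_unit j a c (\<lambda>x. 1)) * M i (ent_unit j c d (v j a b)) = M i (ent_unit j a d (v j a b))"
        using M_unit_mult[of c i j "\<lambda>x. 1" "v j a b" a d] v_ab free by simp
      moreover have "M i (ent_unit j a d (v j a b)) * M i (ent_unit j d b (\<lambda>x. 1)) = M i (ent_unit j a b (v j a b))"
        using M_unit_mult[of d i j "v j a b" "\<lambda>x. 1" a b] v_ab free by simp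
      moreover have "M i (ent_unit j a c (\<lambda>x. 1)) \<in> ?A" "M i (ent_unit j d b (\<lambda>x. 1)) \<in> ?A"
        using unit j free by auto
      ultimately show ?thesis using A(3) by metis
    qed
  qed
  with close u'_cont u'_real show ?thesis unfolding diag_real_part_def by blast
qed

lemma perturb_to_generate:
  assumes grow: "\<And>N i. \<exists>i'>i. \<forall>j<K i'. N \<le> n i' j"
    and u: "diag_real_part i u t" and v: "cont i v" and "\<epsilon> > 0"
  shows "\<exists>i' u' t'. diag_real_part i' u' t' \<and> norm (M i' u' - M i u) < \<epsilon> \<and> M i v \<in> cstar_generated (M i' u')"
proof -
  \<comment> \<open>The row bound of \<open>push_sparse\<close>, plus 1 for the diagonal that is
    added to the pattern. It depends on level \<open>i\<close> alone, so the later level with sizes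
    at least \<open>12 * ?N + 2\<close> can be chosen after it.\<close>
  let ?N = "(\<Sum>j<K i. n i j) + 1"
  obtain i' where i': "i' > i" "\<And>j. j < K i' \<Longrightarrow> 12 * ?N + 2 \<le> n i' j"
    using grow by blast
  define k where "k = i' - i"
  have k: "k \<ge> 1" "i' = i + k" using i'(1) by (auto simp: k_def)
  obtain R0 :: "nat \<Rightarrow> (nat \<times> nat) set" where R0: "\<And>j. sym (R0 j)" "\<And>j a. finite {b. (a, b) \<in> R0 j}"
    "\<And>j a. j < K (i + k) \<Longrightarrow> card {b. (a, b) \<in> R0 j} \<le> (\<Sum>j<K i. n i j)"
    "\<And>u j a b y. cont i u \<Longrightarrow> j < K (i + k) \<Longrightarrow> a < n (i + k) j \<Longrightarrow> b < n (i + k) j \<Longrightarrow>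
      y \<in> mspace (X (i + k) j) \<Longrightarrow> (a, b) \<notin> R0 j \<Longrightarrow> push i k u j a b y = 0"
    by (rule push_sparse[OF k(1), of i]) blast
  \<comment> \<open>Beyond the actual summands the pattern is just the diagonal, because
    \<open>generate_sparse\<close> asks for the row bound at every \<open>j\<close>.\<close>
  define R where "R j = (if j < K (i + k) then R0 j else {}) \<union> Id" for j
  have row: "{b. (a, b) \<in> R j} = insert a (if j < K (i + k) then {b. (a, b) \<in> R0 j} else {})" for a j
    by (auto simp: R_def)
  have u_cont: "cont i u" using u by (simp add: diag_real_part_def)
  obtain t' where t': "diag_real_part (i + k) (push i k u) t'"
    using push_diag_real_part[OF u k(1)] by blast
  have "\<exists>u' t'. diag_real_part (i + k) u' t' \<and> norm (M (i + k) u' - M (i + k) (push i k u)) < \<epsilon> \<and>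
      M (i + k) (push i k v) \<in> cstar_generated (M (i + k) u')"
  proof (rule generate_sparse[OF t' conn_elt(2)[OF v] \<open>\<epsilon> > 0\<close>, of R ?N])
    show "sym (R j)" for j using R0(1)[of j] by (auto simp: R_def sym_def)
    show "finite {b. (a, b) \<in> R j}" for a j unfolding row using R0(2) by simp
    show "card {b. (a, b) \<in> R j} \<le> ?N" for a j
      unfolding row using R0(2)[of a j] R0(3)[of j a] by (auto simp: card_insert_if)
    show "push i k u j a b y = 0" "push i k v j a b y = 0"
      if "j < K (i + k)" "a < n (i + k) j" "b < n (i + k) j" "y \<in> mspace (X (i + k) j)" "(a, b) \<notin> R j" for j a b y
      using R0(4)[OF u_cont that(1-4)] R0(4)[OF v that(1-4)] that(1,5) by (auto simp: R_def)
  qed (use i'(2) k(2) in \<open>auto simp: R_def\<close>)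
  then show ?thesis
    unfolding M_push[OF u_cont] M_push[OF v] by blast
qed

text \<open>The candidates \<open>S\<close> come from all levels, so a perturbation may move to a
  later level without leaving \<open>S\<close>.\<close>

lemma singly_generated_if_growing:
  assumes grow: "\<And>N i. \<exists>i'>i. \<forall>j<K i'. N \<le> n i' j"
  shows "singly_generated TYPE('b)"
proof -
  obtain W where W: "countable W" "W \<noteq> {}" "W \<subseteq> V" "\<And>A. cstar_subalgebra A \<Longrightarrow> W \<subseteq> A \<Longrightarrow> A = UNIV"
    by (rule countable_generators) blast
  define S where "S = {M i u |i u. \<exists>t. diag_real_part i u t}"
  obtain b where b: "range (from_nat_into W) \<subseteq> cstar_generated b"
  proof (rule exists_generator_of_sequence)
    have "diag_real_part 0 (\<lambda>j c d x. 0) (\<lambda>j c. 0)"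
      using cont_ent_const[of _ _ _ "\<lambda>j c d. 0"] by (simp add: diag_real_part_def ent_eq_def ent_diag_def)
    then show "S \<noteq> {}" unfolding S_def by blast
  next
    fix b k and \<epsilon> :: real assume "b \<in> S" "\<epsilon> > 0"
    then obtain i u t where b: "b = M i u" "diag_real_part i u t" by (auto simp: S_def)
    obtain i0 v where v: "from_nat_into W k = M i0 v" "cont i0 v"
      using W(3) from_nat_into[OF W(2), of k] unfolding V_def by blast
    have u: "cont i u" using b(2) by (simp add: diag_real_part_def)
    \<comment> \<open>A common level for \<open>u\<close> and \<open>v\<close>; the
      \<open>+ 1\<close> pushes \<open>u\<close> by at least one step, as
      \<open>push_diag_real_part\<close> requires.\<close>
    let ?i = "i + (i0 + 1)"
    have eq: "i0 + (i + 1) = ?i" by simp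
    obtain t1 where t1: "diag_real_part ?i (push i (i0 + 1) u) t1"
      using push_diag_real_part[OF b(2), of "i0 + 1"] by auto
    have v': "cont ?i (push i0 (i + 1) v)" "M ?i (push i0 (i + 1) v) = M i0 v"
      using conn_elt(2)[OF v(2), of "i + 1"] M_push[OF v(2), of "i + 1"] unfolding eq by simp_all
    show "\<exists>b'\<in>S. norm (b' - b) < \<epsilon> \<and> from_nat_into W k \<in> cstar_generated b'"
      using perturb_to_generate[OF grow t1 v'(1) \<open>\<epsilon> > 0\<close>]
      unfolding v'(2) M_push[OF u] v(1) b(1) S_def by blast
  qed
  then have "W \<subseteq> cstar_generated b" using W(1,2) by (simp add: range_from_nat_into)
  from W(4)[OF cstar_subalgebra_generated this] show ?thesis
    unfolding singly_generated_def by blast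
qed

end

section \<open>The case of bounded matrix sizes\<close>

text \<open>The index type may be uncountable, so there need not be a subsequence converging at
  every index. Compactness of a product of discs instead provides a cluster point and a filter finer
  than \<open>sequentially\<close> converging to it.\<close>

lemma pointwise_cluster_filter:
  fixes val :: "nat \<Rightarrow> 't \<Rightarrow> complex"
  assumes "\<And>t. \<exists>B. \<forall>l. cmod (val l t) \<le> B"
  obtains G p where "G \<noteq> bot" "G \<le> sequentially" "\<And>t. ((\<lambda>l. val l t) \<longlongrightarrow> p t) G"
proof -
  obtain B where B: "\<And>t l. cmod (val l t) \<le> B t" using assms by metis
  let ?C = "PiE UNIV (\<lambda>t. cball 0 (B t)) :: ('t \<Rightarrow> complex) set"
  have "compactin (product_topology (\<lambda>t. euclidean) UNIV) ?C"
    by (simp add: compactin_PiE)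
  then have "compact ?C" by (simp add: euclidean_product_topology)
  moreover have "filtermap val sequentially \<noteq> bot" by (simp add: filtermap_bot_iff)
  moreover have "eventually (\<lambda>f. f \<in> ?C) (filtermap val sequentially)"
    using B by (simp add: eventually_filtermap PiE_def)
  ultimately obtain p where p: "inf (nhds p) (filtermap val sequentially) \<noteq> bot"
    unfolding compact_filter by meson
  define G where "G = inf sequentially (filtercomap val (nhds p))"
  have "G \<noteq> bot"
  proof
    assume "G = bot"
    then have "eventually (\<lambda>l. False) G" by simp
    then obtain P Q where P: "eventually P sequentially" and Q: "eventually Q (filtercomap val (nhds p))"
      and PQ: "\<And>l. P l \<Longrightarrow> Q l \<Longrightarrow> False"
      unfolding G_def eventually_inf by blast
    from Q obtain Q' where Q': "eventually Q' (nhds p)" "\<And>l. Q' (val l) \<Longrightarrow> Q l"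
      unfolding eventually_filtercomap by blast
    have "eventually (\<lambda>f. \<not> Q' f) (filtermap val sequentially)"
      unfolding eventually_filtermap using P by (rule eventually_mono) (use PQ Q'(2) in blast)
    with Q'(1) have "eventually (\<lambda>f. False) (inf (nhds p) (filtermap val sequentially))"
      unfolding eventually_inf by blast
    with p show False by (simp add: trivial_limit_def)
  qed
  moreover have "G \<le> sequentially" by (simp add: G_def)
  moreover have "((\<lambda>l. val l t) \<longlongrightarrow> p t) G" for t
  proof -
    have "filterlim val (nhds p) G"
      unfolding G_def by (rule filterlim_mono[OF filterlim_filtercomap order_refl]) simp
    then show ?thesis
      using continuous_on_tendsto_compose[OF continuous_on_product_coordinates[of t]] by simp
  qed
  ultimately show ?thesis by (rule that)
qed

section \<open>Finite dimensional representations of the algebraic limit\<close>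

context ah_limit
begin

text \<open>
  A unital representation of the algebraic limit by \<open>N\<times>N\<close> matrices, contractive on entries, that maps
  diagonal matrices to diagonal matrices.
\<close>

definition diagonal_rep :: "nat \<Rightarrow> (nat \<Rightarrow> 'x entries \<Rightarrow> nat \<Rightarrow> nat \<Rightarrow> complex) \<Rightarrow> bool" where
  "diagonal_rep N \<Psi> \<longleftrightarrow>
     (\<forall>i u v c d. cont i u \<longrightarrow> cont i v \<longrightarrow> \<Psi> i (\<lambda>j c d x. u j c d x + v j c d x) c d = \<Psi> i u c d + \<Psi> i v c d) \<and>
     (\<forall>i u a c d. cont i u \<longrightarrow> \<Psi> i (\<lambda>j c d x. a * u j c d x) c d = a * \<Psi> i u c d) \<and>
     (\<forall>i u v c d. cont i u \<longrightarrow> cont i v \<longrightarrow> \<Psi> i (ent_mult (n i) u v) c d = (\<Sum>e<N. \<Psi> i u c e * \<Psi> i v e d)) \<and>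
     (\<forall>i. \<Psi> i (ent_diag (\<lambda>j c x. 1)) 0 0 = 1) \<and>
     (\<forall>i u c d. cont i u \<longrightarrow> cmod (\<Psi> i u c d) \<le> norm (M i u)) \<and>
     (\<forall>i k u c d. cont i u \<longrightarrow> \<Psi> (i + k) (push i k u) c d = \<Psi> i u c d) \<and>
     (\<forall>i g c d. cont i (ent_diag g) \<longrightarrow> c \<noteq> d \<longrightarrow> \<Psi> i (ent_diag g) c d = 0)"

text \<open>Point evaluations in summands of size below \<open>N\<close>, one per late level, padded
  by zeros to size \<open>N\<close>. The padding can destroy the unit in high coordinates, but every
  size is at least 1, so entry \<open>(0, 0)\<close> of the unit is 1 throughout and stays 1 in the
  limit.\<close>

lemma diagonal_rep_if_bounded:
  assumes bounded: "\<And>l. l > i0 \<Longrightarrow> \<exists>j<K l. n l j < N"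
  shows "\<exists>\<Psi>. diagonal_rep N \<Psi>"
proof -
  have "\<exists>j x. j < K l \<and> n l j < N \<and> x \<in> mspace (X l j)" if "l > i0" for l
    using bounded[OF that] X_nonempty by blast
  then obtain J y where Jy: "\<And>l. l > i0 \<Longrightarrow> J l < K l" "\<And>l. l > i0 \<Longrightarrow> n l (J l) < N"
    "\<And>l. l > i0 \<Longrightarrow> y l \<in> mspace (X l (J l))"
    by metis
  \<comment> \<open>The value 0 serves as padding and as a default at levels up to \<open>i\<close>;
    these levels do not influence limits along \<open>G\<close>.\<close>
  define val where "val = (\<lambda>l (i, u, c, d). if l > i \<and> l > i0 \<and> cont i u \<and> c < n l (J l) \<and> d < n l (J l)
    then push i (l - i) u (J l) c d (y l) else 0)"
  have val_le: "cmod (val l (i, u, c, d)) \<le> nrm (block (i + (l - i))) (conn \<phi> i (l - i) (elt i u))"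
    if "l > i" "l > i0" "cont i u" for l i u c d
  proof -
    \<comment> \<open>Padded entries equal 0, and entry \<open>(0, 0)\<close>, which exists in every
      size, shows the norm to be nonnegative.\<close>
    have nonneg: "0 \<le> nrm (block (i + (l - i))) (conn \<phi> i (l - i) (elt i u))"
      using cmod_push_le[OF that(3), of "J l" "l - i" 0 0 "y l"] Jy[OF that(2)] n_pos[OF Jy(1)[OF that(2)]] that(1)
      by (auto intro: order_trans[OF norm_ge_zero])
    show ?thesis
      using cmod_push_le[OF that(3), of "J l" "l - i" c d "y l"] Jy[OF that(2)] that(1) nonneg
      by (simp add: val_def)
  qed
  have nrm_lim: "(\<lambda>l. nrm (block (i + (l - i))) (conn \<phi> i (l - i) (elt i u))) \<longlonglongrightarrow> norm (M i u)"
    if "cont i u" for i u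
    using filterlim_compose[OF nrm_limit[OF mk_carrier[OF that]] filterlim_minus_const_nat_at_top[of i]]
    by (simp add: M_def)
  have bdd: "\<exists>B. \<forall>l. cmod (val l t) \<le> B" for t
  proof -
    obtain i u c d where t: "t = (i, u, c, d)" by (cases t)
    show ?thesis
    proof (cases "cont i u")
      case True
      have "Bseq (\<lambda>l. nrm (block (i + (l - i))) (conn \<phi> i (l - i) (elt i u)))"
        using nrm_lim[OF True] convergentI convergent_imp_Bseq by blast
      then obtain B where B: "B > 0" "\<And>l. norm (nrm (block (i + (l - i))) (conn \<phi> i (l - i) (elt i u))) \<le> B"
        by (rule BseqE) blast
      have "cmod (val l t) \<le> B" for l
      proof (cases "l > i \<and> l > i0")
        case True': True
        then show ?thesis
          using val_le[of i l u c d] \<open>cont i u\<close> B(2)[of l] unfolding t real_norm_def by linarith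
      next
        case False
        then show ?thesis using B(1) by (auto simp: t val_def)
      qed
      then show ?thesis by blast
    qed (auto simp: t val_def)
  qed
  obtain G p where G: "G \<noteq> bot" "G \<le> sequentially" and p: "\<And>t. ((\<lambda>l. val l t) \<longlongrightarrow> p t) G"
    by (rule pointwise_cluster_filter[of val, OF bdd]) blast
  define \<Psi> where "\<Psi> = (\<lambda>i u c d. p (i, u, c, d))"
  have lim: "((\<lambda>l. val l (i, u, c, d)) \<longlongrightarrow> \<Psi> i u c d) G" for i u c d
    unfolding \<Psi>_def by (rule p)
  have large: "eventually (\<lambda>l. l > i \<and> l > i0) G" for i
    using eventually_gt_at_top[of "max i i0"] G(2) by (auto simp: le_filter_def elim: eventually_mono)
  have limI: "\<Psi> i u c d = z"
    if "(f \<longlongrightarrow> z) G" "\<And>l. l > m \<Longrightarrow> l > i0 \<Longrightarrow> val l (i, u, c, d) = f l" for i u c d z f m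
  proof (rule tendsto_unique[OF G(1)])
    show "((\<lambda>l. val l (i, u, c, d)) \<longlongrightarrow> z) G"
      by (rule Lim_transform_eventually[OF that(1)], rule eventually_mono[OF large[of m]]) (use that(2) in auto)
  qed (rule lim)
  have "\<Psi> i (\<lambda>j c d x. u j c d x + v j c d x) c d = \<Psi> i u c d + \<Psi> i v c d"
    if "cont i u" "cont i v" for i u v c d
  proof (rule limI[OF tendsto_add[OF lim lim], of i])
    fix l assume l: "l > i" "l > i0"
    then show "val l (i, \<lambda>j c d x. u j c d x + v j c d x, c, d) = val l (i, u, c, d) + val l (i, v, c, d)"
      using that push_add[OF that, of "l - i"] cont_ent_add[OF that] Jy[OF l(2)]
      by (simp add: val_def ent_eq_def)
  qed
  moreover have "\<Psi> i (\<lambda>j c d x. a * u j c d x) c d = a * \<Psi> i u c d" if "cont i u" for i u a c d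
  proof (rule limI[OF tendsto_mult_left[OF lim], of i])
    fix l assume l: "l > i" "l > i0"
    then show "val l (i, \<lambda>j c d x. a * u j c d x, c, d) = a * val l (i, u, c, d)"
      using that push_scale[OF that, of "l - i" a] cont_ent_smult[OF that] Jy[OF l(2)]
      by (simp add: val_def ent_eq_def)
  qed
  moreover have "\<Psi> i (ent_mult (n i) u v) c d = (\<Sum>e<N. \<Psi> i u c e * \<Psi> i v e d)"
    if "cont i u" "cont i v" for i u v c d
  proof (rule limI[OF tendsto_sum[OF tendsto_mult[OF lim lim]], of i])
    fix l assume l: "l > i" "l > i0"
    show "val l (i, ent_mult (n i) u v, c, d) = (\<Sum>e<N. val l (i, u, c, e) * val l (i, v, e, d))"
    proof (cases "c < n l (J l) \<and> d < n l (J l)")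
      case True
      then have "val l (i, ent_mult (n i) u v, c, d) =
          (\<Sum>e<n l (J l). val l (i, u, c, e) * val l (i, v, e, d))"
        using that push_mult[OF that, of "l - i"] cont_ent_mult[OF that] Jy[OF l(2)] l
        by (simp add: val_def ent_eq_def ent_mult_def)
      \<comment> \<open>The additional terms vanish by the padding, so the matrix product has a
        fixed number \<open>N\<close> of terms at all levels.\<close>
      also have "\<dots> = (\<Sum>e<N. val l (i, u, c, e) * val l (i, v, e, d))"
        using Jy(2)[OF l(2)] by (intro sum.mono_neutral_left) (auto simp: val_def)
      finally show ?thesis .
    next
      case False
      then show ?thesis by (auto simp: val_def intro!: sum.neutral[symmetric])
    qed
  qed
  moreover have "\<Psi> i (ent_diag (\<lambda>j c x. 1)) 0 0 = 1" for i
  proof (rule limI[OF tendsto_const, of i])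
    fix l assume l: "l > i" "l > i0"
    have "cont i (ent_diag (\<lambda>j c x. 1))" by (rule cont_ent_diag) simp
    then show "val l (i, ent_diag (\<lambda>j c x. 1), 0, 0) = 1"
      using push_one[of i "l - i"] Jy[OF l(2)] n_pos[OF Jy(1)[OF l(2)]] l
      by (simp add: val_def ent_eq_def ent_diag_def)
  qed
  moreover have "cmod (\<Psi> i u c d) \<le> norm (M i u)" if "cont i u" for i u c d
  proof (rule tendsto_le[OF G(1) tendsto_mono[OF G(2) nrm_lim[OF that]] tendsto_norm[OF lim]])
    show "\<forall>\<^sub>F l in G. cmod (val l (i, u, c, d)) \<le> nrm (block (i + (l - i))) (conn \<phi> i (l - i) (elt i u))"
      by (rule eventually_mono[OF large[of i]]) (use val_le that in auto)
  qed
  moreover have "\<Psi> (i + k) (push i k u) c d = \<Psi> i u c d" if "cont i u" for i k u c d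
  proof (rule limI[OF lim, of "i + k"])
    fix l assume l: "l > i + k" "l > i0"
    then have "push (i + k) (l - (i + k)) (push i k u) = push i (l - i) u"
      using push_push[OF that, of k "l - (i + k)"] by simp
    then show "val l (i + k, push i k u, c, d) = val l (i, u, c, d)"
      using l that conn_elt(2)[OF that] by (simp add: val_def)
  qed
  moreover have "\<Psi> i (ent_diag g) c d = 0" if "cont i (ent_diag g)" "c \<noteq> d" for i g c d
  proof (rule limI[OF tendsto_const, of i])
    fix l assume l: "l > i" "l > i0"
    then show "val l (i, ent_diag g, c, d) = 0"
      using push_diag_offdiag[of "l - i" i g "J l" c d "y l"] that Jy[OF l(2)]
      by (simp add: val_def)
  qed
  ultimately have "diagonal_rep N \<Psi>" unfolding diagonal_rep_def by simp
  then show ?thesis by blast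
qed

section \<open>The representation on the dense subalgebra\<close>

lemma V_common_level:
  assumes "x \<in> V" "x' \<in> V"
  obtains i u v where "cont i u" "cont i v" "x = M i u" "x' = M i v"
proof -
  obtain i u i' v where "x = M i u" "cont i u" "x' = M i' v" "cont i' v"
    using assms unfolding V_def by blast
  then show ?thesis
    using that[of "i + i'" "push i i' u" "push i' i v"] conn_elt(2)[of i u i'] conn_elt(2)[of i' v i]
      M_push[of i u i'] M_push[of i' v i] by (simp add: add.commute[of i'])
qed

lemma M_in_V: "cont i u \<Longrightarrow> M i u \<in> V"
  unfolding V_def by blast

lemma V_closed:
  assumes "x \<in> V" "y \<in> V"
  shows "x + y \<in> V" "x * y \<in> V" "scaleC a x \<in> V" "x - y \<in> V"
proof -
  obtain i u v where uv: "cont i u" "cont i v" "x = M i u" "y = M i v"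
    by (rule V_common_level[OF assms])
  show "x + y \<in> V" using M_in_V[OF cont_ent_add[OF uv(1,2)]] M_add[OF uv(1,2)] uv(3,4) by simp
  show "x * y \<in> V" using M_in_V[OF cont_ent_mult[OF uv(1,2)]] M_mult[OF uv(1,2)] uv(3,4) by simp
  show "scaleC a x \<in> V" using M_in_V[OF cont_ent_smult[OF uv(1)]] M_scale[OF uv(1)] uv(3) by simp
  show "x - y \<in> V" using M_in_V[OF cont_ent_diff[OF uv(1,2)]] M_diff[OF uv(1,2)] uv(3,4) by simp
qed

lemma cont_one: "cont i (ent_diag (\<lambda>j c x. 1))"
  by (rule cont_ent_diag) simp

lemma one_in_V: "1 \<in> V"
  using M_in_V[OF cont_one[of 0]] M_one by simp

lemma zero_in_V: "0 \<in> V"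
  using V_closed(4)[OF one_in_V one_in_V] by simp

text \<open>Two representatives of one element, pushed to a common level, differ by entries with
  image 0. The bound by \<open>norm (M i u)\<close> makes \<open>\<Psi>\<close> vanish on these, so
  it descends to \<open>V\<close>.\<close>

lemma diagonal_rep_on_V:
  assumes rep: "diagonal_rep N \<Psi>"
  obtains F where "\<And>i u c d. cont i u \<Longrightarrow> F c d (M i u) = \<Psi> i u c d"
    "\<And>x y a c d. x \<in> V \<Longrightarrow> y \<in> V \<Longrightarrow> F c d (x - scaleC a y) = F c d x - a * F c d y"
    "\<And>x y c d. x \<in> V \<Longrightarrow> y \<in> V \<Longrightarrow> F c d (x * y) = (\<Sum>e<N. F c e x * F e d y)"
    "\<And>x c d. x \<in> V \<Longrightarrow> cmod (F c d x) \<le> norm x"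
    "F 0 0 1 = 1" "\<And>c d. c \<noteq> d \<Longrightarrow> F c d 1 = 0"
proof -
  have add: "\<Psi> i (\<lambda>j c d x. u j c d x + v j c d x) c d = \<Psi> i u c d + \<Psi> i v c d" if "cont i u" "cont i v" for i u v c d
    using rep that by (simp add: diagonal_rep_def)
  have scale: "\<Psi> i (\<lambda>j c d x. a * u j c d x) c d = a * \<Psi> i u c d" if "cont i u" for i u a c d
    using rep that by (simp add: diagonal_rep_def)
  have mult: "\<Psi> i (ent_mult (n i) u v) c d = (\<Sum>e<N. \<Psi> i u c e * \<Psi> i v e d)" if "cont i u" "cont i v" for i u v c d
    using rep that by (simp add: diagonal_rep_def)
  have bound: "cmod (\<Psi> i u c d) \<le> norm (M i u)" if "cont i u" for i u c d
    using rep that by (simp add: diagonal_rep_def)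
  have push: "\<Psi> (i + k) (push i k u) c d = \<Psi> i u c d" if "cont i u" for i k u c d
    using rep that by (simp add: diagonal_rep_def)
  have lin: "\<Psi> i (\<lambda>j c d x. u j c d x + (- a) * v j c d x) c d = \<Psi> i u c d - a * \<Psi> i v c d"
    if "cont i u" "cont i v" for i u v a c d
    using add[OF that(1) cont_ent_smult[OF that(2)], of "- a"] scale[OF that(2), of "- a"] by simp
  have M_lin: "M i (\<lambda>j c d x. u j c d x + (- a) * v j c d x) = M i u - scaleC a (M i v)"
    if "cont i u" "cont i v" for i u v a
    using M_add[OF that(1) cont_ent_smult[OF that(2)], of "- a"] M_scale[OF that(2), of "- a"]
      scaleC_add_left[of a "- a" "M i v"] by (simp add: eq_neg_iff_add_eq_0[symmetric])
  have well_defined: "\<Psi> i u c d = \<Psi> i' v c d" if uv: "cont i u" "cont i' v" "M i u = M i' v" for i u i' v c d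
  proof -
    let ?u = "push i i' u" and ?v = "push i' i v"
    have cont: "cont (i + i') ?u" "cont (i + i') ?v"
      using conn_elt(2)[OF uv(1), of i'] conn_elt(2)[OF uv(2), of i] by (simp_all add: add.commute)
    have "M (i + i') ?u = M (i + i') ?v"
      using M_push[OF uv(1), of i'] M_push[OF uv(2), of i] uv(3) by (simp add: add.commute)
    then have "M (i + i') (\<lambda>j c d x. ?u j c d x + (- 1) * ?v j c d x) = 0"
      unfolding M_lin[OF cont] by (simp add: scaleC_one)
    then have "\<Psi> (i + i') (\<lambda>j c d x. ?u j c d x + (- 1) * ?v j c d x) c d = 0"
      using bound[OF cont_ent_add[OF cont(1) cont_ent_smult[OF cont(2)]], of "- 1" c d] by simp
    then show ?thesis
      unfolding lin[OF cont] using push[OF uv(1), of i' c d] push[OF uv(2), of i c d]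
      by (simp add: add.commute)
  qed
  define F where "F c d x = (SOME z. \<exists>i u. cont i u \<and> x = M i u \<and> z = \<Psi> i u c d)" for c d x
  have F: "F c d (M i u) = \<Psi> i u c d" if "cont i u" for i u c d
    unfolding F_def
  proof (rule some_equality)
    show "\<exists>i' v. cont i' v \<and> M i u = M i' v \<and> \<Psi> i u c d = \<Psi> i' v c d" using that by blast
    fix z assume "\<exists>i' v. cont i' v \<and> M i u = M i' v \<and> z = \<Psi> i' v c d"
    then obtain i' v where "cont i' v" "M i u = M i' v" "z = \<Psi> i' v c d" by blast
    then show "z = \<Psi> i u c d" using well_defined[OF that, of i' v c d] by simp
  qed
  show ?thesis
  proof (rule that[OF F])
    show "F c d (x - scaleC a y) = F c d x - a * F c d y" if xy: "x \<in> V" "y \<in> V" for x y a c d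
    proof -
      obtain i u v where uv: "cont i u" "cont i v" "x = M i u" "y = M i v"
        by (rule V_common_level[OF xy])
      show ?thesis
        using F[OF cont_ent_add[OF uv(1) cont_ent_smult[OF uv(2)]], of c d "- a"]
        unfolding M_lin[OF uv(1,2)] lin[OF uv(1,2)] uv(3,4) F[OF uv(1)] F[OF uv(2)] .
    qed
    show "F c d (x * y) = (\<Sum>e<N. F c e x * F e d y)" if xy: "x \<in> V" "y \<in> V" for x y c d
    proof -
      obtain i u v where uv: "cont i u" "cont i v" "x = M i u" "y = M i v"
        by (rule V_common_level[OF xy])
      show ?thesis
        using F[OF cont_ent_mult[OF uv(1,2)], of c d]
        unfolding M_mult[OF uv(1,2)] mult[OF uv(1,2)] uv(3,4) F[OF uv(1)] F[OF uv(2)] .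
    qed
    show "cmod (F c d x) \<le> norm x" if x: "x \<in> V" for x c d
      using x bound F unfolding V_def by force
    show "F 0 0 1 = 1"
      using F[OF cont_one[of 0], of 0 0] rep by (simp add: M_one diagonal_rep_def)
    show "F c d 1 = 0" if "c \<noteq> d" for c d
      using F[OF cont_one[of 0], of c d] rep that cont_one by (simp add: M_one diagonal_rep_def)
  qed
qed

text \<open>When every function on a summand acts as a scalar, the images of the matrix units of
  level \<open>i\<close> span \<open>V\<close>, and a single matrix with constant entries generates
  them.\<close>

lemma singly_generated_if_scalar_center:
  assumes V: "\<And>x. x \<in> V \<Longrightarrow> \<exists>u. cont i u \<and> x = M i u"
    and scalar: "\<And>j g. j < K i \<Longrightarrow> continuous_map (mtopology_of (X i j)) euclidean g \<Longrightarrow>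
      \<exists>a. M i (ent_diag (\<lambda>j' c x. if j' = j then g x else 0)) = scaleC a 1"
  shows "singly_generated TYPE('b)"
proof -
  define \<tau> where "\<tau> j c = real (prod_encode (j, c) + 1)" for j c
  \<comment> \<open>The real part is the diagonal with distinct positive values
    \<open>\<tau>\<close>, and the imaginary part has all entries 1, so each off-diagonal entry is
    \<open>\<i>\<close> and produces a matrix unit.\<close>
  define u :: "'x entries" where "u j c d x = (if c = d then of_real (\<tau> j c) else 0) + \<i>" for j c d x
  let ?A = "cstar_generated (M i u)"
  note sub = cstar_subalgebra_generated[of "M i u"]
  have u_eq: "u j c d = (\<lambda>x. (if c = d then of_real (\<tau> j c) else 0) + \<i>)" for j c d
    by (simp add: fun_eq_iff u_def)
  have u_cont: "cont i u" by (simp add: cont_ent_def u_eq)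
  have "eqv i (\<lambda>j c d x. u j c d x + cnj (u j d c x)) (ent_diag (\<lambda>j c x. of_real (2 * \<tau> j c)))"
    by (simp add: ent_eq_def ent_diag_def u_def)
  moreover have "inj_on (\<lambda>(j, c). 2 * \<tau> j c) (SIGMA j:{..<K i}. {..<n i j})"
    by (rule inj_onI) (auto simp: \<tau>_def)
  moreover have "2 * \<tau> j c \<noteq> 0" for j c by (simp add: \<tau>_def add_nonneg_eq_0_iff)
  ultimately have gen: "M i (ent_unit j c d (u j c d)) \<in> ?A" "M i (ent_unit j c c (\<lambda>x. 1)) \<in> ?A"
    if "j < K i" "c < n i j" "d < n i j" for j c d
    using entries_generated[OF sub u_cont cstar_generated_self _ _ _ that, of "\<lambda>j c. 2 * \<tau> j c"] by blast+
  have unit: "M i (ent_unit j c d (\<lambda>x. 1)) \<in> ?A" if j: "j < K i" "c < n i j" "d < n i j" for j c d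
  proof (cases "c = d")
    case True
    then show ?thesis using gen(2) j by simp
  next
    case False
    have "M i (ent_unit j c d (\<lambda>x. 1)) = M i (\<lambda>j' c' d' x. - \<i> * ent_unit j c d (u j c d) j' c' d' x)"
      using False by (intro M_cong) (simp add: ent_eq_def ent_unit_def u_eq)
    also have "\<dots> = scaleC (- \<i>) (M i (ent_unit j c d (u j c d)))"
      by (rule M_scale, rule cont_unit) (simp add: u_eq)
    finally have "M i (ent_unit j c d (\<lambda>x. 1)) = scaleC (- \<i>) (M i (ent_unit j c d (u j c d)))" .
    then show ?thesis using cstar_subalgebraD(4)[OF sub gen(1)[OF j]] by simp
  qed
  have "V \<subseteq> ?A"
  proof
    fix x assume "x \<in> V"
    then obtain v where v: "cont i v" "x = M i v" using V by blast
    have "M i (ent_unit j c d (v j c d)) \<in> ?A" if j: "j < K i" "c < n i j" "d < n i j" for j c d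
    proof -
      have g: "continuous_map (mtopology_of (X i j)) euclidean (v j c d)"
        using v(1) j by (simp add: cont_ent_def)
      obtain a where "M i (ent_diag (\<lambda>j' c' x. if j' = j then v j c d x else 0)) = scaleC a 1"
        using scalar[OF j(1) g] by blast
      then have "M i (ent_unit j c d (v j c d)) = scaleC a (M i (ent_unit j c d (\<lambda>x. 1)))"
        using M_unit_scalar[OF j g] by (simp add: mult_scaleC_left)
      then show ?thesis using cstar_subalgebraD(4)[OF sub unit[OF j]] by simp
    qed
    then show "x \<in> ?A" unfolding v(2) by (rule M_in_subalgebra[OF sub v(1)])
  qed
  then have "?A = UNIV"
    using closure_V closure_minimal[OF _ cstar_subalgebraD(6)[OF sub]] by blast
  then show ?thesis unfolding singly_generated_def by blast
qed

lemma singly_generated_if_bounded: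
  assumes simple: "simple_cstar TYPE('b)"
    and bounded: "\<And>l. l > i0 \<Longrightarrow> \<exists>j<K l. n l j < N"
  shows "singly_generated TYPE('b)"
proof -
  have N: "N > 0" using bounded[of "Suc i0"] by auto
  obtain \<Psi> where rep: "diagonal_rep N \<Psi>" using diagonal_rep_if_bounded[OF bounded] by blast
  obtain F where F: "\<And>i u c d. cont i u \<Longrightarrow> F c d (M i u) = \<Psi> i u c d"
    "\<And>x y a c d. x \<in> V \<Longrightarrow> y \<in> V \<Longrightarrow> F c d (x - scaleC a y) = F c d x - a * F c d y"
    "\<And>x y c d. x \<in> V \<Longrightarrow> y \<in> V \<Longrightarrow> F c d (x * y) = (\<Sum>e<N. F c e x * F e d y)"
    "\<And>x c d. x \<in> V \<Longrightarrow> cmod (F c d x) \<le> norm x"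
    "F 0 0 1 = 1" "\<And>c d. c \<noteq> d \<Longrightarrow> F c d 1 = 0"
    by (rule diagonal_rep_on_V[OF rep]) blast
  have F0: "F c d 0 = 0" for c d using F(4)[OF zero_in_V, of c d] by simp
  have F_diff: "F c d (x - y) = F c d x - F c d y" if "x \<in> V" "y \<in> V" for x y c d
    using F(2)[OF that, of c d 1] by (simp add: scaleC_one)
  have F_scale: "F c d (scaleC a x) = a * F c d x" if "x \<in> V" for x a c d
    using F(2)[OF zero_in_V that, of c d "- a"] scaleC_add_left[of a "- a" x]
    by (simp add: F0 eq_neg_iff_add_eq_0[symmetric])
  have F_add: "F c d (x + y) = F c d x + F c d y" if "x \<in> V" "y \<in> V" for x y c d
    using F(2)[OF that, of c d "- 1"] by (simp add: scaleC_minus_one)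
  \<comment> \<open>\<open>F 0 0\<close> is contractive and takes the value 1 at the unit, so its
    kernel stays at distance 1 from the unit. Both applications of simplicity rest on this.\<close>
  have far: "norm (1 - x) \<ge> 1" if "x \<in> V" "F 0 0 x = 0" for x
    using F(4)[OF V_closed(4)[OF one_in_V that(1)], of 0 0] F_diff[OF one_in_V that(1), of 0 0] that(2) F(5)
    by simp
  \<comment> \<open>The kernel of the representation is an ideal of \<open>V\<close>. Simplicity
    makes it 0, so elements of \<open>V\<close> are determined by \<open>N * N\<close>
    numbers.\<close>
  have "{x \<in> V. \<forall>c<N. \<forall>d<N. F c d x = 0} = {0}"
  proof (rule simple_cstar_dense_ideal[OF simple closure_V])
    fix a x assume "a \<in> V" "x \<in> {x \<in> V. \<forall>c<N. \<forall>d<N. F c d x = 0}"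
    then show "a * x \<in> {x \<in> V. \<forall>c<N. \<forall>d<N. F c d x = 0} \<and> x * a \<in> {x \<in> V. \<forall>c<N. \<forall>d<N. F c d x = 0}"
      by (auto simp: F(3) V_closed intro!: sum.neutral)
  qed (use N far in \<open>auto simp: zero_in_V F0 F_add F_scale V_closed\<close>)
  then have inj: "x = 0" if "x \<in> V" "\<And>c d. c < N \<Longrightarrow> d < N \<Longrightarrow> F c d x = 0" for x
    using that by blast
  define L where "L i = {M i u |u. cont i u}" for i
  have L_V: "L i \<subseteq> V" for i by (auto simp: L_def V_def)
  have "\<exists>i. \<forall>i'. L i' \<subseteq> L i"
  \<comment> \<open>The functional \<open>F c d\<close> has number \<open>d + c * N\<close>, from
    which \<open>div\<close> and \<open>mod\<close> recover the pair.\<close>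
  proof (rule subspace_chain_stabilizes[of L "\<lambda>k. F (k div N) (k mod N)" "N * N"])
    show "mono L"
    proof (rule monoI)
      fix i i' :: nat assume "i \<le> i'"
      then obtain k where "i' = i + k" by (metis le_Suc_ex)
      moreover have "M i u \<in> L (i + k)" if "cont i u" for u
        unfolding L_def using conn_elt(2)[OF that, of k] M_push[OF that, of k, symmetric] by blast
      ultimately show "L i \<subseteq> L i'" unfolding L_def[of i] by blast
    qed
    show "x - scaleC a y \<in> L i" if xy: "x \<in> L i" "y \<in> L i" for i x y a
    proof -
      obtain u v where uv: "cont i u" "cont i v" "x = M i u" "y = M i v" using xy unfolding L_def by blast
      have "x - scaleC a y = M i (\<lambda>j c d x. u j c d x - a * v j c d x)"
        using M_diff[OF uv(1) cont_ent_smult[OF uv(2)]] M_scale[OF uv(2)] uv(3,4) by simp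
      then show ?thesis using cont_ent_diff[OF uv(1) cont_ent_smult[OF uv(2)]] unfolding L_def by blast
    qed
    show "F (k div N) (k mod N) (x - scaleC a y) = F (k div N) (k mod N) x - a * F (k div N) (k mod N) y"
      if "x \<in> L i" "y \<in> L i" for i k x y a
      using F(2) that L_V by blast
    show "x = 0" if x: "x \<in> L i" and 0: "\<And>k. k < N * N \<Longrightarrow> F (k div N) (k mod N) x = 0" for i x
    proof (rule inj)
      show "x \<in> V" using x L_V by blast
      fix c d assume cd: "c < N" "d < N"
      have "d + c * N < Suc c * N" using cd(2) by simp
      also have "\<dots> \<le> N * N" using cd(1) by (intro mult_le_mono1) simp
      finally show "F c d x = 0" using 0[of "d + c * N"] cd(2) by simp
    qed
    show "0 \<in> L i" for i
      using M_zero[of i, symmetric] cont_ent_const[of "K i" "n i" "X i" "\<lambda>j c d. 0"] unfolding L_def by blast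
  qed
  then obtain i where i: "\<And>i'. L i' \<subseteq> L i" by blast
  have V_i: "\<exists>u. cont i u \<and> x = M i u" if "x \<in> V" for x
    using that i unfolding V_def L_def by blast
  show ?thesis
  proof (rule singly_generated_if_scalar_center[OF V_i])
    fix j and g :: "'x \<Rightarrow> complex" assume j: "j < K i" and g: "continuous_map (mtopology_of (X i j)) euclidean g"
    define D :: "'x entries" where "D = ent_diag (\<lambda>j' c x. if j' = j then g x else 0)"
    have D_cont: "cont i D" unfolding D_def using g by (intro cont_ent_diag) auto
    define z where "z = M i D"
    have z_V: "z \<in> V" unfolding z_def by (rule M_in_V[OF D_cont])
    have central: "z * x = x * z" if x: "x \<in> V" for x
    proof -
      obtain u where u: "cont i u" "x = M i u" using V_i[OF x] by blast
      have "eqv i (ent_mult (n i) D u) (ent_mult (n i) u D)"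
        unfolding ent_eq_def
      proof (intro allI impI ballI)
        fix j' c d x assume cd: "c < n i j'" "d < n i j'"
        have "ent_mult (n i) D u j' c d x = (\<Sum>e<n i j'. if e = c then (if j' = j then g x else 0) * u j' c d x else 0)"
          unfolding ent_mult_def by (intro sum.cong) (auto simp: D_def ent_diag_def)
        moreover have "ent_mult (n i) u D j' c d x = (\<Sum>e<n i j'. if e = d then (if j' = j then g x else 0) * u j' c d x else 0)"
          unfolding ent_mult_def by (intro sum.cong) (auto simp: D_def ent_diag_def)
        ultimately show "ent_mult (n i) D u j' c d x = ent_mult (n i) u D j' c d x"
          using cd by simp
      qed
      from M_cong[OF this] show ?thesis
        unfolding z_def u(2) M_mult[OF D_cont u(1)] M_mult[OF u(1) D_cont] .
    qed
    define a where "a = F 0 0 z"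
    define z' where "z' = z - scaleC a 1"
    have z'_V: "z' \<in> V" unfolding z'_def by (rule V_closed(4)[OF z_V V_closed(3)[OF one_in_V one_in_V]])
    have z'_central: "z' * x = x * z'" if "x \<in> V" for x
      unfolding z'_def using central[OF that]
      by (simp add: left_diff_distrib right_diff_distrib mult_scaleC_left mult_scaleC_right)
    \<comment> \<open>The representation keeps \<open>z\<close> diagonal, and subtracting
      \<open>a\<close> removes the entry \<open>(0, 0)\<close>: row 0 of \<open>z'\<close>
      vanishes.\<close>
    have F_z': "F 0 e z' = 0" for e
    proof -
      have "F 0 e z = 0" if "e \<noteq> 0"
        using F(1)[OF D_cont, of 0 e] rep D_cont that unfolding z_def D_def diagonal_rep_def by simp
      then show ?thesis
        unfolding z'_def using F(2)[OF z_V one_in_V, of 0 e a] F(5) F(6)[of 0 e] by (cases "e = 0") (auto simp: a_def)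
    qed
    \<comment> \<open>As \<open>z'\<close> is central, its multiples form an ideal of
      \<open>V\<close>. Row 0 of \<open>z'\<close> being 0, every multiple has entry
      \<open>(0, 0)\<close> equal to 0 and is therefore far from the unit. So the ideal is 0, and
      \<open>z\<close> is the scalar \<open>a\<close>.\<close>
    have "(\<lambda>x. z' * x) ` V = {0}"
    proof (rule simple_cstar_dense_ideal[OF simple closure_V])
      show "0 \<in> (\<lambda>x. z' * x) ` V" using zero_in_V by force
      show "x + y \<in> (\<lambda>x. z' * x) ` V" if "x \<in> (\<lambda>x. z' * x) ` V" "y \<in> (\<lambda>x. z' * x) ` V" for x y
        using that V_closed(1) by (auto simp: distrib_left[symmetric])
      show "scaleC c x \<in> (\<lambda>x. z' * x) ` V" if "x \<in> (\<lambda>x. z' * x) ` V" for c x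
        using that V_closed(3) by (auto simp: mult_scaleC_right[symmetric])
      show "b * x \<in> (\<lambda>x. z' * x) ` V \<and> x * b \<in> (\<lambda>x. z' * x) ` V"
        if b: "b \<in> V" and x: "x \<in> (\<lambda>x. z' * x) ` V" for b x
      proof -
        obtain y where y: "y \<in> V" "x = z' * y" using x by blast
        have "b * x = z' * (b * y)" "x * b = z' * (y * b)"
          unfolding y(2) using z'_central[OF b] by (simp_all add: mult.assoc[symmetric])
        then show ?thesis using V_closed(2) b y(1) by blast
      qed
      show "norm (1 - x) \<ge> 1" if "x \<in> (\<lambda>x. z' * x) ` V" for x
        using that z'_V by (auto intro!: far simp: V_closed F(3) F_z')
    qed
    then have "z' * 1 = 0" using one_in_V by blast
    then show "\<exists>a. M i (ent_diag (\<lambda>j' c x. if j' = j then g x else 0)) = scaleC a 1"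
      unfolding z'_def z_def D_def by (intro exI[of _ a]) simp
  qed
qed

end

theorem corollary3p1:
  fixes K :: "nat \<Rightarrow> nat"
    and n :: "nat \<Rightarrow> nat \<Rightarrow> nat"
    and X :: "nat \<Rightarrow> nat \<Rightarrow> 'x metric"
    and \<phi> :: "nat \<Rightarrow> (nat \<Rightarrow> 'x \<Rightarrow> complex mat) \<Rightarrow> (nat \<Rightarrow> 'x \<Rightarrow> complex mat)"
    and \<mu> :: "nat \<Rightarrow> (nat \<Rightarrow> 'x \<Rightarrow> complex mat) \<Rightarrow> 'b::unital_cstar_algebra"
  assumes "AH_diagonal_limit K n X \<phi> \<mu>"
    and "simple_cstar TYPE('b)"
  shows "singly_generated TYPE('b)"
proof -
  interpret ah_limit K n X \<phi> \<mu> using assms(1) by unfold_locales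
  show ?thesis
  proof (cases "\<forall>N i. \<exists>i'>i. \<forall>j<K i'. N \<le> n i' j")
    case True
    then show ?thesis by (intro singly_generated_if_growing) blast
  next
    \<comment> \<open>Failure of growth says that from some level on every level has at least one
      summand of size below \<open>N\<close>; the other summands may still be large.\<close>
    case False
    then obtain N i where "\<And>i'. i' > i \<Longrightarrow> \<exists>j<K i'. n i' j < N"
      by (meson not_le)
    then show ?thesis by (rule singly_generated_if_bounded[OF assms(2)])
  qed
qed

end
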